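(* Let $G=(V,E)$ be a directed tree with $|V|=n$, let each $f_i:\mathbb{R}\to\mathbb{R}$ ($i\in V$) be differentiable and strongly convex, and let $0\le\lambda_{i,j},\mu_{i,j}\le+\infty$ for $(i,j)\in E$. Assume that, for a given strongly convex differentiable function $f$ and $x\in\mathbb{R}$, the computational complexity of finding $t$ such that $f'(t)=x$ is $O(1)$. Then the worst-case computational complexity of the ASRA algorithm (described in full in the context) for solving $$\min_{x\in\mathbb{R}^{|V|}}\ \sum_{i\in V}f_i(x_i)+\sum_{(i,j)\in E}\lambda_{i,j}(x_i-x_j)_+ +\sum_{(i,j)\in E}\mu_{i,j}(x_j-x_i)_+$$ is $O(n^3)$.
   Context: **Cost model.** Real-number arithmetic, comparisons, and evaluations of $f_i'$ cost $O(1)$ each; finding $t$ with $f'(t)=x$ costs $O(1)$ for any strongly convex differentiable $f$, including sums of the $f_i$. **Problem conventions.** A directed tree is a finite directed graph whose underlying undirected graph is a tree. $(x)_+=\max(0,x)$. If $\lambda_{i,j}=+\infty$ the term $\lambda_{i,j}(x_i-x_j)_+$ means the constraint $x_i\le x_j$; if $\mu_{i,j}=+\infty$ the term $\mu_{i,j}(x_j-x_i)_+$ means the constraint $x_i\ge x_j$. $f^*$ denotes the convex conjugate; for $f$ differentiable and strongly convex on $\mathbb{R}$, $(f^* )'$ is the inverse function of $f'$. **Normalization.** Before running the algorithm, $G$ is re-oriented into an arborescence (a directed tree with exactly one node of in-degree zero, the root) with the same underlying tree: if an edge $(j,i)\in E$ is reversed to $(i,j)$, put $\hat\lambda_{i,j}=\mu_{j,i}$,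 $\hat\mu_{i,j}=\lambda_{j,i}$; parameters of other edges are unchanged. The problem is unchanged by this. Nodes are then labelled $1,\dots,n$ with root $1$ and $i<j$ for every edge $(i,j)$. For $1\le m\le n$ let $G_m=(V_m,E_m)$ be the subtree induced on $V_m=\{1,\dots,m\}$; then $E_{m+1}\setminus E_m=\{(i_m,m+1)\}$ with $i_m\in V_m$. **ASRA.** Set $x^{(1)}_1=(f_1^* )'(0)$, $z^{(1)}=\emptyset$. For $m=1,\dots,n-1$ set $(x^{(m+1)},z^{(m+1)})=\mathrm{generate}(x^{(m)},z^{(m)},G_{m+1})$. Return $(x^{(n)},z^{(n)})$. **generate.** Put $t_0=0$, $x^*_i(0)=x^{(m)}_i$ ($i\in V_m$), $x^*_{m+1}(0)=(f_{m+1}^* )'(0)$, $z^*(0)=z^{(m)}$. If $f'_{m+1}(x^{(m)}_{i_m})=0$, set $t^*=0$. Otherwise let $\mathcal A^0$ assign to each $(i,j)\in E_m$ the sign $\#\in\{<,=,>\}$ with $x^*_i(0)\,\#\,x^*_j(0)$ ($\mathcal A_\#$ denotes the set of edges with sign $\#$), and for $q=0,1,2,\dots$ repeat update$^-$ (if $f'_{m+1}(x^{(m)}_{i_m})>0$) or update$^+$ (if $f'_{m+1}(x^{(m)}_{i_m})<0$) to get $(t_{q+1},x^*(t_{q+1}),z^*(t_{q+1}),\mathcal A^{q+1})$ from $(t_q,x^*(t_q),z^*(t_q),\mathcal A^q)$, until $t^*$ is declared found. Output $x^{(m+1)}=x^*(t^* )$, $z^{(m+1)}_{i,j}=z^*_{i,j}(t^*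 )$ for $(i,j)\in E_m$, $z^{(m+1)}_{i_m,m+1}=t^*$. **Formulas used in both updates.** Let $B^q=(V_{B^q},E_{B^q})$ be the connected component containing $i_m$ of the graph $(V_m,\mathcal A^q_=)$ (edges viewed as undirected for connectivity). For $i,j\in V_{B^q}$ write $j\triangleleft i$ if the undirected path from $i_m$ to $i$ is strictly contained in the one from $i_m$ to $j$; $C_i=\{j\in V_{B^q}: j\triangleleft i\}\cup\{i\}$. For a node set $S\subseteq V_{B^q}$ let $\sigma(S)=\sum_{(l,k)\in E_m,\,l\in S,\,k\notin V_{B^q}}z^*_{l,k}(t_q)-\sum_{(k,l)\in E_m,\,l\in S,\,k\notin V_{B^q}}z^*_{k,l}(t_q)$, and $\beta^q=\sigma(V_{B^q})$. Define - $x^q_i(t)=x^*_i(t_q)$ for $i\in V_m\setminus V_{B^q}$; $x^q_i(t)=x_{B^q}(t):=\big((\sum_{l\in V_{B^q}}f_l)^*\big)'(t+\beta^q)$ for $i\in V_{B^q}$; $x^q_{m+1}(t)=(f_{m+1}^* )'(-t)$; - for $(i,j)\in E_{B^q}$: $z^q_{i,j}(t)=\sum_{l\in C_i}f_l'(x^q_l(t))-\sigma(C_i)$ if $i\triangleleft j$, and $z^q_{i,j}(t)=-\sum_{l\in C_j}f_l'(x^q_l(t))+\sigma(C_j)$ if $j\triangleleft i$; - $\tilde z^q_{i,j}(t)=z^q_{i,j}(t)$ for $(i,j)\in E_{B^q}$ and $\tilde z^q_{i,j}(t)=z^*_{i,j}(t_q)$ for $(i,j)\in E_m\setminus E_{B^q}$.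 Let $\Omega^q_+=\{(i,j)\in E_m: i\in V_{B^q},j\notin V_{B^q}\}$ and $\Omega^q_-=\{(i,j)\in E_m: i\notin V_{B^q},j\in V_{B^q}\}$. **update$^-$.** (1) For $(i,j)\in E_{B^q}$ let $\Delta t_{i,j}\le0$ solve $z^q_{i,j}(t_q+\Delta t_{i,j})=-\lambda_{i,j}$ if $i\triangleleft j$, resp. $=\mu_{i,j}$ if $j\triangleleft i$ ($\Delta t_{i,j}=-\infty$ if that bound is infinite); $\Delta(E_{B^q})=\max_{E_{B^q}}\Delta t_{i,j}$ ($-\infty$ if $E_{B^q}=\emptyset$). (2) $\Delta(\Omega^q_+)$ is the $\Delta$ with $x_{B^q}(t_q+\Delta)=\max_{(i,j)\in\Omega^q_+\cap\mathcal A^q_>}x^*_j(t_q)$, and $\Delta(\Omega^q_-)$ is the $\Delta$ with $x_{B^q}(t_q+\Delta)=\max_{(i,j)\in\Omega^q_-\cap\mathcal A^q_<}x^*_i(t_q)$ (each $-\infty$ if the index set is empty). (3) $\Delta t_q=\max\{\Delta(E_{B^q}),\Delta(\Omega^q_+),\Delta(\Omega^q_-)\}$; $\Delta\tilde t_q$ is the solution of $x^q_{i_m}(t_q+\Delta\tilde t_q)=x^q_{m+1}(t_q+\Delta\tilde t_q)$; $t_{q+1}=\max\{t_q+\Delta t_q,\ t_q+\Delta\tilde t_q,\ -\lambda_{i_m,m+1}\}$. (4) $x^*(t_{q+1})=x^q(t_{q+1})$, $z^*(t_{q+1})=\tilde z^q(t_{q+1})$. (5) If $t_{q+1}=-\lambda_{i_m,m+1}$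 or $x^*_{i_m}(t_{q+1})=x^*_{m+1}(t_{q+1})$, declare $t^*=t_{q+1}$. Otherwise let $\mathcal M(E^+_{B^q})$ (resp. $\mathcal M(E^-_{B^q})$) be the set of $(i,j)\in E_{B^q}$ with $\Delta t_{i,j}=\Delta t_q$ and $i\triangleleft j$ (resp. $j\triangleleft i$); $\mathcal M(\Omega^q_+)=\{(i,j)\in\Omega^q_+\cap\mathcal A^q_>: x^q_i(t_q+\Delta t_q)=x^*_j(t_q)\}$; $\mathcal M(\Omega^q_-)=\{(i,j)\in\Omega^q_-\cap\mathcal A^q_<: x^q_j(t_q+\Delta t_q)=x^*_i(t_q)\}$; and set $\mathcal A^{q+1}_= =(\mathcal A^q_=\cup\mathcal M(\Omega^q_+)\cup\mathcal M(\Omega^q_-))\setminus(\mathcal M(E^+_{B^q})\cup\mathcal M(E^-_{B^q}))$, $\mathcal A^{q+1}_> =(\mathcal A^q_>\cup\mathcal M(E^+_{B^q}))\setminus\mathcal M(\Omega^q_+)$, $\mathcal A^{q+1}_< =(\mathcal A^q_<\cup\mathcal M(E^-_{B^q}))\setminus\mathcal M(\Omega^q_-)$. **update$^+$.** (1) For $(i,j)\in E_{B^q}$ let $\Delta t_{i,j}\ge0$ solve $z^q_{i,j}(t_q+\Delta t_{i,j})=\mu_{i,j}$ if $i\triangleleft j$, resp. $=-\lambda_{i,j}$ if $j\triangleleft i$ ($+\infty$ if that bound is infinite); $\Delta(E_{B^q})=\min_{E_{B^q}}\Delta t_{i,j}$ ($+\infty$ if empty). (2) $\Delta(\Omega^q_+)$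 is the $\Delta$ with $x_{B^q}(t_q+\Delta)=\min_{(i,j)\in\Omega^q_+\cap\mathcal A^q_<}x^*_j(t_q)$; $\Delta(\Omega^q_-)$ is the $\Delta$ with $x_{B^q}(t_q+\Delta)=\min_{(i,j)\in\Omega^q_-\cap\mathcal A^q_>}x^*_i(t_q)$ ($+\infty$ if empty). (3) $\Delta t_q=\min\{\Delta(E_{B^q}),\Delta(\Omega^q_+),\Delta(\Omega^q_-)\}$; $\Delta\tilde t_q$ as in update$^-$; $t_{q+1}=\min\{t_q+\Delta t_q,\ t_q+\Delta\tilde t_q,\ \mu_{i_m,m+1}\}$. (4) As in update$^-$. (5) If $t_{q+1}=\mu_{i_m,m+1}$ or $x^*_{i_m}(t_{q+1})=x^*_{m+1}(t_{q+1})$, declare $t^*=t_{q+1}$. Otherwise, with $\mathcal M(E^\pm_{B^q})$ defined as in update$^-$, $\mathcal M(\Omega^q_+)=\{(i,j)\in\Omega^q_+\cap\mathcal A^q_<: x^q_i(t_q+\Delta t_q)=x^*_j(t_q)\}$, $\mathcal M(\Omega^q_-)=\{(i,j)\in\Omega^q_-\cap\mathcal A^q_>: x^q_j(t_q+\Delta t_q)=x^*_i(t_q)\}$, set $\mathcal A^{q+1}_=$ by the same formula as in update$^-$, $\mathcal A^{q+1}_> =(\mathcal A^q_>\cup\mathcal M(E^-_{B^q}))\setminus\mathcal M(\Omega^q_-)$, $\mathcal A^{q+1}_< =(\mathcal A^q_<\cup\mathcal M(E^+_{B^q}))\setminus\mathcal M(\Omega^q_+)$. *)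

theory Defs
  imports "HOL-Analysis.Analysis" "HOL-Library.While_Combinator" "HOL-Library.Monad_Syntax"
    "HOL-Library.Landau_Symbols"
begin

section \<open>The problem\<close>

definition strongly_convex :: "(real \<Rightarrow> real) \<Rightarrow> bool" where
  "strongly_convex f \<longleftrightarrow> (\<exists>c>0. \<forall>x y. \<forall>u\<in>{0..1}.
     f (u * x + (1 - u) * y) \<le> u * f x + (1 - u) * f y - c / 2 * u * (1 - u) * (x - y)\<^sup>2)"

definition differentiable_everywhere :: "(real \<Rightarrow> real) \<Rightarrow> bool" where
  "differentiable_everywhere f \<longleftrightarrow> (\<forall>x. f differentiable (at x))"

definition adjacent :: "(nat \<times> nat) set \<Rightarrow> nat \<Rightarrow> nat \<Rightarrow> bool" where
  "adjacent E u v \<longleftrightarrow> (u, v) \<in> E \<or> (v, u) \<in> E"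

definition undirected_path :: "(nat \<times> nat) set \<Rightarrow> nat \<Rightarrow> nat list \<Rightarrow> nat \<Rightarrow> bool" where
  "undirected_path E u p v \<longleftrightarrow>
     p \<noteq> [] \<and> hd p = u \<and> last p = v \<and> distinct p \<and> successively (adjacent E) p"

definition undirected_cycle :: "(nat \<times> nat) set \<Rightarrow> nat list \<Rightarrow> bool" where
  "undirected_cycle E p \<longleftrightarrow>
     3 \<le> length p \<and> distinct p \<and> successively (adjacent E) p \<and> adjacent E (last p) (hd p)"

text \<open>A pair of antiparallel arcs is a cycle of length two of the underlying multigraph, hence
  excluded.\<close>

definition directed_tree :: "nat set \<Rightarrow> (nat \<times> nat) set \<Rightarrow> bool" where
  "directed_tree V E \<longleftrightarrow>
     finite V \<and> V \<noteq> {} \<and> E \<subseteq> V \<times> V \<and> (\<forall>(u, v)\<in>E. u \<noteq> v \<and> (v, u) \<notin> E) \<and>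
     (\<forall>u\<in>V. \<forall>v\<in>V. \<exists>p. undirected_path E u p v) \<and> (\<nexists>p. undirected_cycle E p)"

definition arborescence :: "nat set \<Rightarrow> (nat \<times> nat) set \<Rightarrow> nat \<Rightarrow> bool" where
  "arborescence V E r \<longleftrightarrow> directed_tree V E \<and> {v \<in> V. \<forall>u. (u, v) \<notin> E} = {r}"

record tree_problem =
  nodes :: "nat set"
  arcs :: "(nat \<times> nat) set"
  loss :: "nat \<Rightarrow> real \<Rightarrow> real"
  lam :: "nat \<times> nat \<Rightarrow> ereal"
  mu :: "nat \<times> nat \<Rightarrow> ereal"

definition wf_problem :: "tree_problem \<Rightarrow> bool" where
  "wf_problem G \<longleftrightarrow> directed_tree (nodes G) (arcs G) \<and>
     (\<forall>i\<in>nodes G. differentiable_everywhere (loss G i) \<and> strongly_convex (loss G i)) \<and>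
     (\<forall>e\<in>arcs G. 0 \<le> lam G e \<and> 0 \<le> mu G e)"

text \<open>In \<^typ>\<open>ereal\<close>, \<open>\<infinity> * 0 = 0\<close> and \<open>\<infinity> * a = \<infinity>\<close> for \<open>a > 0\<close>, so an infinite weight is
  exactly the corresponding order constraint.\<close>

definition objective :: "tree_problem \<Rightarrow> (nat \<Rightarrow> real) \<Rightarrow> ereal" where
  "objective G x =
     (\<Sum>i\<in>nodes G. ereal (loss G i (x i)))
     + (\<Sum>(i, j)\<in>arcs G. lam G (i, j) * ereal (max 0 (x i - x j)))
     + (\<Sum>(i, j)\<in>arcs G. mu G (i, j) * ereal (max 0 (x j - x i)))"

definition is_minimizer :: "tree_problem \<Rightarrow> (nat \<Rightarrow> real) \<Rightarrow> bool" where
  "is_minimizer G x \<longleftrightarrow> (\<forall>y. objective G x \<le> objective G y)"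

section \<open>Normalization\<close>

text \<open>\<open>nu k\<close> is the node that receives label \<open>k\<close>. Since labels increase along arcs, the labelling
  determines the re-orientation.\<close>

definition normalized :: "tree_problem \<Rightarrow> (nat \<Rightarrow> nat) \<Rightarrow> tree_problem" where
  "normalized G nu = \<lparr>
     nodes = {1..card (nodes G)},
     arcs = {(i, j). i \<in> {1..card (nodes G)} \<and> j \<in> {1..card (nodes G)} \<and> i < j \<and>
                     adjacent (arcs G) (nu i) (nu j)},
     loss = (\<lambda>i. loss G (nu i)),
     lam = (\<lambda>(i, j). if (nu i, nu j) \<in> arcs G then lam G (nu i, nu j) else mu G (nu j, nu i)),
     mu = (\<lambda>(i, j). if (nu i, nu j) \<in> arcs G then mu G (nu i, nu j) else lam G (nu j, nu i))\<rparr>"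

definition normalizing :: "tree_problem \<Rightarrow> (nat \<Rightarrow> nat) \<Rightarrow> bool" where
  "normalizing G nu \<longleftrightarrow> bij_betw nu {1..card (nodes G)} (nodes G) \<and>
     arborescence (nodes (normalized G nu)) (arcs (normalized G nu)) 1"

section \<open>The algorithm\<close>

definition conjugate :: "(real \<Rightarrow> real) \<Rightarrow> real \<Rightarrow> real" where
  "conjugate f y = (SUP x. y * x - f x)"

datatype order_sign = LT | EQ | GT

definition compare_sign :: "real \<Rightarrow> real \<Rightarrow> order_sign" where
  "compare_sign a b = (if a < b then LT else if a = b then EQ else GT)"

record asra_state =
  tcur :: real
  xs :: "nat \<Rightarrow> real"
  zs :: "nat \<times> nat \<Rightarrow> real"
  sg :: "nat \<times> nat \<Rightarrow> order_sign"

context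
  fixes H :: tree_problem and m :: nat
begin

definition sub_arcs :: "(nat \<times> nat) set" where
  "sub_arcs = {(i, j) \<in> arcs H. i \<in> {1..m} \<and> j \<in> {1..m}}"

definition new_arc_tail :: nat where
  "new_arc_tail = (THE i. (i, Suc m) \<in> arcs H)"

text \<open>\<open>beyond j i\<close> is the relation \<open>j \<triangleleft> i\<close>. The paths run in the tree \<open>G\<^sub>m\<close>; between nodes of
  a block they coincide with the paths of the block.\<close>

definition path_to :: "nat \<Rightarrow> nat set" where
  "path_to i = set (THE p. undirected_path sub_arcs new_arc_tail p i)"

definition beyond :: "nat \<Rightarrow> nat \<Rightarrow> bool" where
  "beyond j i \<longleftrightarrow> path_to i \<subset> path_to j"

context
  fixes s :: asra_state
begin

definition eq_arcs :: "(nat \<times> nat) set" where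
  "eq_arcs = {e \<in> sub_arcs. sg s e = EQ}"

definition block :: "nat set" where
  "block = {j \<in> {1..m}. (new_arc_tail, j) \<in> (eq_arcs \<union> eq_arcs\<inverse>)\<^sup>*}"

definition block_arcs :: "(nat \<times> nat) set" where
  "block_arcs = {(i, j) \<in> eq_arcs. i \<in> block \<and> j \<in> block}"

definition omega_plus :: "(nat \<times> nat) set" where
  "omega_plus = {(i, j) \<in> sub_arcs. i \<in> block \<and> j \<notin> block}"

definition omega_minus :: "(nat \<times> nat) set" where
  "omega_minus = {(i, j) \<in> sub_arcs. i \<notin> block \<and> j \<in> block}"

definition cut_side :: "nat \<Rightarrow> nat set" where
  "cut_side i = {j \<in> block. beyond j i} \<union> {i}"

definition sigma :: "nat set \<Rightarrow> real" where
  "sigma S = (\<Sum>e\<in>{(l, k) \<in> sub_arcs. l \<in> S \<and> k \<notin> block}. zs s e)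
           - (\<Sum>e\<in>{(k, l) \<in> sub_arcs. l \<in> S \<and> k \<notin> block}. zs s e)"

definition block_x :: "real \<Rightarrow> real" where
  "block_x t = deriv (conjugate (\<lambda>x. \<Sum>l\<in>block. loss H l x)) (t + sigma block)"

definition xq :: "nat \<Rightarrow> real \<Rightarrow> real" where
  "xq i t = (if i \<in> block then block_x t
             else if i = Suc m then deriv (conjugate (loss H (Suc m))) (- t)
             else xs s i)"

definition zq :: "nat \<times> nat \<Rightarrow> real \<Rightarrow> real" where
  "zq e t = (case e of (i, j) \<Rightarrow>
     if beyond i j then (\<Sum>l\<in>cut_side i. deriv (loss H l) (xq l t)) - sigma (cut_side i)
     else - (\<Sum>l\<in>cut_side j. deriv (loss H l) (xq l t)) + sigma (cut_side j))"

definition z_tilde :: "real \<Rightarrow> nat \<times> nat \<Rightarrow> real" where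
  "z_tilde t e = (if e \<in> block_arcs then zq e t else zs s e)"

definition delta_meet :: real where
  "delta_meet = (THE d. xq new_arc_tail (tcur s + d) = xq (Suc m) (tcur s + d))"

definition delta_arc_minus :: "nat \<times> nat \<Rightarrow> ereal" where
  "delta_arc_minus e = (case e of (i, j) \<Rightarrow>
     let b = (if beyond i j then - lam H (i, j) else mu H (i, j)) in
     if \<bar>b\<bar> = \<infinity> then -\<infinity> else ereal (THE d. d \<le> 0 \<and> ereal (zq e (tcur s + d)) = b))"

definition delta_arc_plus :: "nat \<times> nat \<Rightarrow> ereal" where
  "delta_arc_plus e = (case e of (i, j) \<Rightarrow>
     let b = (if beyond i j then mu H (i, j) else - lam H (i, j)) in
     if \<bar>b\<bar> = \<infinity> then \<infinity> else ereal (THE d. 0 \<le> d \<and> ereal (zq e (tcur s + d)) = b))"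

text \<open>The Boolean component of the result tells whether \<open>t\<^sup>*\<close> has been found. The suprema and
  infima are over finite sets, with value \<open>-\<infinity>\<close> resp. \<open>\<infinity>\<close> on the empty set.\<close>

definition update_minus :: "asra_state \<times> bool" where
  "update_minus = (let
     wP = {e \<in> omega_plus. sg s e = GT};
     wM = {e \<in> omega_minus. sg s e = LT};
     dE = (SUP e\<in>block_arcs. delta_arc_minus e);
     dP = (if wP = {} then -\<infinity>
           else ereal (THE d. block_x (tcur s + d) = Max ((\<lambda>(i, j). xs s j) ` wP)));
     dM = (if wM = {} then -\<infinity>
           else ereal (THE d. block_x (tcur s + d) = Max ((\<lambda>(i, j). xs s i) ` wM)));
     dt = max dE (max dP dM);
     lim = - lam H (new_arc_tail, Suc m);
     t' = real_of_ereal (max (ereal (tcur s) + dt) (max (ereal (tcur s + delta_meet)) lim));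
     x' = (\<lambda>i. xq i t');
     found = (ereal t' = lim \<or> x' new_arc_tail = x' (Suc m));
     tq = tcur s + real_of_ereal dt;
     mEP = {(i, j) \<in> block_arcs. delta_arc_minus (i, j) = dt \<and> beyond i j};
     mEM = {(i, j) \<in> block_arcs. delta_arc_minus (i, j) = dt \<and> beyond j i};
     mP = {(i, j) \<in> wP. xq i tq = xs s j};
     mM = {(i, j) \<in> wM. xq j tq = xs s i};
     sg' = (\<lambda>e. if e \<in> mP \<union> mM then EQ else if e \<in> mEP then GT else if e \<in> mEM then LT
                else sg s e)
   in (\<lparr>tcur = t', xs = x', zs = z_tilde t', sg = (if found then sg s else sg')\<rparr>, found))"

definition update_plus :: "asra_state \<times> bool" where
  "update_plus = (let
     wP = {e \<in> omega_plus. sg s e = LT};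
     wM = {e \<in> omega_minus. sg s e = GT};
     dE = (INF e\<in>block_arcs. delta_arc_plus e);
     dP = (if wP = {} then \<infinity>
           else ereal (THE d. block_x (tcur s + d) = Min ((\<lambda>(i, j). xs s j) ` wP)));
     dM = (if wM = {} then \<infinity>
           else ereal (THE d. block_x (tcur s + d) = Min ((\<lambda>(i, j). xs s i) ` wM)));
     dt = min dE (min dP dM);
     lim = mu H (new_arc_tail, Suc m);
     t' = real_of_ereal (min (ereal (tcur s) + dt) (min (ereal (tcur s + delta_meet)) lim));
     x' = (\<lambda>i. xq i t');
     found = (ereal t' = lim \<or> x' new_arc_tail = x' (Suc m));
     tq = tcur s + real_of_ereal dt;
     mEP = {(i, j) \<in> block_arcs. delta_arc_plus (i, j) = dt \<and> beyond i j};
     mEM = {(i, j) \<in> block_arcs. delta_arc_plus (i, j) = dt \<and> beyond j i};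
     mP = {(i, j) \<in> wP. xq i tq = xs s j};
     mM = {(i, j) \<in> wM. xq j tq = xs s i};
     sg' = (\<lambda>e. if e \<in> mP \<union> mM then EQ else if e \<in> mEM then GT else if e \<in> mEP then LT
                else sg s e)
   in (\<lparr>tcur = t', xs = x', zs = z_tilde t', sg = (if found then sg s else sg')\<rparr>, found))"

end

definition generate ::
  "(nat \<Rightarrow> real) \<times> (nat \<times> nat \<Rightarrow> real) \<Rightarrow> ((nat \<Rightarrow> real) \<times> (nat \<times> nat \<Rightarrow> real)) option" where
  "generate = (\<lambda>(x, z). let
     g = deriv (loss H (Suc m)) (x new_arc_tail);
     s0 = \<lparr>tcur = 0, xs = x(Suc m := deriv (conjugate (loss H (Suc m))) 0), zs = z,
           sg = (\<lambda>(i, j). compare_sign (x i) (x j))\<rparr>;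
     upd = (if g > 0 then update_minus else update_plus)
   in map_option (\<lambda>(s, _). (xs s, (zs s)((new_arc_tail, Suc m) := tcur s)))
        (while_option (\<lambda>(s, found). \<not> found) (\<lambda>(s, _). upd s) (s0, g = 0)))"

end

primrec asra_iterate ::
  "tree_problem \<Rightarrow> nat \<Rightarrow> ((nat \<Rightarrow> real) \<times> (nat \<times> nat \<Rightarrow> real)) option" where
  "asra_iterate H 0 = Some ((\<lambda>_. deriv (conjugate (loss H 1)) 0), (\<lambda>_. 0))"
| "asra_iterate H (Suc k) = Option.bind (asra_iterate H k) (generate H (Suc k))"

definition asra :: "tree_problem \<Rightarrow> ((nat \<Rightarrow> real) \<times> (nat \<times> nat \<Rightarrow> real)) option" where
  "asra H = asra_iterate H (card (nodes H) - 1)"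

section \<open>Cost model\<close>

text \<open>A computation either diverges or yields a value together with the number of elementary steps
  it took.\<close>

datatype 'a tm = Diverges | Run 'a nat

definition bind_tm :: "'a tm \<Rightarrow> ('a \<Rightarrow> 'b tm) \<Rightarrow> 'b tm" where
  "bind_tm c f = (case c of Diverges \<Rightarrow> Diverges | Run a k \<Rightarrow>
     (case f a of Diverges \<Rightarrow> Diverges | Run b l \<Rightarrow> Run b (k + l)))"

adhoc_overloading Monad_Syntax.bind \<rightleftharpoons> bind_tm

text \<open>\<open>step e\<close> is one elementary statement; \<open>e\<close> is always an expression of bounded size built from
  accesses and updates of arrays (functions indexed by nodes, labels or arcs), (extended) real and label arithmetic, and
  comparisons. Everything else is charged separately: creating an array costs its length, and each
  loop iteration costs one in addition to its body.\<close>

definition step :: "'a \<Rightarrow> 'a tm" where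
  "step a = Run a 1"

definition new_array :: "nat \<Rightarrow> 'a \<Rightarrow> ('i \<Rightarrow> 'a) tm" where
  "new_array k a = Run (\<lambda>_. a) (Suc k)"

primrec for_tm :: "'i list \<Rightarrow> ('i \<Rightarrow> 's \<Rightarrow> 's tm) \<Rightarrow> 's \<Rightarrow> 's tm" where
  "for_tm [] body s = step s"
| "for_tm (i # is) body s = do { s0 \<leftarrow> step s; s1 \<leftarrow> body i s0; for_tm is body s1 }"

definition while_tm :: "('s \<Rightarrow> bool) \<Rightarrow> ('s \<Rightarrow> 's tm) \<Rightarrow> 's \<Rightarrow> 's tm" where
  "while_tm b body s = (case
     while_option (\<lambda>c. case c of Diverges \<Rightarrow> False | Run s _ \<Rightarrow> b s)
       (\<lambda>c. do { s0 \<leftarrow> c; s1 \<leftarrow> step s0; body s1 }) (step s)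
     of None \<Rightarrow> Diverges | Some c \<Rightarrow> c)"

text \<open>Sums of losses are handled symbolically: forming the sum of two of them is an elementary
  statement, and the only operation on them is the inversion of the derivative, whose cost is
  the parameter \<open>inv_cost\<close>. Derivatives are evaluated for the individual losses only.\<close>

datatype fsum = Single nat | Plus fsum fsum

primrec fsum_fun :: "(nat \<Rightarrow> real \<Rightarrow> real) \<Rightarrow> fsum \<Rightarrow> real \<Rightarrow> real" where
  "fsum_fun f (Single i) = f i"
| "fsum_fun f (Plus g h) = (\<lambda>x. fsum_fun f g x + fsum_fun f h x)"

datatype direction = Down | Up

definition worst :: "direction \<Rightarrow> ereal" where
  "worst d = (case d of Down \<Rightarrow> -\<infinity> | Up \<Rightarrow> \<infinity>)"

definition best :: "direction \<Rightarrow> ereal \<Rightarrow> ereal \<Rightarrow> ereal" where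
  "best d a b = (case d of Down \<Rightarrow> max a b | Up \<Rightarrow> min a b)"

section \<open>ASRA in the cost model\<close>

text \<open>The program works on the normalized problem: \<open>par k\<close> is the tail of the only arc with head
  \<open>k\<close>, for \<open>k \<ge> 2\<close>, and \<open>la\<close>, \<open>mv\<close> hold the weights of the normalized problem.\<close>

context
  fixes inv_cost :: "(real \<Rightarrow> real) \<Rightarrow> real \<Rightarrow> nat"
    and f :: "nat \<Rightarrow> real \<Rightarrow> real"
    and par :: "nat \<Rightarrow> nat"
    and la :: "nat \<times> nat \<Rightarrow> ereal"
    and mv :: "nat \<times> nat \<Rightarrow> ereal"
begin

definition deriv_tm :: "nat \<Rightarrow> real \<Rightarrow> real tm" where
  "deriv_tm i x = Run (deriv (f i) x) 1"

definition invert_tm :: "fsum \<Rightarrow> real \<Rightarrow> real tm" where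
  "invert_tm h y = Run (THE t. deriv (fsum_fun f h) t = y) (Suc (inv_cost (fsum_fun f h) y))"

text \<open>\<open>inB\<close> is the membership array of the block of \<open>i = i\<^sub>m\<close>; \<open>up\<close> marks the nodes of the block on
  the path from \<open>i\<close> towards the root of the arborescence, and for such a node \<open>k \<noteq> i\<close>, \<open>nxt k\<close> is its
  neighbour in the direction of \<open>i\<close>. For the other nodes of the block this neighbour is \<open>par k\<close>.\<close>

definition block_tm ::
  "nat \<Rightarrow> nat \<Rightarrow> (nat \<times> nat \<Rightarrow> order_sign)
   \<Rightarrow> ((nat \<Rightarrow> bool) \<times> (nat \<Rightarrow> bool) \<times> (nat \<Rightarrow> nat)) tm" where
  "block_tm m i sn = do {
     top0 \<leftarrow> new_array m 0;
     top \<leftarrow> for_tm [1..<Suc m] (\<lambda>k top. step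
       (top(k := if 2 \<le> k \<and> sn (par k, k) = EQ then top (par k) else k))) top0;
     inB0 \<leftarrow> new_array m False;
     inB \<leftarrow> for_tm [1..<Suc m] (\<lambda>k inB. step (inB(k := (top k = top i)))) inB0;
     up0 \<leftarrow> new_array m False;
     up1 \<leftarrow> step (up0(i := True));
     nxt0 \<leftarrow> new_array m 0;
     (up, nxt) \<leftarrow> for_tm (rev [2..<Suc m]) (\<lambda>k (up, nxt). step
       (if up k \<and> sn (par k, k) = EQ then (up(par k := True), nxt(par k := k)) else (up, nxt)))
       (up1, nxt0);
     step (inB, up, nxt)
   }"

text \<open>Turns the weights \<open>a k\<close> of the nodes of the block into the totals over \<open>C\<^sub>k\<close> (over the whole
  block for \<open>k = i\<close>), by adding the total of each node to its neighbour in the direction of \<open>i\<close>.\<close>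

definition accumulate_tm ::
  "nat \<Rightarrow> nat \<Rightarrow> (nat \<Rightarrow> bool) \<Rightarrow> (nat \<Rightarrow> bool) \<Rightarrow> (nat \<Rightarrow> nat) \<Rightarrow> ('a \<Rightarrow> 'a \<Rightarrow> 'a) \<Rightarrow> (nat \<Rightarrow> 'a)
   \<Rightarrow> (nat \<Rightarrow> 'a) tm" where
  "accumulate_tm m i inB up nxt add a = do {
     b \<leftarrow> for_tm (rev [2..<Suc m]) (\<lambda>k a. step
       (if inB k \<and> \<not> up k then a(par k := add (a (par k)) (a k)) else a)) a;
     for_tm [1..<Suc m] (\<lambda>k a. step
       (if up k \<and> k \<noteq> i then a(nxt k := add (a (nxt k)) (a k)) else a)) b
   }"

definition sigma_tm :: "nat \<Rightarrow> (nat \<Rightarrow> bool) \<Rightarrow> (nat \<times> nat \<Rightarrow> real) \<Rightarrow> (nat \<Rightarrow> real) tm" where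
  "sigma_tm m inB z = do {
     a0 \<leftarrow> new_array m 0;
     for_tm [2..<Suc m] (\<lambda>k a. step
       (if inB (par k) \<and> \<not> inB k then a(par k := a (par k) + z (par k, k))
        else if inB k \<and> \<not> inB (par k) then a(k := a k - z (par k, k))
        else a)) a0
   }"

text \<open>Since \<open>x\<^sub>B\<close> and the \<open>z\<^sub>i\<^sub>j\<close> are monotone in \<open>t\<close>, an event is located by the value of \<open>x\<^sub>B\<close> at which
  it happens. Only the first event of each of the three kinds is converted into a time increment,
  at the cost of one evaluation of the derivatives of all losses of the block. \<open>cand k\<close> is the value
  at which the arc between \<open>k\<close> and its neighbour in the direction of \<open>i\<close> reaches its bound.\<close>

definition candidates_tm ::
  "direction \<Rightarrow> nat \<Rightarrow> nat \<Rightarrow> (nat \<Rightarrow> bool) \<Rightarrow> (nat \<Rightarrow> bool) \<Rightarrow> (nat \<Rightarrow> nat) \<Rightarrow> (nat \<Rightarrow> real)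
   \<Rightarrow> (nat \<Rightarrow> fsum) \<Rightarrow> (nat \<Rightarrow> ereal) tm" where
  "candidates_tm d m i inB up nxt S F = do {
     c0 \<leftarrow> new_array m (worst d);
     for_tm [1..<Suc m] (\<lambda>k c.
       if inB k \<and> k \<noteq> i then do {
         b \<leftarrow> step (if up k then (case d of Down \<Rightarrow> - la (k, nxt k) | Up \<Rightarrow> mv (k, nxt k))
                   else (case d of Down \<Rightarrow> mv (par k, k) | Up \<Rightarrow> - la (par k, k)));
         if \<bar>b\<bar> = \<infinity> then step c
         else do {
           r \<leftarrow> step (if up k then real_of_ereal b + S k else S k - real_of_ereal b);
           y \<leftarrow> invert_tm (F k) r;
           step (c(k := ereal y))
         }
       }
       else step c) c0
   }"

definition first_tm :: "direction \<Rightarrow> nat list \<Rightarrow> (nat \<Rightarrow> bool) \<Rightarrow> (nat \<Rightarrow> ereal) \<Rightarrow> ereal tm" where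
  "first_tm d ks P v = for_tm ks (\<lambda>k r. step (if P k then best d r (v k) else r)) (worst d)"

definition increment_tm ::
  "direction \<Rightarrow> nat \<Rightarrow> (nat \<Rightarrow> bool) \<Rightarrow> real \<Rightarrow> real \<Rightarrow> ereal \<Rightarrow> ereal tm" where
  "increment_tm d m inB beta t v =
     (if \<bar>v\<bar> = \<infinity> then step (worst d)
      else do {
        w \<leftarrow> step (real_of_ereal v);
        r \<leftarrow> for_tm [1..<Suc m] (\<lambda>k r.
          if inB k then do { g \<leftarrow> deriv_tm k w; step (r + g) } else step r) 0;
        step (ereal (r - beta - t))
      })"

definition update_tm :: "direction \<Rightarrow> nat \<Rightarrow> nat \<Rightarrow> asra_state \<Rightarrow> (asra_state \<times> bool) tm" where
  "update_tm d m i s = do {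
     (inB, up, nxt) \<leftarrow> block_tm m i (sg s);
     S0 \<leftarrow> sigma_tm m inB (zs s);
     S \<leftarrow> accumulate_tm m i inB up nxt (+) S0;
     F0 \<leftarrow> new_array m (Single 0);
     F1 \<leftarrow> for_tm [1..<Suc m] (\<lambda>k F. step (F(k := Single k))) F0;
     F \<leftarrow> accumulate_tm m i inB up nxt Plus F1;
     cand \<leftarrow> candidates_tm d m i inB up nxt S F;
     vE \<leftarrow> first_tm d [1..<Suc m] (\<lambda>k. inB k \<and> k \<noteq> i) cand;
     let wP = (\<lambda>k. inB (par k) \<and> \<not> inB k \<and>
                     sg s (par k, k) = (case d of Down \<Rightarrow> GT | Up \<Rightarrow> LT));
     let wM = (\<lambda>k. \<not> inB (par k) \<and> inB k \<and>
                     sg s (par k, k) = (case d of Down \<Rightarrow> LT | Up \<Rightarrow> GT));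
     vP \<leftarrow> first_tm d [2..<Suc m] wP (\<lambda>k. ereal (xs s k));
     vM \<leftarrow> first_tm d [2..<Suc m] wM (\<lambda>k. ereal (xs s (par k)));
     dE \<leftarrow> increment_tm d m inB (S i) (tcur s) vE;
     dP \<leftarrow> increment_tm d m inB (S i) (tcur s) vP;
     dM \<leftarrow> increment_tm d m inB (S i) (tcur s) vM;
     dt \<leftarrow> step (best d dE (best d dP dM));
     y \<leftarrow> invert_tm (Plus (F i) (Single (Suc m))) (S i);
     g \<leftarrow> deriv_tm (Suc m) y;
     dmeet \<leftarrow> step (- g - tcur s);
     lim \<leftarrow> step (case d of Down \<Rightarrow> - la (i, Suc m) | Up \<Rightarrow> mv (i, Suc m));
     t' \<leftarrow> step (real_of_ereal
       (best d (ereal (tcur s) + dt) (best d (ereal (tcur s + dmeet)) lim)));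
     v \<leftarrow> invert_tm (F i) (t' + S i);
     w \<leftarrow> invert_tm (Single (Suc m)) (- t');
     x1 \<leftarrow> for_tm [1..<Suc m] (\<lambda>k x. step (if inB k then x(k := v) else x)) (xs s);
     x' \<leftarrow> step (x1(Suc m := w));
     D0 \<leftarrow> new_array m 0;
     D1 \<leftarrow> for_tm [1..<Suc m] (\<lambda>k D.
       if inB k then do { g \<leftarrow> deriv_tm k v; step (D(k := g)) } else step D) D0;
     D \<leftarrow> accumulate_tm m i inB up nxt (+) D1;
     z' \<leftarrow> for_tm [1..<Suc m] (\<lambda>k z. step
       (if inB k \<and> k \<noteq> i then
          (if up k then z((k, nxt k) := D k - S k) else z((par k, k) := - D k + S k))
        else z)) (zs s);
     found \<leftarrow> step (ereal t' = lim \<or> x' i = x' (Suc m));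
     if found then step (\<lparr>tcur = t', xs = x', zs = z', sg = sg s\<rparr>, True)
     else do {
       sg1 \<leftarrow> for_tm [1..<Suc m] (\<lambda>k r. step
         (if inB k \<and> k \<noteq> i \<and> cand k = ereal v then
            (if up k then r((k, nxt k) := (case d of Down \<Rightarrow> GT | Up \<Rightarrow> LT))
             else r((par k, k) := (case d of Down \<Rightarrow> LT | Up \<Rightarrow> GT)))
          else r)) (sg s);
       sg2 \<leftarrow> for_tm [2..<Suc m] (\<lambda>k r. step
         (if wP k \<and> xs s k = v \<or> wM k \<and> xs s (par k) = v then r((par k, k) := EQ) else r)) sg1;
       step (\<lparr>tcur = t', xs = x', zs = z', sg = sg2\<rparr>, False)
     }
   }"

definition generate_tm ::
  "nat \<Rightarrow> (nat \<Rightarrow> real) \<times> (nat \<times> nat \<Rightarrow> real) \<Rightarrow> ((nat \<Rightarrow> real) \<times> (nat \<times> nat \<Rightarrow> real)) tm" where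
  "generate_tm m = (\<lambda>(x, z). do {
     i \<leftarrow> step (par (Suc m));
     g \<leftarrow> deriv_tm (Suc m) (x i);
     w \<leftarrow> invert_tm (Single (Suc m)) 0;
     x0 \<leftarrow> step (x(Suc m := w));
     r0 \<leftarrow> new_array m EQ;
     sg0 \<leftarrow> for_tm [2..<Suc m] (\<lambda>k r. step
       (r((par k, k) := compare_sign (x (par k)) (x k)))) r0;
     (s, _) \<leftarrow> while_tm (\<lambda>(s, found). \<not> found)
       (\<lambda>(s, _). update_tm (if g > 0 then Down else Up) m i s)
       (\<lparr>tcur = 0, xs = x0, zs = z, sg = sg0\<rparr>, g = 0);
     step (xs s, (zs s)((i, Suc m) := tcur s))
   })"

definition asra_labelled_tm :: "nat \<Rightarrow> ((nat \<Rightarrow> real) \<times> (nat \<times> nat \<Rightarrow> real)) tm" where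
  "asra_labelled_tm n = do {
     v \<leftarrow> invert_tm (Single 1) 0;
     x0 \<leftarrow> new_array n v;
     z0 \<leftarrow> new_array n 0;
     for_tm [1..<n] generate_tm (x0, z0)
   }"

end

text \<open>Labels are assigned one at a time, each to the new end node of the first listed arc with exactly
  one labelled end node; the root is the first listed node. \<open>lab v = 0\<close> means that \<open>v\<close> has no label
  yet. With arbitrary listings of the nodes and arcs, every root and every labelling compatible with
  the normalization arises in this way (list the arcs by the labels of their heads).\<close>

definition normalize_tm ::
  "(nat \<times> nat \<Rightarrow> ereal) \<Rightarrow> (nat \<times> nat \<Rightarrow> ereal) \<Rightarrow> nat list \<Rightarrow> (nat \<times> nat) list
   \<Rightarrow> ((nat \<Rightarrow> nat) \<times> (nat \<Rightarrow> nat) \<times> (nat \<times> nat \<Rightarrow> ereal) \<times> (nat \<times> nat \<Rightarrow> ereal)) tm" where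
  "normalize_tm l u vs es = do {
     lab0 \<leftarrow> new_array (length vs) 0;
     lab1 \<leftarrow> step (lab0(hd vs := 1));
     nu0 \<leftarrow> new_array (length vs) (hd vs);
     par0 \<leftarrow> new_array (length vs) 0;
     la0 \<leftarrow> new_array (length vs) 0;
     mv0 \<leftarrow> new_array (length vs) 0;
     (lab, nu, par, la, mv) \<leftarrow> for_tm [1..<length vs] (\<lambda>m (lab, nu, par, la, mv). do {
       r \<leftarrow> for_tm es (\<lambda>(a, b) r. step
         (if r = None \<and> (lab a = 0) \<noteq> (lab b = 0) then Some (a, b) else r)) None;
       step (case r of None \<Rightarrow> (lab, nu, par, la, mv)
         | Some (a, b) \<Rightarrow>
             if lab b = 0 then
               (lab(b := Suc m), nu(Suc m := b), par(Suc m := lab a),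
                la((lab a, Suc m) := l (a, b)), mv((lab a, Suc m) := u (a, b)))
             else
               (lab(a := Suc m), nu(Suc m := a), par(Suc m := lab b),
                la((lab b, Suc m) := u (a, b)), mv((lab b, Suc m) := l (a, b))))
       }) (lab1, nu0, par0, la0, mv0);
     step (nu, par, la, mv)
   }"

text \<open>The input consists of the losses, the weights, and listings of the nodes and arcs. The result
  is the labelling, the computed solution on the original nodes, and the dual values on the labelled
  arcs.\<close>

definition asra_tm ::
  "((real \<Rightarrow> real) \<Rightarrow> real \<Rightarrow> nat) \<Rightarrow> (nat \<Rightarrow> real \<Rightarrow> real) \<Rightarrow> (nat \<times> nat \<Rightarrow> ereal)
   \<Rightarrow> (nat \<times> nat \<Rightarrow> ereal) \<Rightarrow> nat list \<Rightarrow> (nat \<times> nat) list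
   \<Rightarrow> ((nat \<Rightarrow> nat) \<times> (nat \<Rightarrow> real) \<times> (nat \<times> nat \<Rightarrow> real)) tm" where
  "asra_tm inv_cost f l u vs es = do {
     (nu, par, la, mv) \<leftarrow> normalize_tm l u vs es;
     fl0 \<leftarrow> new_array (length vs) (f (hd vs));
     fl \<leftarrow> for_tm [1..<Suc (length vs)] (\<lambda>k fl. step (fl(k := f (nu k)))) fl0;
     (x, z) \<leftarrow> asra_labelled_tm inv_cost fl par la mv (length vs);
     y0 \<leftarrow> new_array (length vs) 0;
     y \<leftarrow> for_tm [1..<Suc (length vs)] (\<lambda>k y. step (y(nu k := x k))) y0;
     step (nu, y, z)
   }"

end

theory Submission
  imports Defs
begin

text \<open>Optimality is a Karush-Kuhn-Tucker system: the derivative of the loss at each node is the net outflow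
  of a flow \<open>z\<close> on the arcs, where \<open>x\<^sub>i > x\<^sub>j\<close> forces \<open>z\<^sub>i\<^sub>j = - \<lambda>\<^sub>i\<^sub>j\<close>, \<open>x\<^sub>i < x\<^sub>j\<close> forces \<open>z\<^sub>i\<^sub>j = \<mu>\<^sub>i\<^sub>j\<close>, and
  \<open>x\<^sub>i = x\<^sub>j\<close> leaves \<open>z\<^sub>i\<^sub>j\<close> between these bounds. Stage \<open>m\<close> keeps this system valid on \<open>G\<^sub>m\<close> with an additional
  outflow \<open>t\<close> at \<open>i\<^sub>m\<close>. While \<open>t\<close> moves monotonically, the block of \<open>i\<^sub>m\<close> moves as a single node and all other
  nodes rest. With the tree rooted at \<open>i\<^sub>m\<close>, an arc can therefore join the block and later leave it, but it
  never returns. So a stage consists of at most \<open>2 m + 1\<close> updates, each of which takes linear time.\<close>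

section \<open>Strongly convex functions on the line: tangents, invertible derivatives and
  conjugates\<close>

section \<open>Strongly convex losses\<close>

text \<open>Two algorithms have to be related: the mathematical one, whose increments are definite
  descriptions and whose loop might not end, and the costed program, which finds the block by array
  passes and locates events by the value of the block instead of the time. They are not compared
  directly. Both satisfy one description of an update, \<open>update_spec\<close>, which fixes the
  outcome up to signs that are not read again. It lives in a model of a moving block
  (\<open>flow_block\<close>) in which arc orientation and the direction of motion have disappeared.
  There every branch of the block has a strictly increasing potential \<open>pot k\<close>, so each
  increment exists, is unique, and can be exchanged with the block value at which it occurs.

  This exchange is what makes an update linear: a candidate value costs one inversion, whereas
  turning it into a time costs a pass over the block, and only three values are turned into times.

  The signs of an arc have weights 2, 1, 0, which gives the \<open>2 * m\<close> in the number of
  updates; the one extra update is the last, which need not change a sign. Infinite weights cause no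
  event; this is encoded by the neutral value \<open>worst d\<close> of the extremum.\<close>

definition smooth_strongly_convex :: "(real \<Rightarrow> real) \<Rightarrow> bool" where
  "smooth_strongly_convex f \<longleftrightarrow> differentiable_everywhere f \<and> strongly_convex f"

text \<open>The description has the form of the value returned by \<open>invert_tm\<close>;
  \<open>deriv_conjugate\<close> identifies it with the derivative of the conjugate, the inverse
  used by the mathematical algorithm.\<close>

definition deriv_inv :: "(real \<Rightarrow> real) \<Rightarrow> real \<Rightarrow> real" where
  "deriv_inv f y = (THE t. deriv f t = y)"

lemma ssc_DERIV: "smooth_strongly_convex f \<Longrightarrow> (f has_real_derivative deriv f x) (at x)"
  unfolding smooth_strongly_convex_def differentiable_everywhere_def
  using DERIV_deriv_iff_real_differentiable by blast

text \<open>Strong convexity on the segment from \<open>x\<close> to \<open>y\<close>, divided by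
  \<open>u\<close>, bounds the difference quotient at \<open>x\<close>; as \<open>u\<close> tends to
  0 from the right, the factor \<open>1 - u\<close> of the quadratic term tends to 1, so that term
  survives.\<close>

lemma strong_tangent:
  assumes "smooth_strongly_convex f"
  obtains c where "c > 0" "\<And>x y. f y \<ge> f x + deriv f x * (y - x) + c / 2 * (y - x)\<^sup>2"
proof -
  obtain c where c: "c > 0" and cv: "\<And>x y u. u \<in> {0..1} \<Longrightarrow>
     f (u * x + (1 - u) * y) \<le> u * f x + (1 - u) * f y - c / 2 * u * (1 - u) * (x - y)\<^sup>2"
    using assms unfolding smooth_strongly_convex_def strongly_convex_def by blast
  have "f y \<ge> f x + deriv f x * (y - x) + c / 2 * (y - x)\<^sup>2" for x y
  proof -
    define p where "p u = f (x + u * (y - x))" for u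
    have "(p has_real_derivative deriv f x * (y - x)) (at 0)"
      unfolding p_def by (rule DERIV_chain2[where f = f]) (use ssc_DERIV[OF assms] in \<open>auto intro!: derivative_eq_intros\<close>)
    then have "((\<lambda>u. (p u - p 0) / (u - 0)) \<longlongrightarrow> deriv f x * (y - x)) (at_right 0)"
      by (simp add: has_field_derivative_iff filterlim_at_split)
    moreover have "((\<lambda>u. f y - f x - c / 2 * (1 - u) * (y - x)\<^sup>2) \<longlongrightarrow> f y - f x - c / 2 * (1 - 0) * (y - x)\<^sup>2) (at_right 0)"
      by (intro tendsto_intros)
    moreover have "\<forall>\<^sub>F u in at_right 0. (p u - p 0) / (u - 0) \<le> f y - f x - c / 2 * (1 - u) * (y - x)\<^sup>2"
      unfolding eventually_at_right_field
    proof (intro exI[of _ 1] conjI allI impI)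
      fix u :: real assume u: "0 < u" "u < 1"
      have "p u = f (u * y + (1 - u) * x)" unfolding p_def by (simp add: algebra_simps)
      also have "\<dots> \<le> u * f y + (1 - u) * f x - c / 2 * u * (1 - u) * (y - x)\<^sup>2"
        using cv[of u y x] u by auto
      finally have "p u - p 0 \<le> u * (f y - f x - c / 2 * (1 - u) * (y - x)\<^sup>2)"
        unfolding p_def by (simp add: algebra_simps)
      then show "(p u - p 0) / (u - 0) \<le> f y - f x - c / 2 * (1 - u) * (y - x)\<^sup>2"
        using u by (simp add: divide_le_eq mult.commute)
    qed simp
    ultimately have "deriv f x * (y - x) \<le> f y - f x - c / 2 * (1 - 0) * (y - x)\<^sup>2"
      by (intro tendsto_le[where F = "at_right 0" and x = "f y - f x - c / 2 * (1 - 0) * (y - x)\<^sup>2" and y = "deriv f x * (y - x)"]) auto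
    then show ?thesis by simp
  qed
  with c show ?thesis using that by blast
qed

lemma ssc_tangent:
  assumes "smooth_strongly_convex f" shows "f y \<ge> f x + deriv f x * (y - x)"
proof -
  obtain c where c: "c > 0" "\<And>x y. f y \<ge> f x + deriv f x * (y - x) + c / 2 * (y - x)\<^sup>2"
    by (rule strong_tangent[OF assms]) blast
  have "0 \<le> c / 2 * (y - x)\<^sup>2" using c(1) by simp
  then show ?thesis using c(2)[of x y] by linarith
qed

text \<open>The sum of the strong tangent inequalities at \<open>x\<close> and at \<open>y\<close>:
  the function values cancel and the two quadratic terms add up.\<close>

lemma deriv_strongly_monotone:
  assumes "smooth_strongly_convex f"
  obtains c where "c > 0" "\<And>x y. (deriv f y - deriv f x) * (y - x) \<ge> c * (y - x)\<^sup>2"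
proof -
  obtain c where c: "c > 0" "\<And>x y. f y \<ge> f x + deriv f x * (y - x) + c / 2 * (y - x)\<^sup>2"
    by (rule strong_tangent[OF assms]) blast
  have "(deriv f y - deriv f x) * (y - x) \<ge> c * (y - x)\<^sup>2" for x y
    using c(2)[of x y] c(2)[of y x] by (simp add: algebra_simps power2_eq_square)
  with c(1) show ?thesis using that by blast
qed

lemma deriv_strict_mono:
  assumes "smooth_strongly_convex f" shows "strict_mono (deriv f)"
proof (rule strict_monoI)
  fix x y :: real assume "x < y"
  obtain c where c: "c > 0" "\<And>x y. (deriv f y - deriv f x) * (y - x) \<ge> c * (y - x)\<^sup>2"
    by (rule deriv_strongly_monotone[OF assms]) blast
  have "0 < c * (y - x)\<^sup>2" using c(1) \<open>x < y\<close> by simp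
  then have "0 < (deriv f y - deriv f x) * (y - x)" using c(2)[of y x] by linarith
  then show "deriv f x < deriv f y" using \<open>x < y\<close> by (simp add: zero_less_mult_iff)
qed

text \<open>The function \<open>f - y \<cdot>\<close> is coercive, and its minimizer solves \<open>deriv f t = y\<close>.\<close>

lemma deriv_surj:
  assumes "smooth_strongly_convex f" shows "\<exists>t. deriv f t = y"
proof -
  obtain c where c: "c > 0" "\<And>x y. f y \<ge> f x + deriv f x * (y - x) + c / 2 * (y - x)\<^sup>2"
    by (rule strong_tangent[OF assms]) blast
  define p where "p t = f t - y * t" for t
  define b where "b = deriv f 0 - y"
  \<comment> \<open>Chosen so that for \<open>\<bar>t\<bar> \<ge> R\<close> the quadratic term of
    \<open>low\<close> outweighs the linear one; the minimum over the compact interval is then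
    global.\<close>
  define R where "R = 2 * \<bar>b\<bar> / c + 1"
  have R: "R > 0" using c(1) by (simp add: R_def add_nonneg_pos)
  have D: "(p has_real_derivative deriv f t - y) (at t)" for t
    unfolding p_def using ssc_DERIV[OF assms, of t] by (auto intro!: derivative_eq_intros)
  have low: "p t \<ge> p 0 + b * t + c / 2 * t\<^sup>2" for t
    using c(2)[of 0 t] by (simp add: p_def b_def algebra_simps)
  have far: "p t > p 0" if "\<bar>t\<bar> \<ge> R" for t
  proof -
    have "c / 2 * \<bar>t\<bar> \<ge> c / 2 * R" using that c(1) by simp
    also have "c / 2 * R = \<bar>b\<bar> + c / 2" using c(1) by (simp add: R_def field_simps)
    finally have "c / 2 * \<bar>t\<bar> > \<bar>b\<bar>" using c(1) by linarith
    then have "c / 2 * \<bar>t\<bar> * \<bar>t\<bar> > \<bar>b\<bar> * \<bar>t\<bar>" using that R by (intro mult_strict_right_mono) auto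
    moreover have "c / 2 * \<bar>t\<bar> * \<bar>t\<bar> = c / 2 * t\<^sup>2" by (simp add: power2_eq_square)
    moreover have "b * t \<ge> - (\<bar>b\<bar> * \<bar>t\<bar>)" by (metis abs_ge_minus_self abs_mult minus_le_iff)
    ultimately show ?thesis using low[of t] by linarith
  qed
  have "continuous_on {-R..R} p"
    using D DERIV_isCont continuous_at_imp_continuous_on by blast
  then obtain t where t: "t \<in> {-R..R}" "\<And>s. s \<in> {-R..R} \<Longrightarrow> p t \<le> p s"
    using continuous_attains_inf[of "{-R..R}" p] R by auto
  have t0: "p t \<le> p 0" using t(2)[of 0] R by simp
  have "p t \<le> p s" for s
    using t(2)[of s] far[of s] t0 by (smt (verit) atLeastAtMost_iff)
  then have "deriv f t - y = 0" using DERIV_local_min[OF D[of t], of 1] by simp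
  then show ?thesis by auto
qed

lemma deriv_deriv_inv [simp]: assumes "smooth_strongly_convex f" shows "deriv f (deriv_inv f y) = y"
proof -
  have "\<exists>!t. deriv f t = y"
    using deriv_surj[OF assms] strict_mono_eq[OF deriv_strict_mono[OF assms]] by metis
  then show ?thesis unfolding deriv_inv_def by (rule theI')
qed

lemma deriv_inv_unique: "smooth_strongly_convex f \<Longrightarrow> deriv f t = y \<Longrightarrow> deriv_inv f y = t"
  using strict_mono_eq[OF deriv_strict_mono] by (metis deriv_deriv_inv)

text \<open>By the tangent inequality the supremum is attained at \<open>g y\<close>, so
  \<open>g y\<close> is a subgradient of the conjugate at \<open>y\<close>. Strong monotonicity
  makes \<open>g\<close> Lipschitz with constant \<open>1 / c\<close>, and the subgradient
  inequalities at \<open>y\<close> and \<open>y + h\<close> squeeze the difference quotient.\<close>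

lemma deriv_conjugate:
  assumes "smooth_strongly_convex f" shows "deriv (conjugate f) y = deriv_inv f y"
proof -
  obtain c where c: "c > 0" "\<And>x y. (deriv f y - deriv f x) * (y - x) \<ge> c * (y - x)\<^sup>2"
    by (rule deriv_strongly_monotone[OF assms]) blast
  define g where "g = deriv_inv f"
  have fg: "deriv f (g y) = y" for y using assms by (simp add: g_def)
  have val: "conjugate f y = y * g y - f (g y)" for y
    unfolding conjugate_def
  proof (rule cSup_eq_maximum)
    show "y * g y - f (g y) \<in> range (\<lambda>x. y * x - f x)" by blast
    fix v assume "v \<in> range (\<lambda>x. y * x - f x)"
    then obtain x where "v = y * x - f x" by blast
    then show "v \<le> y * g y - f (g y)"
      using ssc_tangent[OF assms, where x = "g y" and y = x] by (simp add: fg algebra_simps)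
  qed
  have sub: "conjugate f b \<ge> conjugate f a + (b - a) * g a" for a b
    using ssc_tangent[OF assms, where x = "g b" and y = "g a"] by (simp add: val fg algebra_simps)
  have lip: "\<bar>g b - g a\<bar> \<le> \<bar>b - a\<bar> / c" for a b
  proof (cases "g b = g a")
    case False
    have "c * \<bar>g b - g a\<bar> * \<bar>g b - g a\<bar> \<le> (b - a) * (g b - g a)"
      using c(2)[of "g b" "g a"] by (simp add: fg power2_eq_square mult.assoc)
    also have "\<dots> \<le> \<bar>b - a\<bar> * \<bar>g b - g a\<bar>" by (metis abs_ge_self abs_mult)
    finally have "c * \<bar>g b - g a\<bar> \<le> \<bar>b - a\<bar>"
      using False by (simp add: mult_le_cancel_right)
    then show ?thesis using c(1) by (simp add: le_divide_eq mult.commute)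
  qed (use c(1) in simp)
  have "((\<lambda>h. (conjugate f (y + h) - conjugate f y) / h) \<longlongrightarrow> g y) (at 0)"
  proof (rule LIM_I)
    fix e :: real assume e: "e > 0"
    have "norm ((conjugate f (y + h) - conjugate f y) / h - g y) < e" if h: "h \<noteq> 0" "\<bar>h\<bar> < e * c" for h
    proof -
      let ?D = "conjugate f (y + h) - conjugate f y - h * g y"
      have "0 \<le> ?D" using sub[of y "y + h"] by simp
      moreover have "?D \<le> h * (g (y + h) - g y)" using sub[of "y + h" y] by (simp add: algebra_simps)
      ultimately have "\<bar>?D\<bar> \<le> \<bar>h\<bar> * \<bar>g (y + h) - g y\<bar>" unfolding abs_mult[symmetric] by linarith
      also have "\<dots> \<le> \<bar>h\<bar> * (\<bar>h\<bar> / c)" using lip[of "y + h" y] by (intro mult_left_mono) auto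
      also have "\<dots> < \<bar>h\<bar> * e" using h c(1) by (intro mult_strict_left_mono) (auto simp: divide_less_eq)
      finally have "\<bar>?D\<bar> / \<bar>h\<bar> < e" using h by (simp add: divide_less_eq mult.commute)
      moreover have "(conjugate f (y + h) - conjugate f y) / h - g y = ?D / h" using h by (simp add: field_simps)
      ultimately show ?thesis by simp
    qed
    then show "\<exists>s>0. \<forall>h. h \<noteq> 0 \<and> norm (h - 0) < s \<longrightarrow>
        norm ((conjugate f (y + h) - conjugate f y) / h - g y) < e"
      using e c(1) by (intro exI[of _ "e * c"]) auto
  qed
  then show ?thesis using DERIV_imp_deriv by (auto simp: DERIV_def g_def)
qed

lemma ssc_add:
  assumes "smooth_strongly_convex f" "smooth_strongly_convex g" shows "smooth_strongly_convex (\<lambda>x. f x + g x)"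
proof -
  obtain c where c: "c > 0" "\<And>x y u. u \<in> {0..1} \<Longrightarrow>
     f (u * x + (1 - u) * y) \<le> u * f x + (1 - u) * f y - c / 2 * u * (1 - u) * (x - y)\<^sup>2"
    using assms(1) unfolding smooth_strongly_convex_def strongly_convex_def by blast
  obtain d where d: "d > 0" "\<And>x y u. u \<in> {0..1} \<Longrightarrow>
     g (u * x + (1 - u) * y) \<le> u * g x + (1 - u) * g y - d / 2 * u * (1 - u) * (x - y)\<^sup>2"
    using assms(2) unfolding smooth_strongly_convex_def strongly_convex_def by blast
  have "f (u * x + (1 - u) * y) + g (u * x + (1 - u) * y)
      \<le> u * (f x + g x) + (1 - u) * (f y + g y) - (c + d) / 2 * u * (1 - u) * (x - y)\<^sup>2"
    if "u \<in> {0..1}" for x y u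
  proof -
    have "(c + d) / 2 * u * (1 - u) * (x - y)\<^sup>2
        = c / 2 * u * (1 - u) * (x - y)\<^sup>2 + d / 2 * u * (1 - u) * (x - y)\<^sup>2"
      by (simp add: add_divide_distrib distrib_right)
    then show ?thesis using c(2)[OF that, of x y] d(2)[OF that, of x y]
      unfolding distrib_left by linarith
  qed
  then have "strongly_convex (\<lambda>x. f x + g x)"
    unfolding strongly_convex_def using c(1) d(1) by (intro exI[of _ "c + d"]) auto
  moreover have "differentiable_everywhere (\<lambda>x. f x + g x)"
    using assms unfolding smooth_strongly_convex_def differentiable_everywhere_def by (auto intro!: differentiable_add)
  ultimately show ?thesis by (simp add: smooth_strongly_convex_def)
qed

lemma ssc_sum:
  assumes "finite S" "S \<noteq> {}" "\<And>l. l \<in> S \<Longrightarrow> smooth_strongly_convex (f l)"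
  shows "smooth_strongly_convex (\<lambda>x. \<Sum>l\<in>S. f l x)"
  using assms
proof (induction S rule: finite_ne_induct)
  case (insert a S)
  then show ?case using ssc_add[of "f a" "\<lambda>x. \<Sum>l\<in>S. f l x"] by simp
qed simp

lemma deriv_add_ssc: "smooth_strongly_convex f \<Longrightarrow> smooth_strongly_convex g \<Longrightarrow> deriv (\<lambda>x. f x + g x) x = deriv f x + deriv g x"
  by (rule DERIV_imp_deriv) (intro DERIV_add ssc_DERIV)

lemma deriv_sum_ssc:
  assumes "finite S" "\<And>l. l \<in> S \<Longrightarrow> smooth_strongly_convex (f l)"
  shows "deriv (\<lambda>x. \<Sum>l\<in>S. f l x) x = (\<Sum>l\<in>S. deriv (f l) x)"
  by (rule DERIV_imp_deriv) (intro DERIV_sum ssc_DERIV assms)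

section \<open>A calculus of postconditions and cost bounds for the cost monad\<close>

section \<open>Running times\<close>

text \<open>A total correctness triple: demanding a result of the form \<open>Run a k\<close>
  includes termination, and the bounds \<open>N\<close> simply add up under
  \<open>bind_tm\<close>.\<close>

definition runs :: "'a tm \<Rightarrow> ('a \<Rightarrow> bool) \<Rightarrow> nat \<Rightarrow> bool" where
  "runs c P N \<longleftrightarrow> (\<exists>a k. c = Run a k \<and> P a \<and> k \<le> N)"

lemma runs_weaken: "runs c P N \<Longrightarrow> (\<And>a. P a \<Longrightarrow> Q a) \<Longrightarrow> N \<le> M \<Longrightarrow> runs c Q M"
  unfolding runs_def by fastforce

lemma runs_bind:
  assumes "runs c P N" "\<And>a. P a \<Longrightarrow> runs (f a) Q M"
  shows "runs (bind_tm c f) Q (N + M)"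
proof -
  obtain a k where a: "c = Run a k" "P a" "k \<le> N" using assms(1) unfolding runs_def by blast
  obtain b l where "f a = Run b l" "Q b" "l \<le> M" using assms(2)[OF a(2)] unfolding runs_def by blast
  with a show ?thesis by (auto simp: runs_def bind_tm_def)
qed

lemma runs_step: "P a \<Longrightarrow> runs (step a) P (Suc 0)"
  by (simp add: runs_def step_def)

lemma runs_new_array: "P (\<lambda>_. a) \<Longrightarrow> runs (new_array k a) P (Suc k)"
  by (simp add: runs_def new_array_def)

text \<open>The invariant speaks about the prefix already processed. The \<open>+ 1\<close> per
  element is the step that \<open>for_tm\<close> charges for each iteration, the final
  \<open>+ 1\<close> its step on the empty list.\<close>

lemma runs_for_invariant:
  assumes "I [] s"
    and "\<And>pre k post s. L = pre @ k # post \<Longrightarrow> I pre s \<Longrightarrow> runs (body k s) (I (pre @ [k])) N"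
  shows "runs (for_tm L body s) (I L) (length L * (N + 1) + 1)"
proof -
  have "runs (for_tm post body s) (I L) (length post * (N + 1) + 1)"
    if "L = pre @ post" "I pre s" for pre post s
    using that
  proof (induction post arbitrary: pre s)
    case Nil
    then show ?case by (simp add: runs_def step_def)
  next
    case (Cons k post)
    have "runs (body k s) (I (pre @ [k])) N" using assms(2) Cons.prems by simp
    then have "runs (for_tm (k # post) body s) (I L) (1 + (N + (length post * (N + 1) + 1)))"
      unfolding for_tm.simps
    proof (intro runs_bind)
      show "runs (step s) (\<lambda>s0. s0 = s) 1" by (simp add: runs_step)
      show "runs (body k s0) (I (pre @ [k])) N" if "s0 = s" for s0
        using that \<open>runs (body k s) (I (pre @ [k])) N\<close> by simp
      show "runs (for_tm post body s1) (I L) (length post * (N + 1) + 1)" if "I (pre @ [k]) s1" for s1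
        using Cons.IH[of "pre @ [k]"] Cons.prems(1) that by simp
    qed
    then show ?case by (simp add: algebra_simps)
  qed
  from this[of "[]" L s] assms(1) show ?thesis by simp
qed

lemma runs_for_fold:
  assumes "\<And>k s. k \<in> set L \<Longrightarrow> runs (body k s) (\<lambda>s'. s' = f k s) N"
  shows "runs (for_tm L body s) (\<lambda>s'. s' = fold f L s) (length L * (N + 1) + 1)"
  using runs_for_invariant[of "\<lambda>pre s'. s' = fold f pre s" s L body N] assms by simp

lemma runs_for_step:
  "runs (for_tm L (\<lambda>k s. step (f k s)) s) (\<lambda>s'. s' = fold f L s) (length L * 2 + 1)"
  using runs_for_fold[of L "\<lambda>k s. step (f k s)" f 1 s] by (simp add: runs_def step_def mult_2_right)

lemma upt_eq_append_Cons:
  assumes "[a..<b] = pre @ k # post" shows "pre = [a..<k] \<and> a \<le> k \<and> k < b"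
proof -
  have n: "k = [a..<b] ! length pre" "length pre < length [a..<b]" using assms by simp_all
  then have k: "k = a + length pre" "k < b" by auto
  have "pre = take (length pre) [a..<b]" using assms by simp
  also have "\<dots> = [a..<k]" using k by (simp add: take_upt)
  finally show ?thesis using k by simp
qed

lemma runs_for_upt:
  assumes "a \<le> b" "I a s"
    and "\<And>k s. a \<le> k \<Longrightarrow> k < b \<Longrightarrow> I k s \<Longrightarrow> runs (body k s) (I (Suc k)) N"
  shows "runs (for_tm [a..<b] body s) (I b) ((b - a) * (N + 1) + 1)"
proof -
  have "runs (for_tm [a..<b] body s) (\<lambda>s. I (a + length [a..<b]) s) (length [a..<b] * (N + 1) + 1)"
    by (rule runs_for_invariant[where I = "\<lambda>pre s. I (a + length pre) s"])
       (use assms in \<open>auto dest!: upt_eq_append_Cons\<close>)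
  then show ?thesis using assms(1) by simp
qed

lemma runs_for_down:
  assumes "a \<le> b" "I b s"
    and "\<And>k s. a \<le> k \<Longrightarrow> k < b \<Longrightarrow> I (Suc k) s \<Longrightarrow> runs (body k s) (I k) N"
  shows "runs (for_tm (rev [a..<b]) body s) (I a) ((b - a) * (N + 1) + 1)"
proof -
  have *: "runs (body k s) (I (b - length (pre @ [k]))) N"
    if eq: "rev [a..<b] = pre @ k # post" and I: "I (b - length pre) s" for pre k post s
  proof -
    have "[a..<b] = rev post @ k # rev pre" using eq by (metis rev_append rev_rev_ident rev.simps(2) append.assoc append_Cons append_Nil)
    then have "length [a..<b] = length (rev post @ k # rev pre)" "rev post = [a..<k]" "a \<le> k" "k < b"
      using upt_eq_append_Cons by (metis, blast+)
    moreover from this(2) have "length post = k - a" by (metis length_rev length_upt)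
    ultimately have "a \<le> k" "k < b" "b - length pre = Suc k" "b - length (pre @ [k]) = k"
      by auto
    then show ?thesis using assms(3) I by simp
  qed
  have "runs (for_tm (rev [a..<b]) body s) (\<lambda>s. I (b - length (rev [a..<b])) s)
     (length (rev [a..<b]) * (N + 1) + 1)"
    by (rule runs_for_invariant[where I = "\<lambda>pre s. I (b - length pre) s"]) (use assms * in auto)
  then show ?thesis using assms(1) by simp
qed

text \<open>The pure loop and the costed loop run in lockstep, so termination of both comes out of
  one induction. The measure has to decrease only if the loop goes on afterwards; the terminating
  iteration is exempt, hence the factor \<open>\<nu> s + 1\<close>.\<close>

lemma runs_while_simulation:
  fixes R :: "'s \<Rightarrow> 't \<Rightarrow> bool" and \<nu> :: "'s \<Rightarrow> nat"
  assumes sim: "\<And>s t. R s t \<Longrightarrow> b s \<Longrightarrow> runs (body t) (R (upd s)) C"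
    and cond: "\<And>s t. R s t \<Longrightarrow> b' t = b s"
    and less: "\<And>s t. R s t \<Longrightarrow> b s \<Longrightarrow> b (upd s) \<Longrightarrow> \<nu> (upd s) < \<nu> s"
    and start: "R s t"
  shows "\<exists>s'. while_option b upd s = Some s' \<and> \<not> b s' \<and>
    runs (while_tm b' body t) (R s') ((\<nu> s + 1) * (C + 1) + 1)"
proof -
  let ?b = "\<lambda>c. case c of Diverges \<Rightarrow> False | Run s _ \<Rightarrow> b' s"
  let ?F = "\<lambda>c. bind_tm c (\<lambda>s0. bind_tm (step s0) body)"
  have "\<exists>s' t' k'. while_option b upd s = Some s' \<and> \<not> b s' \<and> R s' t' \<and>
      while_option ?b ?F (Run t k) = Some (Run t' k') \<and> k' \<le> k + (\<nu> s + 1) * (C + 1)"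
    if "R s t" for s t k
    using that
  proof (induction "\<nu> s" arbitrary: s t k rule: less_induct)
    case less
    show ?case
    proof (cases "b s")
      case False
      then show ?thesis using less.prems cond
        by (subst (1 2) while_option_unfold) auto
    next
      case True
      obtain t1 k1 where t1: "body t = Run t1 k1" "R (upd s) t1" "k1 \<le> C"
        using sim[OF less.prems True] unfolding runs_def by blast
      have F: "?F (Run t k) = Run t1 (k + (1 + k1))" by (simp add: bind_tm_def step_def t1)
      show ?thesis
      proof (cases "b (upd s)")
        case False
        then show ?thesis using True less.prems cond t1 F
          by (subst (1 2) while_option_unfold, subst (1 2) while_option_unfold) auto
      next
        case b: True
        obtain s' t' k' where "while_option b upd (upd s) = Some s'" "\<not> b s'" "R s' t'"
          "while_option ?b ?F (Run t1 (k + (1 + k1))) = Some (Run t' k')"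
          and k': "k' \<le> k + (1 + k1) + (\<nu> (upd s) + 1) * (C + 1)"
          using less.hyps[OF assms(3)[OF less.prems True b] t1(2)] by blast
        moreover have "k' \<le> k + (\<nu> s + 1) * (C + 1)"
        proof -
          have "\<nu> (upd s) + 1 \<le> \<nu> s" using assms(3)[OF less.prems True b] by simp
          then have "(\<nu> (upd s) + 1) * (C + 1) \<le> \<nu> s * (C + 1)" by (rule mult_le_mono1)
          then show ?thesis using k' t1(3) by (simp add: algebra_simps)
        qed
        ultimately show ?thesis using True less.prems cond F
          by (subst (1 2) while_option_unfold) auto
      qed
    qed
  qed
  from this[OF start, of 1] show ?thesis
    unfolding runs_def while_tm_def step_def by fastforce
qed

section \<open>Paths, branches and accumulation in a rooted tree\<close>

section \<open>Rooted trees\<close>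

text \<open>The tree is given by the map \<open>nx\<close> that moves each node one step towards the root.\<close>

locale rooted_tree =
  fixes V :: "nat set" and r :: nat and nx :: "nat \<Rightarrow> nat" and rk :: "nat \<Rightarrow> nat"
  assumes finite_V: "finite V" and root: "r \<in> V"
    and nx_V: "\<And>k. k \<in> V \<Longrightarrow> k \<noteq> r \<Longrightarrow> nx k \<in> V"
    and rk_nx: "\<And>k. k \<in> V \<Longrightarrow> k \<noteq> r \<Longrightarrow> rk (nx k) < rk k"
begin

definition toward :: "(nat \<times> nat) set" where
  "toward = {(k, nx k) |k. k \<in> V \<and> k \<noteq> r}"

text \<open>For \<open>k\<close> in \<open>V\<close> this is the node set of the path between
  \<open>k\<close> and the root; \<open>set_path_from_root\<close> identifies it with the paths
  behind \<open>beyond\<close>.\<close>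

definition chain :: "nat \<Rightarrow> nat set" where
  "chain k = {j. (k, j) \<in> toward\<^sup>*}"

lemma toward_iff: "(k, j) \<in> toward \<longleftrightarrow> k \<in> V \<and> k \<noteq> r \<and> j = nx k"
  by (auto simp: toward_def)

lemma single_valued_toward: "single_valued toward"
  by (auto simp: single_valued_def toward_iff)

lemma nx_neq: "k \<in> V \<Longrightarrow> k \<noteq> r \<Longrightarrow> nx k \<noteq> k"
  using rk_nx by force

lemma toward_rk: "(l, k) \<in> toward\<^sup>* \<Longrightarrow> l = k \<or> rk k < rk l"
proof (induction rule: rtrancl_induct)
  case (step y z)
  then show ?case using rk_nx[of y] by (auto simp: toward_iff)
qed simp

lemma toward_unfold:
  "(k, j) \<in> toward\<^sup>* \<longleftrightarrow> k = j \<or> k \<in> V \<and> k \<noteq> r \<and> (nx k, j) \<in> toward\<^sup>*"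
  by (metis converse_rtranclE converse_rtrancl_into_rtrancl rtrancl.rtrancl_refl toward_iff)

lemma toward_antisym: "(k, j) \<in> toward\<^sup>* \<Longrightarrow> (j, k) \<in> toward\<^sup>* \<Longrightarrow> j = k"
  using toward_rk[of k j] toward_rk[of j k] by auto

lemma chain_root: "chain r = {r}"
  unfolding chain_def by (auto simp: toward_unfold[of r])

lemma chain_nx: "k \<in> V \<Longrightarrow> k \<noteq> r \<Longrightarrow> chain k = insert k (chain (nx k))"
  unfolding chain_def by (auto simp: toward_unfold[of k])

lemma self_notin_chain_nx: "k \<in> V \<Longrightarrow> k \<noteq> r \<Longrightarrow> k \<notin> chain (nx k)"
  unfolding chain_def using toward_rk[of "nx k" k] rk_nx[of k] by fastforce

lemma root_in_chain: "k \<in> V \<Longrightarrow> (k, r) \<in> toward\<^sup>*"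
proof (induction "rk k" arbitrary: k rule: less_induct)
  case less
  then show ?case using nx_V rk_nx by (subst toward_unfold) blast
qed

text \<open>Replaces the strict inclusion of paths, by which \<open>beyond\<close> is defined, by
  reachability along \<open>toward\<close>.\<close>

lemma psubset_chain_iff:
  assumes "i \<in> V" "j \<in> V"
  shows "chain i \<subset> chain j \<longleftrightarrow> (j, i) \<in> toward\<^sup>* \<and> i \<noteq> j"
proof
  assume "chain i \<subset> chain j"
  then show "(j, i) \<in> toward\<^sup>* \<and> i \<noteq> j" unfolding chain_def by blast
next
  assume a: "(j, i) \<in> toward\<^sup>* \<and> i \<noteq> j"
  then have "j \<notin> chain i" unfolding chain_def using toward_antisym by auto
  moreover have "j \<in> chain j" unfolding chain_def by simp
  moreover have "chain i \<subseteq> chain j" unfolding chain_def using a by auto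
  ultimately show "chain i \<subset> chain j" by blast
qed

end

locale rooted_tree_arcs = rooted_tree +
  fixes E :: "(nat \<times> nat) set"
  assumes adjacent_iff: "\<And>u v. adjacent E u v \<longleftrightarrow> (u, v) \<in> toward \<or> (v, u) \<in> toward"
begin

lemma successively_snoc:
  "successively P (p @ [y]) \<longleftrightarrow> successively P p \<and> (p \<noteq> [] \<longrightarrow> P (last p) y)"
  by (auto simp: successively_append_iff)

text \<open>A step towards the root is impossible: each node has at most one \<open>toward\<close>
  successor, and on a path that came down this is the preceding node, which a distinct list cannot
  revisit; the root has none.\<close>

lemma path_from_root_descends:
  assumes "hd p = r" "distinct p" "successively (adjacent E) p"
  shows "successively (\<lambda>u v. (v, u) \<in> toward) p"
  using assms
proof (induction p rule: rev_induct)
  case (snoc b p)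
  show ?case
  proof (cases "p = []")
    case False
    then obtain q a where p: "p = q @ [a]" by (metis append_butlast_last_id)
    have IH: "successively (\<lambda>u v. (v, u) \<in> toward) p"
      using snoc False by (auto simp: successively_append_iff)
    have "adjacent E (last p) b" using snoc.prems(3) False by (simp add: successively_snoc)
    then have "adjacent E a b" using p by simp
    moreover have "(a, b) \<notin> toward"
    proof
      assume ab: "(a, b) \<in> toward"
      show False
      proof (cases "q = []")
        case True
        then show False using ab snoc.prems(1) p by (simp add: toward_iff)
      next
        case False
        then have "(a, last q) \<in> toward" using IH p by (simp add: successively_snoc)
        then have "last q = b" using ab by (simp add: toward_iff)
        then show False using snoc.prems(2) p False by auto
      qed
    qed
    ultimately show ?thesis unfolding successively_snoc using IH p by (auto simp: adjacent_iff)
  qed simp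
qed simp

text \<open>Both paths lead away from the root throughout, so on each the node before the common end
  \<open>k\<close> is \<open>nx k\<close>; dropping the end gives the induction.\<close>

lemma path_from_root_unique:
  assumes "undirected_path E r p k" "undirected_path E r q k"
  shows "p = q"
proof -
  have "p = q" if "p \<noteq> []" "hd p = r" "q \<noteq> []" "hd q = r" "last p = last q" "distinct p" "distinct q"
    "successively (\<lambda>u v. (v, u) \<in> toward) p" "successively (\<lambda>u v. (v, u) \<in> toward) q" for p q
    using that
  proof (induction p arbitrary: q rule: rev_induct)
    case (snoc k p)
    obtain q' where q: "q = q' @ [k]" using snoc.prems by (metis append_butlast_last_id last_snoc)
    show ?case
    proof (cases "k = r")
      case True
      have *: "w = []" if "hd (w @ [r]) = r" "distinct (w @ [r])" for w
        using that by (cases w) auto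
      have "p = []" "q' = []" using snoc.prems q True by (auto intro: *)
      then show ?thesis using q by simp
    next
      case False
      then have ne: "p \<noteq> []" "q' \<noteq> []" using snoc.prems q by auto
      then have "(k, last p) \<in> toward" "(k, last q') \<in> toward"
        using snoc.prems q by (auto simp: successively_snoc)
      then have "last p = last q'" by (simp add: toward_iff)
      then show ?thesis using snoc.IH[of q'] snoc.prems ne q by (auto simp: successively_snoc)
    qed
  qed simp
  then show ?thesis using assms path_from_root_descends unfolding undirected_path_def by simp
qed

lemma path_from_root_exists: "k \<in> V \<Longrightarrow> \<exists>p. undirected_path E r p k \<and> set p = chain k"
proof (induction "rk k" arbitrary: k rule: less_induct)
  case less
  show ?case
  proof (cases "k = r")
    case True
    then show ?thesis by (intro exI[of _ "[r]"]) (simp add: undirected_path_def chain_root)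
  next
    case False
    then obtain p where p: "undirected_path E r p (nx k)" "set p = chain (nx k)"
      using less nx_V rk_nx by blast
    have "undirected_path E r (p @ [k]) k"
      using p self_notin_chain_nx[OF less.prems False] less.prems False
      unfolding undirected_path_def by (auto simp: successively_snoc adjacent_iff toward_iff)
    moreover have "set (p @ [k]) = chain k" using p(2) chain_nx[OF less.prems False] by simp
    ultimately show ?thesis by blast
  qed
qed

lemma set_path_from_root: "k \<in> V \<Longrightarrow> set (THE p. undirected_path E r p k) = chain k"
  using path_from_root_exists path_from_root_unique by (metis (mono_tags, lifting) theI)

end

locale rooted_subtree = rooted_tree +
  fixes B :: "nat set"
  assumes B_V: "B \<subseteq> V" and root_B: "r \<in> B"
    and nx_B: "\<And>k. k \<in> B \<Longrightarrow> k \<noteq> r \<Longrightarrow> nx k \<in> B"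
begin

text \<open>For \<open>k\<close> in the block, \<open>branch k\<close> is the set \<open>C\<^sub>k\<close>.\<close>

definition branch :: "nat \<Rightarrow> nat set" where
  "branch k = {l \<in> B. (l, k) \<in> toward\<^sup>*}"

definition children :: "nat \<Rightarrow> nat set" where
  "children k = {c \<in> B. c \<noteq> r \<and> nx c = k}"

lemma finite_B: "finite B"
  using B_V finite_V finite_subset by blast

lemma finite_branch: "finite (branch k)"
  unfolding branch_def using finite_B by simp

lemma branch_B: "branch k \<subseteq> B"
  unfolding branch_def by blast

lemma self_in_branch: "k \<in> B \<Longrightarrow> k \<in> branch k"
  by (simp add: branch_def)

lemma branch_root: "branch r = B"
  unfolding branch_def using root_in_chain B_V by blast

lemma finite_children: "finite (children k)"
  unfolding children_def using finite_B by simp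

lemma branch_rec:
  assumes "k \<in> B" shows "branch k = insert k (\<Union>c\<in>children k. branch c)"
proof
  show "branch k \<subseteq> insert k (\<Union>c\<in>children k. branch c)"
  proof
    fix l assume "l \<in> branch k"
    then have l: "l \<in> B" "(l, k) \<in> toward\<^sup>*" by (auto simp: branch_def)
    show "l \<in> insert k (\<Union>c\<in>children k. branch c)"
    proof (cases "l = k")
      case False
      then obtain c where c: "(l, c) \<in> toward\<^sup>*" "(c, k) \<in> toward" using l(2) by (metis rtranclE)
      have "c \<in> B" using c(1) l(1)
        by (induction rule: rtrancl_induct) (auto simp: toward_iff nx_B)
      then show ?thesis using c l(1) by (auto simp: children_def branch_def toward_iff)
    qed simp
  qed
  show "insert k (\<Union>c\<in>children k. branch c) \<subseteq> branch k"
  proof -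
    have "(c, k) \<in> toward" if "c \<in> children k" for c
      using that B_V by (auto simp: children_def toward_iff)
    then show ?thesis using assms by (auto simp: branch_def intro: rtrancl_into_rtrancl)
  qed
qed

text \<open>A common member would make the siblings comparable, because \<open>toward\<close> is
  single-valued; then \<open>k\<close>, the \<open>nx\<close> of both, would reach one of its own
  children, against the decrease of \<open>rk\<close>.\<close>

lemma branch_children_disjoint:
  assumes "c \<in> children k" "c' \<in> children k" "c \<noteq> c'"
  shows "branch c \<inter> branch c' = {}"
proof -
  have cc: "c \<in> V" "c' \<in> V" "nx c = k" "nx c' = k" "c \<noteq> r" "c' \<noteq> r" using assms B_V by (auto simp: children_def)
  have "False" if l: "(l, c) \<in> toward\<^sup>*" "(l, c') \<in> toward\<^sup>*" for l
  proof -
    consider "(c, c') \<in> toward\<^sup>*" | "(c', c) \<in> toward\<^sup>*"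
      using single_valued_confluent[OF single_valued_toward l] by blast
    then show False
    proof cases
      case 1
      then have "(k, c') \<in> toward\<^sup>*" using assms(3) cc toward_unfold by metis
      then show False using toward_rk[of k c'] rk_nx[of c'] cc by auto
    next
      case 2
      then have "(k, c) \<in> toward\<^sup>*" using assms(3) cc toward_unfold by metis
      then show False using toward_rk[of k c] rk_nx[of c] cc by auto
    qed
  qed
  then show ?thesis by (auto simp: branch_def)
qed

lemma self_notin_branch_child: "c \<in> children k \<Longrightarrow> k \<notin> branch c"
  using toward_rk rk_nx B_V by (fastforce simp: children_def branch_def)

text \<open>The recursion behind both the flow balance of the block (\<open>pot_rec\<close>) and the
  accumulation pass of the program (\<open>fold_accumulate\<close>).\<close>

lemma sum_branch:
  fixes a :: "nat \<Rightarrow> 'a :: comm_monoid_add"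
  assumes "k \<in> B"
  shows "sum a (branch k) = a k + (\<Sum>c\<in>children k. sum a (branch c))"
proof -
  have "sum a (branch k) = a k + sum a (\<Union>c\<in>children k. branch c)"
    unfolding branch_rec[OF assms]
    using finite_children finite_branch self_notin_branch_child by (subst sum.insert) auto
  also have "sum a (\<Union>c\<in>children k. branch c) = (\<Sum>c\<in>children k. sum a (branch c))"
    using finite_children finite_branch branch_children_disjoint by (intro sum.UNION_disjoint) auto
  finally show ?thesis .
qed

text \<open>Nodes are visited by decreasing \<open>rk\<close>, so an entry is already the total over
  its branch when it is added to its neighbour. The map \<open>val\<close> covers different
  accumulated objects: it is the identity for reals and evaluation at a point for symbolic sums of
  losses.\<close>

lemma fold_accumulate:
  fixes val :: "'a \<Rightarrow> 'b :: comm_monoid_add"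
  assumes add: "\<And>x y. val (add x y) = val x + val y"
    and L: "set L = B - {r}" "sorted_wrt (\<lambda>k l. rk k > rk l) L"
    and k: "k \<in> B"
  shows "val (fold (\<lambda>k a. a(nx k := add (a (nx k)) (a k))) L a k) = (\<Sum>l\<in>branch k. val (a l))"
proof -
  define T where "T k = (\<Sum>l\<in>branch k. val (a l))" for k
  have T: "T k = val (a k) + sum T (children k)" if "k \<in> B" for k
    unfolding T_def by (rule sum_branch[OF that])
  \<comment> \<open>Generalization to initial parts of the traversal: an entry holds its own value
    plus the totals of the children visited so far. The third assumption makes \<open>L\<close>
    closed under larger \<open>rk\<close>, so that all children of a visited node come before
    it.\<close>
  have "val (fold (\<lambda>k a. a(nx k := add (a (nx k)) (a k))) L a k) = val (a k) + sum T (children k \<inter> set L)"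
    if "set L \<subseteq> B - {r}" "sorted_wrt (\<lambda>k l. rk k > rk l) L"
      "\<forall>k\<in>set L. \<forall>c\<in>B - {r}. rk c > rk k \<longrightarrow> c \<in> set L" for L k
    using that
  proof (induction L arbitrary: k rule: rev_induct)
    case (snoc j L)
    have j: "j \<in> B" "j \<noteq> r" "j \<notin> set L" using snoc.prems by (auto simp: sorted_wrt_append)
    have closed: "\<forall>k\<in>set L. \<forall>c\<in>B - {r}. rk c > rk k \<longrightarrow> c \<in> set L"
    proof (intro ballI impI)
      fix k c assume kc: "k \<in> set L" "c \<in> B - {r}" "rk c > rk k"
      then have "c \<in> set (L @ [j])" using snoc.prems(3) by auto
      moreover have "rk k > rk j" using snoc.prems(2) kc(1) by (simp add: sorted_wrt_append)
      ultimately show "c \<in> set L" using kc(3) by auto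
    qed
    define b where "b = fold (\<lambda>k a. a(nx k := add (a (nx k)) (a k))) L a"
    have upd: "fold (\<lambda>k a. a(nx k := add (a (nx k)) (a k))) (L @ [j]) a = b(nx j := add (b (nx j)) (b j))"
      by (simp add: b_def)
    have IH: "val (b k) = val (a k) + sum T (children k \<inter> set L)" for k
      unfolding b_def by (rule snoc.IH[OF _ _ closed]) (use snoc.prems in \<open>auto simp: sorted_wrt_append\<close>)
    have "children j \<subseteq> set L"
    proof
      fix c assume "c \<in> children j"
      then have c: "c \<in> B - {r}" "rk c > rk j" using rk_nx B_V by (auto simp: children_def)
      then have "c \<in> set (L @ [j])" using snoc.prems(3) by auto
      then show "c \<in> set L" using c by auto
    qed
    then have vj: "val (b j) = T j" using IH[of j] T[OF j(1)] by (simp add: inf.absorb1)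
    show ?case
    proof (cases "k = nx j")
      case True
      have "children k \<inter> set (L @ [j]) = insert j (children k \<inter> set L)"
        using True j by (auto simp: children_def)
      then have "sum T (children k \<inter> set (L @ [j])) = T j + sum T (children k \<inter> set L)"
        using j finite_children by simp
      then show ?thesis using True IH[of "nx j"] vj unfolding upd by (simp add: add add_ac)
    next
      case False
      then have "children k \<inter> set (L @ [j]) = children k \<inter> set L" by (auto simp: children_def)
      then show ?thesis using False IH[of k] unfolding upd by simp
    qed
  qed simp
  from this[of L k] have "val (fold (\<lambda>k a. a(nx k := add (a (nx k)) (a k))) L a k)
      = val (a k) + sum T (children k \<inter> set L)"
    using L by simp
  also have "children k \<inter> set L = children k" using L by (auto simp: children_def)
  also note T[OF k, symmetric]
  finally show ?thesis by (simp only: T_def)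
qed

end

section \<open>A direction-dependent order, and complementary slackness on a single arc\<close>

section \<open>Directions\<close>

text \<open>Both directions of the update are treated at once: \<open>lee Up\<close> is the reversed order.\<close>

definition lee :: "direction \<Rightarrow> 'a::linorder \<Rightarrow> 'a \<Rightarrow> bool" where
  "lee d a b = (case d of Down \<Rightarrow> a \<le> b | Up \<Rightarrow> b \<le> a)"

definition bestS :: "direction \<Rightarrow> ereal set \<Rightarrow> ereal" where
  "bestS d A = (case d of Down \<Rightarrow> Sup A | Up \<Rightarrow> Inf A)"

lemma lee_refl [simp]: "lee d a a"
  by (cases d) (auto simp: lee_def)

lemma lee_trans [trans]: "lee d a b \<Longrightarrow> lee d b c \<Longrightarrow> lee d a c"
  by (cases d) (auto simp: lee_def)

lemma lee_antisym: "lee d a b \<Longrightarrow> lee d b a \<Longrightarrow> a = b"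
  by (cases d) (auto simp: lee_def)

lemma lee_linear: "lee d a b \<or> lee d b a"
  by (cases d) (auto simp: lee_def)

lemma lee_worst [simp]: "lee d (worst d) a"
  by (cases d) (auto simp: lee_def worst_def)

lemma lee_ereal [simp]: "lee d (ereal a) (ereal b) = lee d a b"
  by (cases d) (auto simp: lee_def)

lemma lee_mono: "strict_mono F \<Longrightarrow> lee d (F a) (F b) = lee d a b"
  by (cases d) (auto simp: lee_def strict_mono_less_eq)

lemma lee_uminus: "lee d (- a) (- b) = lee d b (a :: real)"
  by (cases d) (auto simp: lee_def)

lemma best_lee: "lee d a (best d a b)" "lee d b (best d a b)"
  by (cases d; simp add: lee_def best_def)+

lemma best_lee3: "lee d b (best d a (best d b c))" "lee d c (best d a (best d b c))"
  by (rule lee_trans[OF best_lee(1) best_lee(2)], rule lee_trans[OF best_lee(2) best_lee(2)])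

lemma best_leeI: "lee d a c \<Longrightarrow> lee d b c \<Longrightarrow> lee d (best d a b) c"
  by (cases d; simp add: lee_def best_def)

lemma best_cases: "best d a b = a \<or> best d a b = b"
  by (cases d) (auto simp: best_def max_def min_def)

lemma best_worst [simp]: "best d (worst d) a = a" "best d a (worst d) = a"
  by (cases d; simp add: best_def worst_def)+

lemma bestS_empty [simp]: "bestS d {} = worst d"
  by (cases d) (simp_all add: bestS_def worst_def bot_ereal_def top_ereal_def)

lemma bestS_insert: "bestS d (insert a A) = best d a (bestS d A)"
  by (cases d) (simp_all add: bestS_def best_def sup_max inf_min)

lemma bestS_union: "bestS d (A \<union> A') = best d (bestS d A) (bestS d A')"
  by (cases d) (simp_all add: bestS_def best_def sup_max inf_min Sup_union_distrib Inf_union_distrib)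

lemma bestS_lee: "a \<in> A \<Longrightarrow> lee d a (bestS d A)"
  by (cases d) (auto simp: bestS_def lee_def Sup_upper Inf_lower)

lemma bestS_leeI: "(\<And>a. a \<in> A \<Longrightarrow> lee d a b) \<Longrightarrow> lee d (bestS d A) b"
  by (cases d) (auto simp: bestS_def lee_def Sup_least Inf_greatest)

lemma bestS_mem: "finite A \<Longrightarrow> bestS d A \<in> insert (worst d) A"
proof (induction A rule: finite_induct)
  case (insert a A)
  then show ?case using best_cases[of d a "bestS d A"] by (auto simp: bestS_insert)
qed simp

text \<open>\<open>att d\<close> marks the arcs that can join the block in direction \<open>d\<close> and \<open>det d\<close> those that have left
  it; the comparison is between the far and the near end node.\<close>

definition att :: "direction \<Rightarrow> order_sign" where
  "att d = (case d of Down \<Rightarrow> LT | Up \<Rightarrow> GT)"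

definition det :: "direction \<Rightarrow> order_sign" where
  "det d = (case d of Down \<Rightarrow> GT | Up \<Rightarrow> LT)"

lemma att_det [simp]: "att d \<noteq> EQ" "det d \<noteq> EQ" "att d \<noteq> det d" "det d \<noteq> att d" "EQ \<noteq> att d" "EQ \<noteq> det d"
  by (cases d; simp add: att_def det_def)+

lemma sign_cases: "s = EQ \<or> s = att d \<or> s = det d"
  by (cases d; cases s) (auto simp: att_def det_def)

text \<open>Complementary slackness with weak inequalities: \<open>GT\<close> and \<open>LT\<close>
  fix the bound on which the flow sits but allow equal values, as occurs when an arc has just left
  the block. At an event the old and the new sign are therefore both correct.\<close>

definition arc_ok :: "ereal \<Rightarrow> ereal \<Rightarrow> order_sign \<Rightarrow> real \<Rightarrow> real \<Rightarrow> real \<Rightarrow> bool" where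
  "arc_ok l u s a b z = (case s of
      EQ \<Rightarrow> a = b \<and> l \<le> ereal z \<and> ereal z \<le> u
    | GT \<Rightarrow> b \<le> a \<and> ereal z = l
    | LT \<Rightarrow> a \<le> b \<and> ereal z = u)"

text \<open>The bound that the flow towards the root approaches on an arc of the block while
  \<open>t\<close> moves in direction \<open>d\<close>; \<open>opp\<close> is the bound on which the
  flow of an arc with sign \<open>att d\<close> sits.\<close>

definition bnd :: "direction \<Rightarrow> ereal \<Rightarrow> ereal \<Rightarrow> ereal" where
  "bnd d l u = (case d of Down \<Rightarrow> l | Up \<Rightarrow> u)"

definition opp :: "direction \<Rightarrow> ereal \<Rightarrow> ereal \<Rightarrow> ereal" where
  "opp d l u = (case d of Down \<Rightarrow> u | Up \<Rightarrow> l)"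

lemma arc_ok_EQ: "arc_ok l u EQ a b z \<longleftrightarrow> a = b \<and> lee d (bnd d l u) (ereal z) \<and> lee d (ereal z) (opp d l u)"
  by (cases d) (auto simp: arc_ok_def lee_def bnd_def opp_def)

lemma arc_ok_att: "arc_ok l u (att d) a b z \<longleftrightarrow> lee d a b \<and> ereal z = opp d l u"
  by (cases d) (auto simp: arc_ok_def lee_def att_def opp_def)

lemma arc_ok_det: "arc_ok l u (det d) a b z \<longleftrightarrow> lee d b a \<and> ereal z = bnd d l u"
  by (cases d) (auto simp: arc_ok_def lee_def det_def bnd_def)

section \<open>Moving the block: potentials, events, and the next solution of the optimality
  system\<close>

section \<open>One update\<close>

context rooted_tree
begin

text \<open>Here \<open>Z k\<close> is the flow on the edge from \<open>k\<close> to
  \<open>nx k\<close>, whatever the orientation of the arc; hence the root has no outgoing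
  term.\<close>

definition net :: "(nat \<Rightarrow> real) \<Rightarrow> nat \<Rightarrow> real" where
  "net Z k = (if k = r then 0 else Z k) - sum Z {j \<in> V. j \<noteq> r \<and> nx j = k}"

end

text \<open>An update without arc orientations: signs, flows and bounds are indexed by the end node
  farther from \<open>r\<close> and read towards \<open>r\<close>. The function \<open>fn\<close>
  and the value \<open>w\<close> belong to the new node, which lies ahead of the block in direction
  \<open>d\<close>; \<open>lim\<close> is the extreme flow allowed on the new arc.\<close>

locale flow_block = rooted_subtree +
  fixes f :: "nat \<Rightarrow> real \<Rightarrow> real" and x Z :: "nat \<Rightarrow> real" and t :: real
    and S :: "nat \<Rightarrow> order_sign" and lo up :: "nat \<Rightarrow> ereal"
    and d :: direction and fn :: "real \<Rightarrow> real" and lim :: ereal and w :: real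
  assumes ssc_f: "\<And>k. k \<in> V \<Longrightarrow> smooth_strongly_convex (f k)" and ssc_fn: "smooth_strongly_convex fn"
    and stationary: "\<And>k. k \<in> V \<Longrightarrow> deriv (f k) (x k) = net Z k + (if k = r then t else 0)"
    and ok: "\<And>k. k \<in> V \<Longrightarrow> k \<noteq> r \<Longrightarrow> arc_ok (lo k) (up k) (S k) (x k) (x (nx k)) (Z k)"
    and block_EQ: "\<And>k. k \<in> B \<Longrightarrow> k \<noteq> r \<Longrightarrow> S k = EQ"
    and block_max: "\<And>k. k \<in> V \<Longrightarrow> k \<noteq> r \<Longrightarrow> nx k \<in> B \<Longrightarrow> S k = EQ \<Longrightarrow> k \<in> B"
    and bounds: "\<And>k. k \<in> V \<Longrightarrow> k \<noteq> r \<Longrightarrow> lo k \<le> 0 \<and> 0 \<le> up k"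
    and fn_w: "deriv fn w = - t" and w: "lee d w (x r)" "w \<noteq> x r"
    and lim: "lee d lim (ereal t)"
begin

text \<open>Every outside neighbour of the block has its \<open>nx\<close> in the block, so only
  edges pointing into the block contribute; the minus sign makes this \<open>sigma\<close> of a
  singleton (see \<open>sigma_eq\<close>).\<close>

definition sig :: "nat \<Rightarrow> real" where
  "sig l = - sum Z {j \<in> V. j \<notin> B \<and> nx j = l}"

text \<open>\<open>pot k v\<close> is the flow from \<open>k\<close> to \<open>nx k\<close> that balances \<open>C\<^sub>k\<close> when the block has the value \<open>v\<close>; for
  \<open>k = r\<close> it is the value of \<open>t\<close> that does so.\<close>

definition pot :: "nat \<Rightarrow> real \<Rightarrow> real" where
  "pot k v = (\<Sum>l\<in>branch k. deriv (f l) v - sig l)"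

definition branch_loss :: "nat \<Rightarrow> real \<Rightarrow> real" where
  "branch_loss k = (\<lambda>v. \<Sum>l\<in>branch k. f l v)"

text \<open>For \<open>k = r\<close> this is the value \<open>x\<^sub>B\<close> of the block at time
  \<open>y\<close>; for other \<open>k\<close> it is the block value at which the flow from
  \<open>k\<close> to \<open>nx k\<close> becomes \<open>y\<close>.\<close>

definition pot_inv :: "nat \<Rightarrow> real \<Rightarrow> real" where
  "pot_inv k y = deriv_inv (branch_loss k) (y + sum sig (branch k))"

definition x_new :: "real \<Rightarrow> nat \<Rightarrow> real" where
  "x_new v k = (if k \<in> B then v else x k)"

definition Z_new :: "real \<Rightarrow> nat \<Rightarrow> real" where
  "Z_new v k = (if k \<in> B \<and> k \<noteq> r then pot k v else Z k)"

lemma ssc_branch_loss: "k \<in> B \<Longrightarrow> smooth_strongly_convex (branch_loss k)"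
  unfolding branch_loss_def using ssc_f branch_B[of k] B_V self_in_branch[of k] finite_branch
  by (intro ssc_sum) blast+

lemma deriv_branch_loss: "k \<in> B \<Longrightarrow> deriv (branch_loss k) v = (\<Sum>l\<in>branch k. deriv (f l) v)"
  unfolding branch_loss_def using ssc_f branch_B[of k] B_V finite_branch
  by (intro deriv_sum_ssc) blast+

lemma pot_eq: "k \<in> B \<Longrightarrow> pot k v = deriv (branch_loss k) v - sum sig (branch k)"
  by (simp add: pot_def deriv_branch_loss sum_subtractf)

lemma strict_mono_pot: "k \<in> B \<Longrightarrow> strict_mono (pot k)"
  using deriv_strict_mono[OF ssc_branch_loss] by (simp add: strict_mono_def pot_eq)

lemma pot_pot_inv [simp]: "k \<in> B \<Longrightarrow> pot k (pot_inv k y) = y"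
  by (simp add: pot_eq pot_inv_def ssc_branch_loss)

lemma pot_inv_unique: "k \<in> B \<Longrightarrow> pot k v = y \<Longrightarrow> pot_inv k y = v"
  using strict_mono_eq[OF strict_mono_pot] pot_pot_inv by metis

lemma lee_pot [simp]: "k \<in> B \<Longrightarrow> lee e (pot k a) (pot k b) = lee e a b"
  by (rule lee_mono) (rule strict_mono_pot)

lemma pot_rec: "k \<in> B \<Longrightarrow> pot k v = deriv (f k) v - sig k + (\<Sum>c\<in>children k. pot c v)"
  unfolding pot_def by (rule sum_branch)

lemma x_block: "k \<in> B \<Longrightarrow> x k = x r"
proof (induction "rk k" arbitrary: k rule: less_induct)
  case less
  show ?case
  proof (cases "k = r")
    case False
    have "arc_ok (lo k) (up k) EQ (x k) (x (nx k)) (Z k)"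
      using ok[of k] block_EQ[of k] less.prems False B_V by auto
    then have "x k = x (nx k)" by (simp add: arc_ok_def)
    then show ?thesis using less False rk_nx[of k] nx_B[of k] B_V by auto
  qed simp
qed

lemma net_split:
  assumes "k \<in> B"
  shows "net Y k = (if k = r then 0 else Y k) - (\<Sum>c\<in>children k. Y c) - sum Y {j \<in> V. j \<notin> B \<and> nx j = k}"
proof -
  have *: "{j \<in> V. j \<noteq> r \<and> nx j = k} = children k \<union> {j \<in> V. j \<notin> B \<and> nx j = k}"
    using B_V root_B by (auto simp: children_def)
  have "children k \<inter> {j \<in> V. j \<notin> B \<and> nx j = k} = {}" by (auto simp: children_def)
  then show ?thesis using finite_children finite_V unfolding net_def *
    by (subst sum.union_disjoint) auto
qed

text \<open>On a tree the flow is determined by conservation: going from the leaves of the block to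
  the root, along the reversed \<open>rk\<close>, the stationarity condition at \<open>k\<close> can
  be solved for \<open>Z k\<close>, and at the root for \<open>t\<close>.\<close>

lemma pot_old: "k \<in> B \<Longrightarrow> pot k (x r) = (if k = r then t else Z k)"
proof (induction "Max (rk ` B) - rk k" arbitrary: k rule: less_induct)
  case less
  have "pot c (x r) = Z c" if "c \<in> children k" for c
  proof -
    have c: "c \<in> B" "c \<noteq> r" "rk k < rk c" using that rk_nx B_V by (auto simp: children_def)
    moreover have "rk c \<le> Max (rk ` B)" using c finite_B by simp
    ultimately have "Max (rk ` B) - rk c < Max (rk ` B) - rk k" by linarith
    then show ?thesis using less.hyps c by auto
  qed
  then have "pot k (x r) = deriv (f k) (x k) - sig k + sum Z (children k)"
    using less.prems x_block[of k] by (simp add: pot_rec)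
  then show ?case using stationary[of k] less.prems B_V net_split[of k Z] by (auto simp: sig_def)
qed

text \<open>Holds for every block value \<open>v\<close>: inside the block \<open>pot\<close> is
  defined by this balance, and outside nothing changes, because the edges with new flow have both
  ends in the block.\<close>

lemma net_new:
  assumes "k \<in> V"
  shows "deriv (f k) (x_new v k) = net (Z_new v) k + (if k = r then pot r v else 0)"
proof (cases "k \<in> B")
  case True
  have "sum (Z_new v) {j \<in> V. j \<notin> B \<and> nx j = k} = - sig k"
    unfolding sig_def by (auto simp: Z_new_def intro: sum.cong)
  moreover have "sum (Z_new v) (children k) = (\<Sum>c\<in>children k. pot c v)"
    by (rule sum.cong) (auto simp: Z_new_def children_def)
  ultimately show ?thesis using pot_rec[OF True, of v] True unfolding net_split[OF True]
    by (auto simp: Z_new_def x_new_def)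
next
  case False
  then have k: "k \<noteq> r" using root_B by auto
  have "sum (Z_new v) {j \<in> V. j \<noteq> r \<and> nx j = k} = sum Z {j \<in> V. j \<noteq> r \<and> nx j = k}"
    using False nx_B by (intro sum.cong) (auto simp: Z_new_def)
  then show ?thesis using stationary[OF assms] False k by (simp add: x_new_def net_def Z_new_def)
qed

definition joining :: "nat set" where
  "joining = {k \<in> V. k \<noteq> r \<and> k \<notin> B \<and> nx k \<in> B \<and> S k = att d}"

definition cnd :: "nat \<Rightarrow> ereal" where
  "cnd k = (if \<bar>bnd d (lo k) (up k)\<bar> = \<infinity> then worst d
            else ereal (pot_inv k (real_of_ereal (bnd d (lo k) (up k)))))"

definition events :: "ereal set" where
  "events = cnd ` (B - {r}) \<union> (\<lambda>k. ereal (x k)) ` joining"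

text \<open>From the block value of an event to its time increment. As \<open>pot r\<close> is
  increasing, the conversion preserves the order and may be applied after taking the
  extremum.\<close>

definition conv :: "ereal \<Rightarrow> ereal" where
  "conv v = (if \<bar>v\<bar> = \<infinity> then worst d else ereal (pot r (real_of_ereal v) - t))"

text \<open>The value at which block and new node meet. Adding their stationarity conditions cancels
  \<open>t\<close>, so this value is found by a single inversion for the sum of their
  losses.\<close>

definition y_meet :: real where
  "y_meet = deriv_inv (\<lambda>v. branch_loss r v + fn v) (sum sig B)"

definition t_next :: real where
  "t_next = real_of_ereal (best d (ereal t + conv (bestS d events))
     (best d (ereal (- deriv fn y_meet)) lim))"

definition v_next :: real where
  "v_next = pot_inv r t_next"

definition w_next :: real where
  "w_next = deriv_inv fn (- t_next)"

lemma finite_events: "finite events"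
  unfolding events_def joining_def using finite_B finite_V by simp

lemma pot_v_next [simp]: "pot r v_next = t_next"
  by (simp add: v_next_def root_B)

lemma fn_w_next [simp]: "deriv fn w_next = - t_next"
  by (simp add: w_next_def ssc_fn)

lemma lee_fn: "lee e (deriv fn a) (deriv fn b) = lee e a b"
  by (rule lee_mono) (rule deriv_strict_mono[OF ssc_fn])

lemma pot_meet: "pot r y_meet = - deriv fn y_meet"
proof -
  have n: "smooth_strongly_convex (\<lambda>v. branch_loss r v + fn v)"
    by (intro ssc_add ssc_branch_loss root_B ssc_fn)
  have "deriv (\<lambda>v. branch_loss r v + fn v) y_meet = sum sig B"
    unfolding y_meet_def by (rule deriv_deriv_inv[OF n])
  then have "deriv (branch_loss r) y_meet + deriv fn y_meet = sum sig B"
    by (simp add: deriv_add_ssc ssc_branch_loss root_B ssc_fn)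
  then show ?thesis by (simp add: pot_eq root_B branch_root)
qed

text \<open>At height \<open>t\<close> the increasing curve \<open>pot r\<close> passes through
  \<open>x r\<close>, and the decreasing curve of the negated derivative of \<open>fn\<close>
  through \<open>w\<close>. Since \<open>w\<close> lies strictly ahead of \<open>x r\<close> in
  direction \<open>d\<close>, the curves cannot cross behind \<open>x r\<close>.\<close>

lemma meet_le: "lee d y_meet (x r)"
proof (rule ccontr)
  assume a: "\<not> lee d y_meet (x r)"
  then have "lee d (x r) y_meet" using lee_linear by blast
  then have "lee d t (pot r y_meet)" using pot_old[OF root_B] lee_pot[OF root_B, of d "x r" y_meet] by simp
  then have "lee d (- t) (deriv fn y_meet) \<Longrightarrow> False"
    using a w lee_fn[of d w y_meet] lee_antisym[of d] 
    by (metis fn_w lee_uminus pot_meet minus_minus lee_fn lee_trans)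
  moreover have "lee d w y_meet" using w \<open>lee d (x r) y_meet\<close> lee_trans by blast
  ultimately show False using lee_fn[of d w y_meet] fn_w by simp
qed

text \<open>At the current block value no bound has been violated and no outside value overtaken, so
  an event lies ahead or at the current value, or never occurs.\<close>

lemma event_ne: "a \<in> events \<Longrightarrow> a = worst d \<or> (\<exists>b. a = ereal b \<and> lee d b (x r))"
proof -
  assume "a \<in> events"
  then consider k where "k \<in> B" "k \<noteq> r" "a = cnd k" | k where "k \<in> joining" "a = ereal (x k)"
    unfolding events_def by blast
  then show ?thesis
  proof cases
    case 1
    show ?thesis
    proof (cases "\<bar>bnd d (lo k) (up k)\<bar> = \<infinity>")
      case False
      then obtain b where b: "bnd d (lo k) (up k) = ereal b" by auto
      have "arc_ok (lo k) (up k) EQ (x k) (x (nx k)) (Z k)"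
        using ok[of k] block_EQ[of k] 1 B_V by auto
      then have "lee d b (Z k)" using b by (simp add: arc_ok_EQ[of _ _ _ _ _ d])
      then have "lee d (pot k (pot_inv k b)) (pot k (x r))" using 1 pot_old[of k] by simp
      then have "lee d (pot_inv k b) (x r)" using 1 by (simp only: lee_pot)
      then show ?thesis using 1 b by (simp add: cnd_def)
    qed (use 1 in \<open>simp add: cnd_def\<close>)
  next
    case 2
    then have "lee d (x k) (x (nx k))" using ok[of k] arc_ok_att unfolding joining_def by force
    then show ?thesis using 2 x_block[of "nx k"] unfolding joining_def by simp
  qed
qed

lemma best_event_cases:
  obtains "bestS d events = worst d" "conv (bestS d events) = worst d"
  | b where "bestS d events = ereal b" "ereal b \<in> events" "lee d b (x r)"
      "conv (bestS d events) = ereal (pot r b - t)"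
proof -
  have "bestS d events \<in> insert (worst d) events" by (rule bestS_mem[OF finite_events])
  then have "bestS d events = worst d \<or>
      (\<exists>b. bestS d events = ereal b \<and> ereal b \<in> events \<and> lee d b (x r))"
    using event_ne[of "bestS d events"] by auto
  then consider "bestS d events = worst d" | b where "bestS d events = ereal b" "ereal b \<in> events" "lee d b (x r)"
    by blast
  then show ?thesis
  proof cases
    case 1
    moreover have "\<bar>worst d\<bar> = \<infinity>" by (cases d) (simp_all add: worst_def)
    ultimately show ?thesis using that(1) by (simp add: conv_def)
  next
    case 2
    then show ?thesis using that(2) by (simp add: conv_def)
  qed
qed

text \<open>The extremum lies between the meeting time and \<open>t\<close>, both real, so
  \<open>real_of_ereal\<close> loses nothing even if there is no event and \<open>lim\<close> is
  infinite.\<close>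

lemma t_next_ereal:
  "ereal t_next = best d (ereal t + conv (bestS d events)) (best d (ereal (- deriv fn y_meet)) lim)"
    (is "_ = ?R")
proof -
  have "lee d (ereal (- deriv fn y_meet)) ?R" by (rule best_lee3)
  moreover have "lee d ?R (ereal t)"
  proof (intro best_leeI)
    show "lee d (ereal t + conv (bestS d events)) (ereal t)"
    proof (cases rule: best_event_cases)
      case 1
      have "ereal t + worst d = worst d" by (cases d) (simp_all add: worst_def)
      then show ?thesis using 1 by simp
    next
      case (2 b)
      then show ?thesis using lee_pot[OF root_B, of d b "x r"] pot_old[OF root_B] by simp
    qed
    show "lee d (ereal (- deriv fn y_meet)) (ereal t)"
      using lee_pot[OF root_B, of d y_meet "x r"] meet_le pot_old[OF root_B] pot_meet by simp
    show "lee d lim (ereal t)" by (rule lim)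
  qed
  ultimately have "\<bar>?R\<bar> \<noteq> \<infinity>" by (cases d; cases ?R) (auto simp: lee_def)
  then show ?thesis unfolding t_next_def by (simp add: ereal_real)
qed

lemma t_next_le: "lee d t_next t"
  and lim_le_t_next: "lee d lim (ereal t_next)"
  and meet_le_v_next: "lee d y_meet v_next"
  and v_next_le: "lee d v_next (x r)"
  and event_le: "a \<in> events \<Longrightarrow> lee d a (ereal v_next)"
proof -
  show "lee d lim (ereal t_next)" unfolding t_next_ereal by (rule best_lee3)
  have "lee d (ereal (- deriv fn y_meet)) (ereal t_next)" unfolding t_next_ereal by (rule best_lee3)
  then have "lee d (pot r y_meet) (pot r v_next)" using pot_meet by simp
  then show "lee d y_meet v_next" by (simp only: lee_pot[OF root_B])
  have le: "lee d (ereal t + conv (bestS d events)) (ereal t_next)" unfolding t_next_ereal by (rule best_lee)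
  have *: "ereal t + worst d = worst d" by (cases d) (simp_all add: worst_def)
  have "lee d (bestS d events) (ereal v_next)"
  proof (cases rule: best_event_cases)
    case (2 b)
    then have "lee d (pot r b) (pot r v_next)" using le by simp
    then show ?thesis using 2 by (simp only: lee_pot[OF root_B] lee_ereal)
  qed simp
  then show "a \<in> events \<Longrightarrow> lee d a (ereal v_next)" using bestS_lee lee_trans by blast
  have "lee d (ereal t_next) (ereal t)" unfolding t_next_ereal
  proof (intro best_leeI)
    show "lee d (ereal t + conv (bestS d events)) (ereal t)"
      by (cases rule: best_event_cases)
         (use * lee_pot[OF root_B, of d _ "x r"] pot_old[OF root_B] in auto)
    show "lee d (ereal (- deriv fn y_meet)) (ereal t)"
      using lee_pot[OF root_B, of d y_meet "x r"] meet_le pot_old[OF root_B] pot_meet by simp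
    show "lee d lim (ereal t)" by (rule lim)
  qed
  then show t: "lee d t_next t" by simp
  then have "lee d (pot r v_next) (pot r (x r))" using pot_old[OF root_B] by simp
  then show "lee d v_next (x r)" by (simp only: lee_pot[OF root_B])
qed

lemma w_next_le: "lee d w_next v_next"
proof -
  have "lee d (- deriv fn y_meet) t_next" 
    using meet_le_v_next lee_pot[OF root_B, of d y_meet v_next] pot_meet by simp
  then have "lee d (deriv fn w_next) (deriv fn y_meet)"
    using lee_uminus[of d "t_next" "- deriv fn y_meet"] by simp
  then show ?thesis using lee_fn meet_le_v_next lee_trans by blast
qed

text \<open>When neither the limit nor the meeting stops the motion, the extremum defining
  \<open>t_next\<close> must be its remaining argument, the time of the first event.\<close>

lemma event_attained:
  assumes "ereal t_next \<noteq> lim" "v_next \<noteq> w_next"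
  shows "ereal v_next \<in> events" "conv (bestS d events) = ereal (t_next - t)"
proof -
  have "t_next \<noteq> - deriv fn y_meet"
  proof
    assume a: "t_next = - deriv fn y_meet"
    then have "pot r v_next = pot r y_meet" using pot_meet by simp
    then have "v_next = y_meet" by (simp only: strict_mono_eq[OF strict_mono_pot[OF root_B]])
    moreover have "deriv fn w_next = deriv fn y_meet" using a by simp
    then have "w_next = y_meet" by (simp only: strict_mono_eq[OF deriv_strict_mono[OF ssc_fn]])
    ultimately show False using assms(2) by simp
  qed
  then have "ereal t_next \<noteq> best d (ereal (- deriv fn y_meet)) lim"
    using assms(1) best_cases[of d "ereal (- deriv fn y_meet)" lim] by auto
  then have e: "ereal t_next = ereal t + conv (bestS d events)"
    using t_next_ereal best_cases[of d "ereal t + conv (bestS d events)"] by metis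
  have *: "ereal t + worst d = worst d" "\<bar>worst d\<bar> = \<infinity>" by (cases d; simp add: worst_def)+
  have "ereal v_next \<in> events \<and> conv (bestS d events) = ereal (t_next - t)"
  proof (cases rule: best_event_cases)
    case 1
    then have "ereal t_next = worst d" using e * by simp
    then have "\<bar>ereal t_next\<bar> = \<infinity>" using * by simp
    then show ?thesis by simp
  next
    case (2 b)
    then have "pot r b = pot r v_next" using e by simp
    then have "b = v_next" by (simp only: strict_mono_eq[OF strict_mono_pot[OF root_B]])
    then show ?thesis using 2 by simp
  qed
  then show "ereal v_next \<in> events" "conv (bestS d events) = ereal (t_next - t)" by blast+
qed

text \<open>The motion stops no later than the first event, so no flow in the block has passed its
  bound and no outside neighbour has been overtaken: the old signs stay correct.\<close>

lemma ok_new: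
  assumes "k \<in> V" "k \<noteq> r"
  shows "arc_ok (lo k) (up k) (S k) (x_new v_next k) (x_new v_next (nx k)) (Z_new v_next k)"
proof (cases "k \<in> B")
  case True
  have EQ: "S k = EQ" using block_EQ True assms by blast
  then have old: "lee d (bnd d (lo k) (up k)) (ereal (Z k))" "lee d (ereal (Z k)) (opp d (lo k) (up k))"
    using ok[OF assms] by (auto simp: arc_ok_EQ[of _ _ _ _ _ d])
  have "lee d (pot k v_next) (pot k (x r))" using v_next_le True by simp
  then have "lee d (ereal (pot k v_next)) (ereal (Z k))" using pot_old[OF True] assms by simp
  then have 1: "lee d (ereal (pot k v_next)) (opp d (lo k) (up k))" using old(2) lee_trans by blast
  have 2: "lee d (bnd d (lo k) (up k)) (ereal (pot k v_next))"
  proof (cases "\<bar>bnd d (lo k) (up k)\<bar> = \<infinity>")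
    case inf: True
    then have "bnd d (lo k) (up k) = worst d" using old(1)
      by (cases d; cases "bnd d (lo k) (up k)") (auto simp: lee_def worst_def)
    then show ?thesis by simp
  next
    case False
    then obtain b where b: "bnd d (lo k) (up k) = ereal b" by auto
    have "cnd k \<in> events" using True assms unfolding events_def by blast
    then have "lee d (pot_inv k b) v_next" using event_le[of "cnd k"] b by (simp add: cnd_def)
    then have "lee d (pot k (pot_inv k b)) (pot k v_next)" by (simp only: lee_pot[OF True])
    then show ?thesis using b True by simp
  qed
  show ?thesis using 1 2 True assms nx_B[of k] unfolding EQ
    by (simp add: arc_ok_EQ[of _ _ _ _ _ d] x_new_def Z_new_def)
next
  case False
  show ?thesis
  proof (cases "nx k \<in> B")
    case nx: True
    have "S k \<noteq> EQ" using block_max[OF assms nx] False by blast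
    then consider "S k = att d" | "S k = det d" using sign_cases by blast
    then show ?thesis
    proof cases
      case 1
      then have "ereal (x k) \<in> events" using assms False nx unfolding events_def joining_def by blast
      then have "lee d (x k) v_next" using event_le[of "ereal (x k)"] by simp
      then show ?thesis using ok[OF assms] nx False unfolding 1
        by (simp add: arc_ok_att x_new_def Z_new_def)
    next
      case 2
      have "lee d (x (nx k)) (x k)" using ok[OF assms] unfolding 2 by (simp add: arc_ok_det)
      then have "lee d v_next (x k)" using v_next_le x_block[OF nx] lee_trans by metis
      then show ?thesis using ok[OF assms] nx False unfolding 2
        by (simp add: arc_ok_det x_new_def Z_new_def)
    qed
  next
    case nx: False
    then show ?thesis using ok[OF assms] False by (simp add: x_new_def Z_new_def)
  qed
qed

definition S_next :: "nat \<Rightarrow> order_sign" where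
  "S_next k = (if k \<in> joining \<and> x k = v_next then EQ
     else if k \<in> B \<and> k \<noteq> r \<and> cnd k = ereal v_next then det d else S k)"

text \<open>Only arcs with an event at \<open>v_next\<close> change sign. A joining arc now has
  equal end values and its flow still on a bound, which \<open>EQ\<close> permits; a detaching arc
  has its flow exactly on \<open>bnd d\<close>.\<close>

lemma ok_next:
  assumes "k \<in> V" "k \<noteq> r"
  shows "arc_ok (lo k) (up k) (S_next k) (x_new v_next k) (x_new v_next (nx k)) (Z_new v_next k)"
proof -
  note new = ok_new[OF assms]
  have lu: "lee d (bnd d (lo k) (up k)) (opp d (lo k) (up k))"
    using bounds[OF assms] by (cases d) (auto simp: lee_def bnd_def opp_def intro: order_trans)
  show ?thesis
  proof (cases "k \<in> joining \<and> x k = v_next")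
    case True
    then have j: "S k = att d" "nx k \<in> B" "k \<notin> B" by (auto simp: joining_def)
    then have "ereal (Z_new v_next k) = opp d (lo k) (up k)" using new by (simp add: arc_ok_att)
    then show ?thesis using True j lu
      by (simp add: S_next_def arc_ok_EQ[of _ _ _ _ _ d] x_new_def)
  next
    case no: False
    show ?thesis
    proof (cases "k \<in> B \<and> cnd k = ereal v_next")
      case True
      have "\<bar>worst d\<bar> = \<infinity>" by (cases d; simp add: worst_def)
      then obtain b where b: "bnd d (lo k) (up k) = ereal b" "v_next = pot_inv k b"
        using True unfolding cnd_def by (cases "bnd d (lo k) (up k)") auto
      then have "pot k v_next = b" using True by simp
      then show ?thesis using True no assms b(1) nx_B[of k]
        by (auto simp: S_next_def arc_ok_det x_new_def Z_new_def)
    next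
      case False
      then show ?thesis using no new by (auto simp: S_next_def)
    qed
  qed
qed

text \<open>The number of sign changes an arc can still undergo while the stage moves in direction
  \<open>d\<close>.\<close>

definition weight :: "order_sign \<Rightarrow> nat" where
  "weight s = (if s = att d then 2 else if s = EQ then 1 else 0)"

lemma weight_less:
  assumes "ereal v_next \<in> events"
  shows "(\<Sum>k\<in>V - {r}. weight (S_next k)) < (\<Sum>k\<in>V - {r}. weight (S k))"
proof (rule sum_strict_mono_ex1)
  show "finite (V - {r})" using finite_V by simp
  have j: "S k = att d" if "k \<in> joining" for k using that by (simp add: joining_def)
  show "\<forall>k\<in>V - {r}. weight (S_next k) \<le> weight (S k)"
    by (auto simp: weight_def S_next_def j block_EQ)
  have "(\<exists>k\<in>B - {r}. ereal v_next = cnd k) \<or> (\<exists>k\<in>joining. v_next = x k)"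
    using assms unfolding events_def by auto
  then consider k where "k \<in> B" "k \<noteq> r" "cnd k = ereal v_next" | k where "k \<in> joining" "x k = v_next"
    by (metis DiffE singletonI)
  then show "\<exists>k\<in>V - {r}. weight (S_next k) < weight (S k)"
  proof cases
    case 1
    then have "k \<notin> joining" by (auto simp: joining_def)
    then show ?thesis using 1 B_V by (intro bexI[of _ k]) (auto simp: weight_def S_next_def block_EQ)
  next
    case 2
    then have "k \<in> V - {r}" by (simp add: joining_def)
    then show ?thesis using 2 by (intro bexI[of _ k]) (auto simp: weight_def S_next_def j)
  qed
qed

end

section \<open>Labelled arborescences and their Karush-Kuhn-Tucker systems\<close>

section \<open>Labelled problems\<close>

locale labelled =
  fixes H :: tree_problem and n :: nat and par :: "nat \<Rightarrow> nat"
  assumes nodes_H: "nodes H = {1..n}" and n_pos: "1 \<le> n"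
    and arcs_H: "arcs H = {(par k, k) |k. 2 \<le> k \<and> k \<le> n}"
    and par: "\<And>k. 2 \<le> k \<Longrightarrow> k \<le> n \<Longrightarrow> 1 \<le> par k \<and> par k < k"
    and ssc_loss: "\<And>k. 1 \<le> k \<Longrightarrow> k \<le> n \<Longrightarrow> smooth_strongly_convex (loss H k)"
    and weights: "\<And>k. 2 \<le> k \<Longrightarrow> k \<le> n \<Longrightarrow> 0 \<le> lam H (par k, k) \<and> 0 \<le> mu H (par k, k)"
begin

lemma sub_arcs_eq:
  assumes "m \<le> n" shows "sub_arcs H m = {(par k, k) |k. 2 \<le> k \<and> k \<le> m}"
proof -
  have "par k \<le> m" if "2 \<le> k" "k \<le> m" for k using par[of k] that assms by simp
  then show ?thesis using assms par unfolding sub_arcs_def arcs_H by fastforce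
qed

end

definition outflow :: "(nat \<times> nat) set \<Rightarrow> (nat \<times> nat \<Rightarrow> real) \<Rightarrow> nat \<Rightarrow> real" where
  "outflow E z k = sum z {e \<in> E. fst e = k} - sum z {e \<in> E. snd e = k}"

definition arc_opt :: "tree_problem \<Rightarrow> (nat \<Rightarrow> real) \<Rightarrow> (nat \<times> nat \<Rightarrow> real) \<Rightarrow> order_sign \<Rightarrow> nat \<times> nat \<Rightarrow> bool" where
  "arc_opt H x z s e = arc_ok (- lam H e) (mu H e) s (x (fst e)) (x (snd e)) (z e)"

text \<open>All that one stage hands over to the next. The signs are existential because each stage
  computes its own from the values (\<open>arc_ok_compare\<close>); for \<open>m = n\<close>
  optimality follows by \<open>kkt_minimizer\<close>.\<close>

definition kkt :: "tree_problem \<Rightarrow> nat \<Rightarrow> (nat \<Rightarrow> real) \<Rightarrow> (nat \<times> nat \<Rightarrow> real) \<Rightarrow> bool" where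
  "kkt H m x z \<longleftrightarrow> (\<forall>k\<in>{1..m}. deriv (loss H k) (x k) = outflow (sub_arcs H m) z k) \<and>
     (\<forall>e\<in>sub_arcs H m. \<exists>s. arc_opt H x z s e)"

definition flip :: "order_sign \<Rightarrow> order_sign" where
  "flip s = (case s of LT \<Rightarrow> GT | EQ \<Rightarrow> EQ | GT \<Rightarrow> LT)"

lemma flip_EQ [simp]: "flip s = EQ \<longleftrightarrow> s = EQ"
  by (cases s) (auto simp: flip_def)

lemma flip_flip [simp]: "flip (flip s) = s"
  by (cases s) (auto simp: flip_def)

lemma arc_ok_flip: "arc_ok (- u) (- l) (flip s) b a (- z) \<longleftrightarrow> arc_ok l u s a b z"
proof -
  have 1: "ereal (- z) = - u \<longleftrightarrow> ereal z = u" for u z by (metis ereal_uminus_uminus uminus_ereal.simps(1))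
  have 2: "- u \<le> ereal (- z) \<longleftrightarrow> ereal z \<le> u" "ereal (- z) \<le> - u \<longleftrightarrow> u \<le> ereal z" for u z
    by (metis ereal_minus_le_minus uminus_ereal.simps(1))+
  show ?thesis unfolding arc_ok_def flip_def by (cases s) (auto simp: 1 2)
qed

section \<open>Re-rooting the subtree of a stage at \<open>i\<^sub>m\<close>\<close>

section \<open>The tree of a stage\<close>

locale stage = labelled +
  fixes m :: nat
  assumes m: "1 \<le> m" "m < n"
begin

abbreviation i\<^sub>m :: nat where "i\<^sub>m \<equiv> par (Suc m)"

text \<open>The nodes on the path from the root 1 to \<open>i\<^sub>m\<close>. Apart from
  \<open>i\<^sub>m\<close> itself, these are the nodes from which the arc towards
  \<open>i\<^sub>m\<close> is an outgoing one.\<close>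

definition anc :: "nat set" where
  "anc = {j. (i\<^sub>m, j) \<in> {(k, par k) |k. 2 \<le> k \<and> k \<le> m}\<^sup>*}"

text \<open>Away from the path between root and \<open>i\<^sub>m\<close>, the way to
  \<open>i\<^sub>m\<close> first leads up to the parent; on the path it leads down to the child on
  the path.\<close>

definition nx :: "nat \<Rightarrow> nat" where
  "nx k = (if k \<in> anc then THE c. c \<in> anc \<and> 2 \<le> c \<and> par c = k else par k)"

text \<open>Labels grow towards \<open>i\<^sub>m\<close> on the path from the root to \<open>i\<^sub>m\<close> and fall everywhere else.\<close>

definition rk :: "nat \<Rightarrow> nat" where
  "rk k = (if k \<in> anc then i\<^sub>m - k else i\<^sub>m + k)"

lemma i\<^sub>m: "1 \<le> i\<^sub>m" "i\<^sub>m \<le> m"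
  using par[of "Suc m"] m by auto

lemma par_m: "2 \<le> k \<Longrightarrow> k \<le> m \<Longrightarrow> 1 \<le> par k \<and> par k < k"
  using par[of k] m by simp

lemma i\<^sub>m_anc: "i\<^sub>m \<in> anc"
  by (simp add: anc_def)

lemma par_anc: "k \<in> anc \<Longrightarrow> 2 \<le> k \<Longrightarrow> k \<le> m \<Longrightarrow> par k \<in> anc"
  unfolding anc_def by (auto intro: rtrancl_into_rtrancl)

lemma path_down:
  "(k, j) \<in> {(k, par k) |k. 2 \<le> k \<and> k \<le> m}\<^sup>* \<Longrightarrow> 1 \<le> k \<Longrightarrow> j = k \<or> 1 \<le> j \<and> j < k"
proof (induction rule: rtrancl_induct)
  case (step y z)
  then show ?case using par_m[of y] by auto
qed simp

lemma anc_le: "k \<in> anc \<Longrightarrow> 1 \<le> k \<and> k \<le> i\<^sub>m"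
  using path_down[of "i\<^sub>m" k] i\<^sub>m unfolding anc_def by auto

text \<open>Two ancestors of \<open>i\<^sub>m\<close> are comparable because the parent relation is
  single-valued. If \<open>c\<close> led to a different \<open>c'\<close> with the same parent, that
  parent would lead to \<open>c'\<close> as well, although labels never grow along parents.\<close>

lemma anc_child_unique:
  assumes "c \<in> anc" "c' \<in> anc" "2 \<le> c" "2 \<le> c'" "par c = par c'"
  shows "c = c'"
proof -
  let ?R = "{(k, par k) |k. 2 \<le> k \<and> k \<le> m}"
  have *: "c = c'" if cc: "(c, c') \<in> ?R\<^sup>*" "c \<in> anc" "2 \<le> c'" "par c = par c'" "2 \<le> c" for c c'
  proof (rule ccontr)
    assume ne: "c \<noteq> c'"
    then obtain y where "(c, y) \<in> ?R" and y: "(y, c') \<in> ?R\<^sup>*" using cc(1) by (meson converse_rtranclE)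
    then have "y = par c'" using cc by auto
    then have "(par c', c') \<in> ?R\<^sup>*" using y by simp
    moreover have "c' \<le> m" using path_down[OF cc(1)] cc(2) anc_le[of c] i\<^sub>m by auto
    ultimately show False using path_down[of "par c'" c'] par_m[of c'] cc(3) by auto
  qed
  have "single_valued ?R" by (auto simp: single_valued_def)
  then have "(c, c') \<in> ?R\<^sup>* \<or> (c', c) \<in> ?R\<^sup>*"
    using assms(1,2) unfolding anc_def by (intro single_valued_confluent[of _ "i\<^sub>m"]) simp_all
  then show ?thesis using *[of c c'] *[of c' c] assms by auto
qed

lemma nx_anc:
  assumes "k \<in> anc" "k \<noteq> i\<^sub>m"
  shows "nx k \<in> anc" "2 \<le> nx k" "par (nx k) = k" "k < nx k"
proof -
  obtain c where "(i\<^sub>m, c) \<in> {(k, par k) |k. 2 \<le> k \<and> k \<le> m}\<^sup>*" "(c, k) \<in> {(k, par k) |k. 2 \<le> k \<and> k \<le> m}"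
    using assms unfolding anc_def by (auto elim: rtranclE)
  then have c: "c \<in> anc \<and> 2 \<le> c \<and> par c = k" by (auto simp: anc_def)
  have "nx k = (THE c. c \<in> anc \<and> 2 \<le> c \<and> par c = k)" using assms by (simp add: nx_def)
  moreover have "\<dots> = c" by (rule the_equality) (use c anc_child_unique in auto)
  ultimately show "nx k \<in> anc" "2 \<le> nx k" "par (nx k) = k" "k < nx k"
    using c anc_le[of c] i\<^sub>m par_m[of c] by auto
qed

lemma nx_par: "c \<in> anc \<Longrightarrow> 2 \<le> c \<Longrightarrow> nx (par c) = c"
proof -
  assume c: "c \<in> anc" "2 \<le> c"
  then have cm: "c \<le> m" using anc_le[of c] i\<^sub>m by simp
  have p: "par c \<in> anc" "par c \<noteq> i\<^sub>m" using c cm par_anc par_m[of c] anc_le[of c] by auto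
  show ?thesis using nx_anc[OF p] c anc_child_unique by auto
qed

lemma one_anc: "1 \<in> anc"
proof -
  have "k \<in> anc \<Longrightarrow> 1 \<in> anc" for k
  proof (induction k rule: less_induct)
    case (less k)
    show ?case
    proof (cases "k = 1")
      case False
      then have "2 \<le> k" "k \<le> m" using anc_le[OF less.prems] i\<^sub>m by auto
      then show ?thesis using less par_anc par_m[of k] by blast
    qed (use less in simp)
  qed
  then show ?thesis using i\<^sub>m_anc by blast
qed

lemma not_anc: "k \<in> {1..m} \<Longrightarrow> k \<notin> anc \<Longrightarrow> 2 \<le> k"
  using one_anc by (cases "k = 1") auto

lemma nx_not_anc [simp]: "k \<notin> anc \<Longrightarrow> nx k = par k"
  by (simp add: nx_def)

definition Vm :: "nat set" where
  "Vm = {1..m}"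

sublocale rooted_tree "Vm" "i\<^sub>m" nx rk
proof
  fix k assume "k \<in> Vm" and ki: "k \<noteq> i\<^sub>m"
  then have k: "k \<in> {1..m}" "k \<noteq> i\<^sub>m" by (simp_all add: Vm_def)
  show "nx k \<in> Vm"
  proof (cases "k \<in> anc")
    case True
    then show ?thesis using nx_anc[OF True k(2)] anc_le[of "nx k"] i\<^sub>m by (simp add: Vm_def)
  next
    case False
    then show ?thesis using not_anc[of k] par_m[of k] k by (auto simp: Vm_def)
  qed
  show "rk (nx k) < rk k"
  proof (cases "k \<in> anc")
    case True
    then show ?thesis using nx_anc[OF True k(2)] anc_le[of "nx k"] by (simp add: rk_def)
  next
    case False
    then have "par k < k" using not_anc[of k] par_m[of k] k by auto
    then show ?thesis using False anc_le[of "par k"] i\<^sub>m by (auto simp: rk_def)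
  qed
qed (use i\<^sub>m in \<open>auto simp: Vm_def\<close>)

text \<open>Indexes each arc by its end node farther from \<open>i\<^sub>m\<close>, which turns sums
  over arcs into sums over the nodes other than \<open>i\<^sub>m\<close>.\<close>

definition arc :: "nat \<Rightarrow> nat \<times> nat" where
  "arc k = (if k \<in> anc then (k, nx k) else (nx k, k))"

lemma sub_arcs: "sub_arcs H m = {(par k, k) |k. 2 \<le> k \<and> k \<le> m}"
  using sub_arcs_eq m by simp

lemma sub_arcs_arc: "sub_arcs H m = arc ` (Vm - {i\<^sub>m})"
proof
  show "sub_arcs H m \<subseteq> arc ` (Vm - {i\<^sub>m})"
  proof
    fix e assume "e \<in> sub_arcs H m"
    then obtain c where c: "e = (par c, c)" "2 \<le> c" "c \<le> m" unfolding sub_arcs by blast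
    note pc = par_m[OF c(2,3)]
    show "e \<in> arc ` (Vm - {i\<^sub>m})"
    proof (cases "c \<in> anc")
      case True
      then have "arc (par c) = e" using c par_anc[of c] nx_par by (simp add: arc_def)
      moreover have "par c \<in> Vm - {i\<^sub>m}" using pc c anc_le[OF True] by (auto simp: Vm_def)
      ultimately show ?thesis by blast
    next
      case False
      then have "arc c = e" "c \<noteq> i\<^sub>m" using c i\<^sub>m_anc by (auto simp: arc_def)
      moreover have "c \<in> Vm" using c by (simp add: Vm_def)
      ultimately show ?thesis by (intro image_eqI[of _ _ c]) auto
    qed
  qed
  show "arc ` (Vm - {i\<^sub>m}) \<subseteq> sub_arcs H m"
  proof
    fix e assume "e \<in> arc ` (Vm - {i\<^sub>m})"
    then obtain k where k: "e = arc k" "k \<in> Vm" "k \<noteq> i\<^sub>m" by blast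
    show "e \<in> sub_arcs H m"
    proof (cases "k \<in> anc")
      case True
      have "nx k \<le> m" using anc_le[of "nx k"] nx_anc[OF True k(3)] i\<^sub>m by simp
      then show ?thesis using k True nx_anc[OF True k(3)] unfolding sub_arcs arc_def by force
    next
      case False
      then show ?thesis using k not_anc[of k] unfolding sub_arcs arc_def by (force simp: Vm_def)
    qed
  qed
qed

lemma inj_on_arc: "inj_on arc (Vm - {i\<^sub>m})"
proof (rule inj_onI)
  fix k l assume k: "k \<in> Vm - {i\<^sub>m}" and l: "l \<in> Vm - {i\<^sub>m}" and eq: "arc k = arc l"
  then show "k = l" using nx_anc[of k] nx_anc[of l] by (auto simp: arc_def split: if_splits)
qed

lemma sum_sub_arcs: "(\<Sum>e\<in>sub_arcs H m. F e) = (\<Sum>k\<in>Vm - {i\<^sub>m}. F (arc k))"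
  unfolding sub_arcs_arc by (rule sum.reindex[OF inj_on_arc, unfolded comp_def])

lemma finite_sub_arcs: "finite (sub_arcs H m)"
  unfolding sub_arcs_arc by (simp add: Vm_def)

sublocale rooted_tree_arcs "Vm" "i\<^sub>m" nx rk "sub_arcs H m"
proof
  have 1: "(a, b) \<in> toward \<or> (b, a) \<in> toward" if "(a, b) \<in> sub_arcs H m" for a b
  proof -
    obtain k where "k \<in> Vm" "k \<noteq> i\<^sub>m" "arc k = (a, b)" using \<open>(a, b) \<in> sub_arcs H m\<close> unfolding sub_arcs_arc by force
    then show ?thesis by (auto simp: arc_def toward_iff split: if_splits)
  qed
  have 2: "(a, b) \<in> sub_arcs H m \<or> (b, a) \<in> sub_arcs H m" if "(a, b) \<in> toward" for a b
  proof -
    have "arc a \<in> sub_arcs H m" "arc a = (a, b) \<or> arc a = (b, a)"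
      using that unfolding sub_arcs_arc toward_iff by (auto simp: arc_def)
    then show ?thesis by auto
  qed
  show "adjacent (sub_arcs H m) u v \<longleftrightarrow> (u, v) \<in> toward \<or> (v, u) \<in> toward" for u v
    unfolding adjacent_def using 1 2 by blast
qed

lemma new_arc_tail: "new_arc_tail H m = i\<^sub>m"
  unfolding new_arc_tail_def arcs_H using m by auto

lemma beyond_iff: "i \<in> Vm \<Longrightarrow> j \<in> Vm \<Longrightarrow> beyond H m j i \<longleftrightarrow> (j, i) \<in> toward\<^sup>* \<and> i \<noteq> j"
  unfolding beyond_def path_to_def new_arc_tail
  by (simp only: set_path_from_root psubset_chain_iff)

lemma beyond_nx:
  assumes "k \<in> Vm" "k \<noteq> i\<^sub>m"
  shows "beyond H m k (nx k)" "\<not> beyond H m (nx k) k"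
proof -
  have V: "nx k \<in> Vm" by (rule nx_V[OF assms])
  have "(k, nx k) \<in> toward" using assms by (simp add: toward_iff)
  then show "beyond H m k (nx k)" using beyond_iff[OF V assms(1)] nx_neq[OF assms] by auto
  show "\<not> beyond H m (nx k) k"
    using beyond_iff[OF assms(1) V] toward_rk[of "nx k" k] rk_nx[OF assms] by auto
qed

text \<open>Flow, signs and bounds are read in the direction towards \<open>i\<^sub>m\<close>, which negates the flow on the arcs
  that point away from \<open>i\<^sub>m\<close>.\<close>

definition oz :: "(nat \<times> nat \<Rightarrow> real) \<Rightarrow> nat \<Rightarrow> real" where
  "oz z k = (if k \<in> anc then z (arc k) else - z (arc k))"

definition osg :: "(nat \<times> nat \<Rightarrow> order_sign) \<Rightarrow> nat \<Rightarrow> order_sign" where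
  "osg sn k = (if k \<in> anc then sn (arc k) else flip (sn (arc k)))"

definition olo :: "nat \<Rightarrow> ereal" where
  "olo k = (if k \<in> anc then - lam H (arc k) else - mu H (arc k))"

definition oup :: "nat \<Rightarrow> ereal" where
  "oup k = (if k \<in> anc then mu H (arc k) else lam H (arc k))"

lemma arc_opt_oriented:
  "arc_opt H x z s (arc k) \<longleftrightarrow>
     arc_ok (olo k) (oup k) (if k \<in> anc then s else flip s) (x k) (x (nx k)) (oz z k)"
  using arc_ok_flip[of "mu H (arc k)" "- lam H (arc k)" s "x k" "x (nx k)" "z (arc k)"]
  by (auto simp: arc_opt_def olo_def oup_def oz_def arc_def)

lemma orient_weights: "k \<in> Vm \<Longrightarrow> k \<noteq> i\<^sub>m \<Longrightarrow> olo k \<le> 0 \<and> 0 \<le> oup k"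
proof -
  assume "k \<in> Vm" "k \<noteq> i\<^sub>m"
  then have "arc k \<in> sub_arcs H m" unfolding sub_arcs_arc by blast
  then have "0 \<le> lam H (arc k) \<and> 0 \<le> mu H (arc k)" unfolding sub_arcs using weights m by auto
  then show ?thesis by (auto simp: olo_def oup_def)
qed

lemma sum_if_diff: "finite A \<Longrightarrow> sum g {e \<in> A. P e} - sum g {e \<in> A. Q e}
   = (\<Sum>e\<in>A. g e * ((if P e then 1 else 0) - (if Q e then 1 else (0::real))))"
  unfolding sum.inter_filter sum_subtractf[symmetric] by (rule sum.cong) auto

text \<open>Reversing an arc negates both \<open>oz\<close> and the antisymmetric weight, so the
  product is unchanged. Net outflows and the sums \<open>sigma\<close> both have this form.\<close>

lemma sum_oriented:
  "(\<Sum>e\<in>sub_arcs H m. z e * (p (fst e) (snd e) - p (snd e) (fst e))) =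
   (\<Sum>k\<in>Vm - {i\<^sub>m}. oz z k * (p k (nx k) - p (nx k) k :: real))"
  unfolding sum_sub_arcs by (rule sum.cong) (auto simp: oz_def arc_def algebra_simps)

lemma outflow_oriented:
  assumes "k \<in> Vm" shows "outflow (sub_arcs H m) z k = net (oz z) k"
proof -
  have "outflow (sub_arcs H m) z k = (\<Sum>j\<in>Vm - {i\<^sub>m}. oz z j * ((if j = k then 1 else 0) - (if nx j = k then 1 else 0)))"
    unfolding outflow_def sum_if_diff[OF finite_sub_arcs]
    using sum_oriented[of z "\<lambda>a b. if a = k then 1 else 0"] by simp
  also have "\<dots> = sum (oz z) {j \<in> Vm - {i\<^sub>m}. j = k} - sum (oz z) {j \<in> Vm - {i\<^sub>m}. nx j = k}"
    by (rule sum_if_diff[symmetric]) (simp add: Vm_def)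
  also have "{j \<in> Vm - {i\<^sub>m}. j = k} = (if k = i\<^sub>m then {} else {k})" using assms by auto
  also have "{j \<in> Vm - {i\<^sub>m}. nx j = k} = {j \<in> Vm. j \<noteq> i\<^sub>m \<and> nx j = k}" by auto
  finally show ?thesis by (simp add: net_def)
qed

end

section \<open>The mathematical updates as instances of the block model\<close>

section \<open>The updates of the algorithm\<close>

context stage
begin

definition limit :: "direction \<Rightarrow> ereal" where
  "limit d = (case d of Down \<Rightarrow> - lam H (i\<^sub>m, Suc m) | Up \<Rightarrow> mu H (i\<^sub>m, Suc m))"

text \<open>The last two conditions keep \<open>t\<close> between 0 and the limit; when the values
  of \<open>i\<^sub>m\<close> and the new node meet, this is what puts the flow on the new arc
  within its bounds (\<open>kkt_of_invariant\<close>).\<close>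

definition invariant :: "direction \<Rightarrow> asra_state \<Rightarrow> bool" where
  "invariant d s \<longleftrightarrow>
     (\<forall>k\<in>Vm. deriv (loss H k) (xs s k) = outflow (sub_arcs H m) (zs s) k + (if k = i\<^sub>m then tcur s else 0)) \<and>
     (\<forall>e\<in>sub_arcs H m. arc_opt H (xs s) (zs s) (sg s e) e) \<and>
     deriv (loss H (Suc m)) (xs s (Suc m)) = - tcur s \<and>
     lee d (xs s (Suc m)) (xs s i\<^sub>m) \<and> lee d (limit d) (ereal (tcur s)) \<and> lee d (tcur s) 0"

lemma i\<^sub>m_Vm: "i\<^sub>m \<in> Vm"
  by (rule root)

lemma arc_in: "k \<in> Vm \<Longrightarrow> k \<noteq> i\<^sub>m \<Longrightarrow> arc k \<in> sub_arcs H m"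
  unfolding sub_arcs_arc by blast

lemma arc_eq_iff: "k \<in> Vm \<Longrightarrow> k \<noteq> i\<^sub>m \<Longrightarrow> l \<in> Vm \<Longrightarrow> l \<noteq> i\<^sub>m \<Longrightarrow> arc k = arc l \<longleftrightarrow> k = l"
  using inj_on_arc unfolding inj_on_def by blast

lemma arc_image_iff: "A \<subseteq> Vm - {i\<^sub>m} \<Longrightarrow> k \<in> Vm \<Longrightarrow> k \<noteq> i\<^sub>m \<Longrightarrow> arc k \<in> arc ` A \<longleftrightarrow> k \<in> A"
  using arc_eq_iff by blast

end

locale running = stage +
  fixes s :: asra_state and d :: direction
  assumes inv: "invariant d s" and unequal: "xs s (Suc m) \<noteq> xs s i\<^sub>m"
begin

abbreviation B :: "nat set" where "B \<equiv> block H m s"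

lemma eq_arcs_arc: "eq_arcs H m s = arc ` {k \<in> Vm - {i\<^sub>m}. sg s (arc k) = EQ}"
  unfolding eq_arcs_def sub_arcs_arc by blast

text \<open>In a tree, being connected to \<open>i\<^sub>m\<close> by \<open>EQ\<close> arcs means
  that the unique path to \<open>i\<^sub>m\<close> consists of \<open>EQ\<close> arcs.\<close>

lemma block_chain: "B = {k \<in> Vm. \<forall>j\<in>chain k. j \<noteq> i\<^sub>m \<longrightarrow> sg s (arc j) = EQ}" (is "_ = ?U")
proof
  let ?R = "eq_arcs H m s \<union> (eq_arcs H m s)\<inverse>"
  have edge: "\<exists>k. k \<in> Vm \<and> k \<noteq> i\<^sub>m \<and> sg s (arc k) = EQ \<and> (y = k \<and> z = nx k \<or> y = nx k \<and> z = k)"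
    if yz: "(y, z) \<in> ?R" for y z
  proof -
    obtain k where "k \<in> Vm" "k \<noteq> i\<^sub>m" "sg s (arc k) = EQ" "arc k = (y, z) \<or> arc k = (z, y)"
      using yz unfolding eq_arcs_arc by force
    then show ?thesis by (auto simp: arc_def split: if_splits)
  qed
  show "B \<subseteq> ?U"
  proof
    fix j assume "j \<in> B"
    then have "(i\<^sub>m, j) \<in> ?R\<^sup>*" by (simp add: block_def new_arc_tail)
    then show "j \<in> ?U"
    proof (induction rule: rtrancl_induct)
      case base
      then show ?case by (simp add: chain_root i\<^sub>m_Vm)
    next
      case (step y z)
      then obtain k where k: "k \<in> Vm" "k \<noteq> i\<^sub>m" "sg s (arc k) = EQ" "y = k \<and> z = nx k \<or> y = nx k \<and> z = k"
        using edge by blast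
      then show ?case using step.IH chain_nx[OF k(1,2)] nx_V[OF k(1,2)] by auto
    qed
  qed
  show "?U \<subseteq> B"
  proof
    fix k assume "k \<in> ?U"
    then have "(i\<^sub>m, k) \<in> ?R\<^sup>*"
    proof (induction "rk k" arbitrary: k rule: less_induct)
      case less
      show ?case
      proof (cases "k = i\<^sub>m")
        case False
        then have k: "k \<in> Vm" "k \<noteq> i\<^sub>m" using less.prems by auto
        then have ch: "chain k = insert k (chain (nx k))" by (rule chain_nx)
        then have "nx k \<in> ?U" using less.prems nx_V[OF k] by blast
        then have "(i\<^sub>m, nx k) \<in> ?R\<^sup>*" using less.hyps rk_nx[OF k] by blast
        moreover have "arc k \<in> eq_arcs H m s" using less.prems k ch unfolding eq_arcs_arc by blast
        then have "(nx k, k) \<in> ?R" by (auto simp: arc_def split: if_splits)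
        ultimately show ?thesis by (rule rtrancl_into_rtrancl)
      qed simp
    qed
    then show "k \<in> B" using \<open>k \<in> ?U\<close> by (simp add: block_def new_arc_tail Vm_def)
  qed
qed

lemma block_nx: "k \<in> Vm \<Longrightarrow> k \<noteq> i\<^sub>m \<Longrightarrow> k \<in> B \<longleftrightarrow> nx k \<in> B \<and> sg s (arc k) = EQ"
  unfolding block_chain using chain_nx[of k] nx_V[of k] by auto

lemma osg_EQ [simp]: "osg sn k = EQ \<longleftrightarrow> sn (arc k) = EQ"
  by (simp add: osg_def)

sublocale flow_block Vm "i\<^sub>m" nx rk B "loss H" "xs s" "oz (zs s)" "tcur s" "osg (sg s)" olo oup d
  "loss H (Suc m)" "limit d" "xs s (Suc m)"
proof
  show "B \<subseteq> Vm" unfolding block_chain by blast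
  show "i\<^sub>m \<in> B" unfolding block_chain by (simp add: chain_root i\<^sub>m_Vm)
  then show "nx k \<in> B" if "k \<in> B" "k \<noteq> i\<^sub>m" for k
    using that block_nx[of k] \<open>B \<subseteq> Vm\<close> by blast
  show "osg (sg s) k = EQ" if "k \<in> B" "k \<noteq> i\<^sub>m" for k
    using that block_nx[of k] \<open>B \<subseteq> Vm\<close> by auto
  show "k \<in> B" if "k \<in> Vm" "k \<noteq> i\<^sub>m" "nx k \<in> B" "osg (sg s) k = EQ" for k
    using that block_nx[of k] by simp
  show "smooth_strongly_convex (loss H k)" if "k \<in> Vm" for k using that ssc_loss[of k] m by (simp add: Vm_def)
  show "smooth_strongly_convex (loss H (Suc m))" using ssc_loss[of "Suc m"] m by simp
  show "deriv (loss H k) (xs s k) = net (oz (zs s)) k + (if k = i\<^sub>m then tcur s else 0)" if "k \<in> Vm" for k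
    using inv that outflow_oriented[OF that, of "zs s"] by (simp add: invariant_def)
  show "arc_ok (olo k) (oup k) (osg (sg s) k) (xs s k) (xs s (nx k)) (oz (zs s) k)"
    if "k \<in> Vm" "k \<noteq> i\<^sub>m" for k
    using inv arc_in[OF that] arc_opt_oriented[of "xs s" "zs s" "sg s (arc k)" k]
    by (simp add: invariant_def osg_def)
  show "olo k \<le> 0 \<and> 0 \<le> oup k" if "k \<in> Vm" "k \<noteq> i\<^sub>m" for k
    using that orient_weights by simp
  show "deriv (loss H (Suc m)) (xs s (Suc m)) = - tcur s" "lee d (xs s (Suc m)) (xs s i\<^sub>m)"
    "lee d (limit d) (ereal (tcur s))"
    using inv by (simp_all add: invariant_def)
  show "xs s (Suc m) \<noteq> xs s i\<^sub>m" by (rule unequal)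
qed

lemma B_Vm: "k \<in> B \<Longrightarrow> k \<in> Vm"
  using B_V by blast

lemma Suc_m_notin: "Suc m \<notin> Vm" "Suc m \<notin> B"
  using B_V by (auto simp: Vm_def)

text \<open>No edge leaves the block towards \<open>i\<^sub>m\<close>, so with \<open>S\<close>
  inside the block only flow entering \<open>S\<close> from outside remains; grouping these edges by
  their \<open>nx\<close> gives \<open>sig\<close>.\<close>

lemma sigma_eq:
  assumes "S \<subseteq> B" shows "sigma H m s S = sum sig S"
proof -
  let ?z = "oz (zs s)"
  let ?T = "{k \<in> Vm. k \<notin> B \<and> nx k \<in> S}"
  have "sigma H m s S = sum (zs s) {e \<in> sub_arcs H m. fst e \<in> S \<and> snd e \<notin> B}
      - sum (zs s) {e \<in> sub_arcs H m. snd e \<in> S \<and> fst e \<notin> B}"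
    unfolding sigma_def by (intro arg_cong2[where f = "(-)"] arg_cong[where f = "sum (zs s)"]) auto
  also have "\<dots> = (\<Sum>k\<in>Vm - {i\<^sub>m}. ?z k *
      ((if k \<in> S \<and> nx k \<notin> B then 1 else 0) - (if nx k \<in> S \<and> k \<notin> B then 1 else 0)))"
    unfolding sum_if_diff[OF finite_sub_arcs]
    using sum_oriented[of "zs s" "\<lambda>a b. if a \<in> S \<and> b \<notin> B then 1 else 0"] by simp
  also have "\<dots> = (\<Sum>k\<in>Vm - {i\<^sub>m}. - (if nx k \<in> S \<and> k \<notin> B then ?z k else 0))"
    using assms nx_B by (intro sum.cong) auto
  also have "\<dots> = - sum ?z {k \<in> Vm - {i\<^sub>m}. nx k \<in> S \<and> k \<notin> B}"
    using finite_V by (simp only: sum_negf sum.inter_filter[OF finite_Diff[OF finite_V]])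
  also have "{k \<in> Vm - {i\<^sub>m}. nx k \<in> S \<and> k \<notin> B} = ?T" using root_B by auto
  also have "sum ?z ?T = (\<Sum>l\<in>S. sum ?z {k \<in> ?T. nx k = l})"
    using finite_V finite_subset[OF assms finite_B] by (intro sum.group[symmetric]) auto
  also have "\<dots> = (\<Sum>l\<in>S. - sig l)"
    unfolding sig_def by (intro sum.cong refl) (auto intro: arg_cong[where f = "sum ?z"])
  finally show ?thesis by (simp add: sum_negf)
qed

lemma cut_side_eq: "k \<in> B \<Longrightarrow> cut_side H m s k = branch k"
  unfolding cut_side_def branch_def using beyond_iff B_Vm by (auto simp: Vm_def)

lemma block_x_eq: "block_x H m s u = pot_inv i\<^sub>m u"
  unfolding block_x_def pot_inv_def branch_loss_def branch_root sigma_eq[OF subset_refl]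
  using ssc_branch_loss[OF root_B] by (simp add: deriv_conjugate branch_loss_def branch_root)

lemma xq_eq: "xq H m s k u = (if k \<in> B then pot_inv i\<^sub>m u
    else if k = Suc m then deriv_inv (loss H (Suc m)) (- u) else xs s k)"
  unfolding xq_def block_x_eq using ssc_fn by (simp add: deriv_conjugate)

lemma zq_arc:
  assumes "k \<in> B" "k \<noteq> i\<^sub>m"
  shows "zq H m s (arc k) u = (if k \<in> anc then pot k (pot_inv i\<^sub>m u) else - pot k (pot_inv i\<^sub>m u))"
proof -
  have "(\<Sum>l\<in>branch k. deriv (loss H l) (xq H m s l u)) = (\<Sum>l\<in>branch k. deriv (loss H l) (pot_inv i\<^sub>m u))"
    using branch_B by (intro sum.cong) (auto simp: xq_eq)
  then show ?thesis
    using assms beyond_nx[of k] B_Vm[of k] unfolding zq_def arc_def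
    by (cases "k \<in> anc") (simp_all add: cut_side_eq sigma_eq[OF branch_B] pot_def sum_subtractf)
qed

lemma block_arcs_eq: "block_arcs H m s = arc ` (B - {i\<^sub>m})"
proof -
  have "arc k \<in> {(i, j). i \<in> B \<and> j \<in> B} \<longleftrightarrow> k \<in> B \<and> nx k \<in> B" for k by (auto simp: arc_def)
  moreover have "block_arcs H m s = eq_arcs H m s \<inter> {(i, j). i \<in> B \<and> j \<in> B}"
    unfolding block_arcs_def by blast
  moreover have "arc ` A \<inter> X = arc ` {k \<in> A. arc k \<in> X}" for A X by blast
  ultimately have "block_arcs H m s = arc ` {k \<in> Vm - {i\<^sub>m}. sg s (arc k) = EQ \<and> k \<in> B \<and> nx k \<in> B}"
    by (simp add: eq_arcs_arc conj_ac)
  moreover have "{k \<in> Vm - {i\<^sub>m}. sg s (arc k) = EQ \<and> k \<in> B \<and> nx k \<in> B} = B - {i\<^sub>m}"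
    using block_nx B_Vm by auto
  ultimately show ?thesis by simp
qed

text \<open>For any solution of the meeting equation, the common value of block and new node makes
  the derivative of their joint loss equal to the total of \<open>sig\<close>, so it is
  \<open>y_meet\<close>.\<close>

lemma delta_meet_eq: "delta_meet H m s = - deriv (loss H (Suc m)) y_meet - tcur s"
  unfolding delta_meet_def new_arc_tail
proof (rule the_equality)
  have "pot_inv i\<^sub>m (- deriv (loss H (Suc m)) y_meet) = y_meet"
    using pot_meet by (intro pot_inv_unique[OF root_B])
  moreover have "deriv_inv (loss H (Suc m)) (deriv (loss H (Suc m)) y_meet) = y_meet"
    using ssc_fn by (intro deriv_inv_unique) auto
  ultimately show "xq H m s i\<^sub>m (tcur s + (- deriv (loss H (Suc m)) y_meet - tcur s))
      = xq H m s (Suc m) (tcur s + (- deriv (loss H (Suc m)) y_meet - tcur s))"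
    using root_B Suc_m_notin by (simp add: xq_eq)
next
  fix a assume "xq H m s i\<^sub>m (tcur s + a) = xq H m s (Suc m) (tcur s + a)"
  then have y: "pot_inv i\<^sub>m (tcur s + a) = deriv_inv (loss H (Suc m)) (- (tcur s + a))"
    using root_B Suc_m_notin by (simp add: xq_eq)
  define y where "y = pot_inv i\<^sub>m (tcur s + a)"
  have "pot i\<^sub>m y = tcur s + a" unfolding y_def using root_B by simp
  moreover have "deriv (loss H (Suc m)) y = - (tcur s + a)" unfolding y_def y using ssc_fn by simp
  ultimately have 1: "pot i\<^sub>m y = tcur s + a" "deriv (loss H (Suc m)) y = - (tcur s + a)" by blast+
  have "deriv (\<lambda>v. branch_loss i\<^sub>m v + loss H (Suc m) v) y = sum sig B"
    using 1 pot_eq[OF root_B, of y] ssc_branch_loss[OF root_B] ssc_fn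
    by (simp add: deriv_add_ssc branch_root)
  then have "y_meet = y" unfolding y_meet_def
    using ssc_branch_loss[OF root_B] ssc_fn by (intro deriv_inv_unique ssc_add)
  then show "a = - deriv (loss H (Suc m)) y_meet - tcur s" using 1 by simp
qed

lemma the_increment: "(THE a. block_x H m s (tcur s + a) = v) = pot i\<^sub>m v - tcur s"
  unfolding block_x_eq
proof (rule the_equality)
  show "pot_inv i\<^sub>m (tcur s + (pot i\<^sub>m v - tcur s)) = v" using pot_inv_unique[OF root_B] by simp
  show "a = pot i\<^sub>m v - tcur s" if "pot_inv i\<^sub>m (tcur s + a) = v" for a
    using that pot_pot_inv[OF root_B, of "tcur s + a"] by simp
qed

text \<open>The event of the arc lies ahead by \<open>event_ne\<close>, which gives the required
  sign of the increment; uniqueness comes from the injectivity of \<open>pot k\<close> and of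
  \<open>pot_inv\<close> at the root.\<close>

lemma the_arc_increment:
  assumes "k \<in> B" "k \<noteq> i\<^sub>m" "bnd d (olo k) (oup k) = ereal b"
  shows "(THE a. lee d a 0 \<and> pot k (pot_inv i\<^sub>m (tcur s + a)) = b) = pot i\<^sub>m (pot_inv k b) - tcur s"
proof (rule the_equality)
  have "cnd k = ereal (pot_inv k b)" using assms(3) by (simp add: cnd_def)
  moreover have "cnd k \<in> events" using assms unfolding events_def by blast
  moreover have "ereal c \<noteq> worst d" for c by (cases d) (simp_all add: worst_def)
  ultimately have "lee d (pot_inv k b) (xs s i\<^sub>m)" using event_ne[of "cnd k"] by auto
  then have "lee d (pot i\<^sub>m (pot_inv k b)) (tcur s)" 
    using lee_pot[OF root_B, of d "pot_inv k b" "xs s i\<^sub>m"] pot_old[OF root_B] by simp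
  then have "lee d (pot i\<^sub>m (pot_inv k b) - tcur s) 0" by (cases d) (simp_all add: lee_def)
  moreover have "pot_inv i\<^sub>m (tcur s + (pot i\<^sub>m (pot_inv k b) - tcur s)) = pot_inv k b"
    using pot_inv_unique[OF root_B] by simp
  ultimately show "lee d (pot i\<^sub>m (pot_inv k b) - tcur s) 0 \<and>
      pot k (pot_inv i\<^sub>m (tcur s + (pot i\<^sub>m (pot_inv k b) - tcur s))) = b"
    using assms by simp
next
  fix a assume "lee d a 0 \<and> pot k (pot_inv i\<^sub>m (tcur s + a)) = b"
  then have "pot_inv k b = pot_inv i\<^sub>m (tcur s + a)" using pot_inv_unique[OF assms(1)] by blast
  then show "a = pot i\<^sub>m (pot_inv k b) - tcur s" using root_B by simp
qed

lemma conv_worst: "conv (worst d) = worst d"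
proof -
  have "\<bar>worst d\<bar> = \<infinity>" by (cases d) (simp_all add: worst_def)
  then show ?thesis by (simp add: conv_def)
qed

lemma conv_cnd:
  assumes "k \<in> B" "k \<noteq> i\<^sub>m"
  shows "conv (cnd k) = (if \<bar>bnd d (olo k) (oup k)\<bar> = \<infinity> then worst d
    else ereal (THE a. lee d a 0 \<and> pot k (pot_inv i\<^sub>m (tcur s + a)) = real_of_ereal (bnd d (olo k) (oup k))))"
proof (cases "\<bar>bnd d (olo k) (oup k)\<bar> = \<infinity>")
  case True
  then show ?thesis using conv_worst by (simp add: cnd_def)
next
  case False
  then obtain b where "bnd d (olo k) (oup k) = ereal b" by auto
  then show ?thesis using the_arc_increment[OF assms] by (simp add: cnd_def conv_def)
qed

lemma delta_arc_minus_eq: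
  assumes "k \<in> B" "k \<noteq> i\<^sub>m" and d: "d = Down"
  shows "delta_arc_minus H m s (arc k) = conv (cnd k)"
proof -
  have e: "bnd d (olo k) (oup k) = olo k" "worst d = -\<infinity>" "\<And>a :: real. lee d a 0 = (a \<le> 0)"
    by (simp_all add: d bnd_def worst_def lee_def)
  have c: "conv (cnd k) = (if \<bar>olo k\<bar> = \<infinity> then -\<infinity>
      else ereal (THE a. a \<le> 0 \<and> pot k (pot_inv i\<^sub>m (tcur s + a)) = real_of_ereal (olo k)))"
    using conv_cnd[OF assms(1,2)] unfolding e .
  have eq: "ereal a = - b \<longleftrightarrow> - a = real_of_ereal b" "ereal a = b \<longleftrightarrow> a = real_of_ereal b"
    if "\<bar>b\<bar> \<noteq> \<infinity>" for a and b :: ereal using that by (cases b; auto)+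
  show ?thesis unfolding c
  proof (cases "k \<in> anc")
    case True
    then show "delta_arc_minus H m s (arc k) = (if \<bar>olo k\<bar> = \<infinity> then -\<infinity>
      else ereal (THE a. a \<le> 0 \<and> pot k (pot_inv i\<^sub>m (tcur s + a)) = real_of_ereal (olo k)))"
      using zq_arc[OF assms(1,2)] beyond_nx[of k] B_Vm[OF assms(1)] assms(2)
      by (auto simp: delta_arc_minus_def arc_def olo_def eq Let_def)
  next
    case False
    have "mu H (arc k) = - olo k" using False by (simp add: olo_def)
    then show "delta_arc_minus H m s (arc k) = (if \<bar>olo k\<bar> = \<infinity> then -\<infinity>
      else ereal (THE a. a \<le> 0 \<and> pot k (pot_inv i\<^sub>m (tcur s + a)) = real_of_ereal (olo k)))"
      using zq_arc[OF assms(1,2)] beyond_nx[of k] B_Vm[OF assms(1)] assms(2) False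
      by (auto simp: delta_arc_minus_def arc_def eq Let_def)
  qed
qed

lemma delta_arc_plus_eq:
  assumes "k \<in> B" "k \<noteq> i\<^sub>m" and d: "d = Up"
  shows "delta_arc_plus H m s (arc k) = conv (cnd k)"
proof -
  have e: "bnd d (olo k) (oup k) = oup k" "worst d = \<infinity>" "\<And>a :: real. lee d a 0 = (0 \<le> a)"
    by (simp_all add: d bnd_def worst_def lee_def)
  have c: "conv (cnd k) = (if \<bar>oup k\<bar> = \<infinity> then \<infinity>
      else ereal (THE a. 0 \<le> a \<and> pot k (pot_inv i\<^sub>m (tcur s + a)) = real_of_ereal (oup k)))"
    using conv_cnd[OF assms(1,2)] unfolding e .
  have eq: "ereal a = - b \<longleftrightarrow> - a = real_of_ereal b" "ereal a = b \<longleftrightarrow> a = real_of_ereal b"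
    if "\<bar>b\<bar> \<noteq> \<infinity>" for a and b :: ereal using that by (cases b; auto)+
  show ?thesis unfolding c
  proof (cases "k \<in> anc")
    case True
    then show "delta_arc_plus H m s (arc k) = (if \<bar>oup k\<bar> = \<infinity> then \<infinity>
      else ereal (THE a. 0 \<le> a \<and> pot k (pot_inv i\<^sub>m (tcur s + a)) = real_of_ereal (oup k)))"
      using zq_arc[OF assms(1,2)] beyond_nx[of k] B_Vm[OF assms(1)] assms(2)
      by (auto simp: delta_arc_plus_def arc_def oup_def eq Let_def)
  next
    case False
    then show "delta_arc_plus H m s (arc k) = (if \<bar>oup k\<bar> = \<infinity> then \<infinity>
      else ereal (THE a. 0 \<le> a \<and> pot k (pot_inv i\<^sub>m (tcur s + a)) = real_of_ereal (oup k)))"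
      using zq_arc[OF assms(1,2)] beyond_nx[of k] B_Vm[OF assms(1)] assms(2)
      by (auto simp: delta_arc_plus_def arc_def oup_def eq Let_def)
  qed
qed

text \<open>The domain on which \<open>conv\<close> preserves the order: it sends both infinities to
  \<open>worst d\<close>, so the opposite infinity has to be excluded before \<open>conv\<close> is
  exchanged with extrema.\<close>

definition finite_or_worst :: "ereal set" where
  "finite_or_worst = insert (worst d) (range ereal)"

lemma best_conv:
  assumes "a \<in> finite_or_worst" "b \<in> finite_or_worst"
  shows "best d (conv a) (conv b) = conv (best d a b)" "best d a b \<in> finite_or_worst"
proof -
  have *: "best d (ereal p) (ereal q) = (if lee d p q then ereal q else ereal p)" for p q
    by (cases d) (auto simp: best_def lee_def max_def min_def)
  have "lee d (pot i\<^sub>m p - tcur s) (pot i\<^sub>m q - tcur s) = lee d p q" for p q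
    using lee_pot[OF root_B, of d p q] by (cases d) (auto simp: lee_def)
  then have "best d (conv (ereal p)) (conv (ereal q)) = conv (best d (ereal p) (ereal q))" for p q
    by (simp add: conv_def *)
  then show "best d (conv a) (conv b) = conv (best d a b)"
    using assms unfolding finite_or_worst_def by (elim insertE rangeE) (simp_all add: conv_worst)
  show "best d a b \<in> finite_or_worst" using assms best_cases[of d a b] by auto
qed

lemma conv_bestS:
  assumes "finite A" "A \<subseteq> finite_or_worst"
  shows "bestS d (conv ` A) = conv (bestS d A)" "bestS d A \<in> finite_or_worst"
proof -
  have "bestS d (conv ` A) = conv (bestS d A) \<and> bestS d A \<in> finite_or_worst"
    using assms
  proof (induction A rule: finite_induct)
    case (insert a A)
    then have "a \<in> finite_or_worst" "bestS d A \<in> finite_or_worst" "bestS d (conv ` A) = conv (bestS d A)" by auto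
    then show ?case using best_conv[of a "bestS d A"] by (simp add: bestS_insert)
  qed (simp add: conv_worst finite_or_worst_def)
  then show "bestS d (conv ` A) = conv (bestS d A)" "bestS d A \<in> finite_or_worst" by blast+
qed

lemma cnd_finite_or_worst: "cnd ` A \<subseteq> finite_or_worst"
  by (auto simp: cnd_def finite_or_worst_def)

text \<open>The mathematical algorithm recognizes detaching arcs by their time increments, the
  program by their block values; strict monotonicity of the potential at \<open>i\<^sub>m\<close>
  makes the two tests agree.\<close>

lemma conv_cnd_eq: "conv (cnd k) = ereal (t_next - tcur s) \<longleftrightarrow> cnd k = ereal v_next"
proof -
  have "cnd k = worst d \<or> (\<exists>b. cnd k = ereal b)" by (simp add: cnd_def)
  moreover have "worst d \<noteq> ereal b" "ereal b \<noteq> worst d" for b by (cases d; simp add: worst_def)+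
  moreover have "pot i\<^sub>m b = t_next \<longleftrightarrow> b = v_next" for b
    using strict_mono_eq[OF strict_mono_pot[OF root_B], of b v_next] by simp
  ultimately show ?thesis by (auto simp: conv_worst) (auto simp: conv_def)
qed

text \<open>The common description met by the mathematical update and the program. Flows are fixed
  on all pairs, because the final dual values are compared as whole functions; signs only on arcs
  and only if the stage continues.\<close>

definition update_spec :: "asra_state \<Rightarrow> bool \<Rightarrow> bool" where
  "update_spec s' fd \<longleftrightarrow> tcur s' = t_next \<and>
     xs s' = (\<lambda>k. if k \<in> B then v_next else if k = Suc m then w_next else xs s k) \<and>
     (\<forall>k\<in>B - {i\<^sub>m}. zs s' (arc k) = (if k \<in> anc then pot k v_next else - pot k v_next)) \<and>
     (\<forall>e. e \<notin> arc ` (B - {i\<^sub>m}) \<longrightarrow> zs s' e = zs s e) \<and>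
     (fd \<longleftrightarrow> ereal t_next = limit d \<or> v_next = w_next) \<and>
     (\<not> fd \<longrightarrow> (\<forall>k\<in>Vm - {i\<^sub>m}. osg (sg s') k = S_next k))"

lemma nx_B': "k \<in> B \<Longrightarrow> k \<noteq> i\<^sub>m \<Longrightarrow> k \<in> anc \<Longrightarrow> nx k \<in> B"
  "k \<in> B \<Longrightarrow> k \<noteq> i\<^sub>m \<Longrightarrow> k \<notin> anc \<Longrightarrow> par k \<in> B"
  using nx_B[of k] by simp_all

lemma flip_eq: "flip a = att d \<longleftrightarrow> a = flip (att d)"
  by (metis flip_flip)

text \<open>An outside neighbour of the block is the farther end of its arc. For arcs leaving the
  block this is the head, so they are read against their orientation and their sign appears
  flipped.\<close>

lemma omega_plus_eq: "{e \<in> omega_plus H m s. sg s e = flip (att d)} = arc ` {k \<in> joining. k \<notin> anc}"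
proof -
  have "{e \<in> omega_plus H m s. sg s e = flip (att d)}
      = {e \<in> sub_arcs H m. fst e \<in> B \<and> snd e \<notin> B \<and> sg s e = flip (att d)}"
    unfolding omega_plus_def by auto
  also have "\<dots> = arc ` {k \<in> Vm - {i\<^sub>m}. fst (arc k) \<in> B \<and> snd (arc k) \<notin> B \<and> sg s (arc k) = flip (att d)}"
    unfolding sub_arcs_arc by auto
  also have "{k \<in> Vm - {i\<^sub>m}. fst (arc k) \<in> B \<and> snd (arc k) \<notin> B \<and> sg s (arc k) = flip (att d)}
      = {k \<in> joining. k \<notin> anc}"
    using nx_B' flip_eq unfolding joining_def by (auto simp: arc_def osg_def split: if_splits)
  finally show ?thesis .
qed

lemma omega_minus_eq: "{e \<in> omega_minus H m s. sg s e = att d} = arc ` {k \<in> joining. k \<in> anc}"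
proof -
  have "{e \<in> omega_minus H m s. sg s e = att d}
      = {e \<in> sub_arcs H m. fst e \<notin> B \<and> snd e \<in> B \<and> sg s e = att d}"
    unfolding omega_minus_def by auto
  also have "\<dots> = arc ` {k \<in> Vm - {i\<^sub>m}. fst (arc k) \<notin> B \<and> snd (arc k) \<in> B \<and> sg s (arc k) = att d}"
    unfolding sub_arcs_arc by auto
  also have "{k \<in> Vm - {i\<^sub>m}. fst (arc k) \<notin> B \<and> snd (arc k) \<in> B \<and> sg s (arc k) = att d}
      = {k \<in> joining. k \<in> anc}"
    using nx_B' flip_eq unfolding joining_def by (auto simp: arc_def osg_def split: if_splits)
  finally show ?thesis .
qed

definition extreme :: "real set \<Rightarrow> real" where
  "extreme X = (case d of Down \<Rightarrow> Max X | Up \<Rightarrow> Min X)"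

lemma first_join:
  assumes "J \<subseteq> joining" "\<And>k. k \<in> J \<Longrightarrow> far (arc k) = xs s k"
  shows "(if arc ` J = {} then worst d
     else ereal (THE a. block_x H m s (tcur s + a) = extreme (far ` arc ` J)))
     = conv (bestS d ((\<lambda>k. ereal (xs s k)) ` J))"
proof (cases "J = {}")
  case False
  have X: "far ` arc ` J = xs s ` J" using assms(2) by (simp add: image_image)
  have fin: "finite (xs s ` J)" using assms(1) finite_V unfolding joining_def by (auto intro: finite_subset)
  have "bestS d (ereal ` xs s ` J) = ereal (extreme (xs s ` J))"
  proof (rule lee_antisym[of d])
    show "lee d (bestS d (ereal ` xs s ` J)) (ereal (extreme (xs s ` J)))"
      using fin by (intro bestS_leeI) (auto simp: lee_def extreme_def split: direction.split)
    have "extreme (xs s ` J) \<in> xs s ` J" using fin False by (auto simp: extreme_def split: direction.split)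
    then show "lee d (ereal (extreme (xs s ` J))) (bestS d (ereal ` xs s ` J))"
      by (intro bestS_lee) blast
  qed
  then show ?thesis using False X by (simp add: the_increment conv_def image_image)
qed (simp add: conv_worst)

text \<open>The increments of the three kinds of events are computed separately and then combined;
  since \<open>conv\<close> commutes with \<open>best d\<close> on \<open>finite_or_worst\<close>,
  this is the increment of the first event overall. Used for the mathematical update and for the
  program.\<close>

lemma increments_combined:
  "best d (conv (bestS d (cnd ` (B - {i\<^sub>m}))))
     (best d (conv (bestS d ((\<lambda>k. ereal (xs s k)) ` {k \<in> joining. k \<notin> anc})))
             (conv (bestS d ((\<lambda>k. ereal (xs s k)) ` {k \<in> joining. k \<in> anc}))))
   = conv (bestS d events)"
proof -
  have J: "joining = {k \<in> joining. k \<notin> anc} \<union> {k \<in> joining. k \<in> anc}" by blast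
  have fin: "finite joining" using finite_V unfolding joining_def by simp
  have *: "bestS d ((\<lambda>k. ereal (xs s k)) ` {k \<in> joining. Q k}) \<in> finite_or_worst" for Q
    using fin by (intro conv_bestS(2)) (auto simp: finite_or_worst_def)
  have "bestS d events = best d (bestS d (cnd ` (B - {i\<^sub>m})))
     (best d (bestS d ((\<lambda>k. ereal (xs s k)) ` {k \<in> joining. k \<notin> anc}))
             (bestS d ((\<lambda>k. ereal (xs s k)) ` {k \<in> joining. k \<in> anc})))"
    unfolding events_def by (subst J) (simp only: image_Un bestS_union)
  moreover have "bestS d (cnd ` (B - {i\<^sub>m})) \<in> finite_or_worst"
    using finite_B cnd_finite_or_worst by (intro conv_bestS(2)) auto
  ultimately show ?thesis using * by (simp add: best_conv)
qed

lemma update_spec_intro: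
  assumes fd: "fd \<longleftrightarrow> ereal t_next = limit d \<or> xq H m s i\<^sub>m t_next = xq H m s (Suc m) t_next"
    and sn: "ereal t_next \<noteq> limit d \<Longrightarrow> v_next \<noteq> w_next \<Longrightarrow> \<forall>k\<in>Vm - {i\<^sub>m}. osg sn k = S_next k"
  shows "update_spec \<lparr>tcur = t_next, xs = (\<lambda>i. xq H m s i t_next), zs = z_tilde H m s t_next,
     sg = (if fd then sg s else sn)\<rparr> fd"
proof -
  have x: "xq H m s k t_next = (if k \<in> B then v_next else if k = Suc m then w_next else xs s k)" for k
    by (simp add: xq_eq v_next_def w_next_def)
  then have f: "fd \<longleftrightarrow> ereal t_next = limit d \<or> v_next = w_next" using fd root_B Suc_m_notin by simp
  have "z_tilde H m s t_next (arc k) = (if k \<in> anc then pot k v_next else - pot k v_next)"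
    if "k \<in> B - {i\<^sub>m}" for k
    using that zq_arc[of k t_next] by (simp add: z_tilde_def block_arcs_eq v_next_def)
  moreover have "z_tilde H m s t_next e = zs s e" if "e \<notin> arc ` (B - {i\<^sub>m})" for e
    using that by (simp add: z_tilde_def block_arcs_eq)
  ultimately show ?thesis using f x sn by (auto simp: update_spec_def)
qed

text \<open>Only if the stage continues is \<open>dt\<close> the increment actually taken; then the
  time \<open>tq\<close> at which the sets of changing arcs are evaluated is
  \<open>t_next\<close>.\<close>

lemma new_signs:
  assumes e: "ereal t_next \<noteq> limit d" "v_next \<noteq> w_next"
    and delta: "\<And>k. k \<in> B - {i\<^sub>m} \<Longrightarrow> \<delta> (arc k) = conv (cnd k)"
    and dt: "dt = conv (bestS d events)" and tq: "tq = tcur s + real_of_ereal dt"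
    and k: "k \<in> Vm - {i\<^sub>m}"
  shows "arc k \<in> {(i, j) \<in> block_arcs H m s. \<delta> (i, j) = dt \<and> beyond H m i j} \<longleftrightarrow>
      k \<in> B \<and> k \<in> anc \<and> cnd k = ereal v_next"
    and "arc k \<in> {(i, j) \<in> block_arcs H m s. \<delta> (i, j) = dt \<and> beyond H m j i} \<longleftrightarrow>
      k \<in> B \<and> k \<notin> anc \<and> cnd k = ereal v_next"
    and "arc k \<in> {(i, j) \<in> {e \<in> omega_plus H m s. sg s e = flip (att d)}. xq H m s i tq = xs s j} \<longleftrightarrow>
      k \<in> joining \<and> k \<notin> anc \<and> xs s k = v_next"
    and "arc k \<in> {(i, j) \<in> {e \<in> omega_minus H m s. sg s e = att d}. xq H m s j tq = xs s i} \<longleftrightarrow>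
      k \<in> joining \<and> k \<in> anc \<and> xs s k = v_next"
proof -
  have dt': "dt = ereal (t_next - tcur s)" using event_attained[OF e] dt by simp
  then have tq': "tq = t_next" using tq by simp
  have k': "k \<in> Vm" "k \<noteq> i\<^sub>m" using k by auto
  have inB: "arc k \<in> block_arcs H m s \<longleftrightarrow> k \<in> B"
    unfolding block_arcs_eq using B_V k' by (subst arc_image_iff) auto
  have J: "arc k \<in> arc ` {k \<in> joining. Q k} \<longleftrightarrow> k \<in> joining \<and> Q k" for Q
    using k' by (subst arc_image_iff) (auto simp: joining_def)
  note by1 = beyond_nx[OF k']
  have \<delta>: "k \<in> B \<Longrightarrow> \<delta> (arc k) = dt \<longleftrightarrow> cnd k = ereal v_next"
    using delta[of k] k' conv_cnd_eq[of k] dt' by simp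
  show "arc k \<in> {(i, j) \<in> block_arcs H m s. \<delta> (i, j) = dt \<and> beyond H m i j} \<longleftrightarrow>
      k \<in> B \<and> k \<in> anc \<and> cnd k = ereal v_next"
    using inB \<delta> by1 by (cases "k \<in> anc") (auto simp: arc_def)
  show "arc k \<in> {(i, j) \<in> block_arcs H m s. \<delta> (i, j) = dt \<and> beyond H m j i} \<longleftrightarrow>
      k \<in> B \<and> k \<notin> anc \<and> cnd k = ereal v_next"
    using inB \<delta> by1 by (cases "k \<in> anc") (auto simp: arc_def)
  have v: "j \<in> B \<Longrightarrow> xq H m s j tq = v_next" for j by (simp add: xq_eq tq' v_next_def)
  show "arc k \<in> {(i, j) \<in> {e \<in> omega_plus H m s. sg s e = flip (att d)}. xq H m s i tq = xs s j} \<longleftrightarrow>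
      k \<in> joining \<and> k \<notin> anc \<and> xs s k = v_next"
    unfolding omega_plus_eq using J[of "\<lambda>k. k \<notin> anc"] v[of "nx k"]
    by (cases "k \<in> joining"; cases "k \<in> anc") (auto simp: arc_def joining_def)
  show "arc k \<in> {(i, j) \<in> {e \<in> omega_minus H m s. sg s e = att d}. xq H m s j tq = xs s i} \<longleftrightarrow>
      k \<in> joining \<and> k \<in> anc \<and> xs s k = v_next"
    unfolding omega_minus_eq using J[of "\<lambda>k. k \<in> anc"] v[of "nx k"]
    by (cases "k \<in> joining"; cases "k \<in> anc") (auto simp: arc_def joining_def)
qed

lemma sign_next:
  assumes "k \<in> Vm" "k \<noteq> i\<^sub>m"
    and "sn (arc k) = (if k \<in> joining \<and> xs s k = v_next then EQ
      else if k \<in> B \<and> cnd k = ereal v_next then (if k \<in> anc then det d else flip (det d)) else sg s (arc k))"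
  shows "osg sn k = S_next k"
  using assms by (auto simp: osg_def S_next_def)

text \<open>The common body of \<open>update_minus\<close> and \<open>update_plus\<close>: the two
  arise by rewriting \<open>best\<close>, \<open>extreme\<close>, \<open>att\<close>,
  \<open>det\<close> and \<open>flip\<close> for the respective direction, with
  \<open>\<delta>\<close> the increments of the block arcs.\<close>

lemma update_spec_general:
  assumes wP: "wP = {e \<in> omega_plus H m s. sg s e = flip (att d)}"
    and wM: "wM = {e \<in> omega_minus H m s. sg s e = att d}"
    and \<delta>: "\<And>k. k \<in> B \<Longrightarrow> k \<noteq> i\<^sub>m \<Longrightarrow> \<delta> (arc k) = conv (cnd k)"
    and dt: "dt = best d (bestS d (\<delta> ` block_arcs H m s)) (best d
      (if wP = {} then worst d
       else ereal (THE a. block_x H m s (tcur s + a) = extreme ((\<lambda>(i, j). xs s j) ` wP)))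
      (if wM = {} then worst d
       else ereal (THE a. block_x H m s (tcur s + a) = extreme ((\<lambda>(i, j). xs s i) ` wM))))"
    and t': "t' = real_of_ereal (best d (ereal (tcur s) + dt)
      (best d (ereal (tcur s + delta_meet H m s)) (limit d)))"
    and fd: "fd \<longleftrightarrow> ereal t' = limit d \<or> xq H m s (new_arc_tail H m) t' = xq H m s (Suc m) t'"
    and tq: "tq = tcur s + real_of_ereal dt"
    and sn: "\<And>e. sn e = (if e \<in> {(i, j) \<in> wP. xq H m s i tq = xs s j} \<union> {(i, j) \<in> wM. xq H m s j tq = xs s i} then EQ
      else if e \<in> {(i, j) \<in> block_arcs H m s. \<delta> (i, j) = dt \<and> beyond H m i j} then det d
      else if e \<in> {(i, j) \<in> block_arcs H m s. \<delta> (i, j) = dt \<and> beyond H m j i} then flip (det d)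
      else sg s e)"
  shows "update_spec \<lparr>tcur = t', xs = (\<lambda>i. xq H m s i t'), zs = z_tilde H m s t',
      sg = (if fd then sg s else sn)\<rparr> fd"
proof -
  have "bestS d (\<delta> ` block_arcs H m s) = bestS d (conv ` cnd ` (B - {i\<^sub>m}))"
    using \<delta> unfolding block_arcs_eq by (simp add: image_image)
  then have dE: "bestS d (\<delta> ` block_arcs H m s) = conv (bestS d (cnd ` (B - {i\<^sub>m})))"
    using finite_B cnd_finite_or_worst by (simp add: conv_bestS(1))
  have dP: "(if wP = {} then worst d
       else ereal (THE a. block_x H m s (tcur s + a) = extreme ((\<lambda>(i, j). xs s j) ` wP)))
    = conv (bestS d ((\<lambda>k. ereal (xs s k)) ` {k \<in> joining. k \<notin> anc}))"
    unfolding wP omega_plus_eq by (rule first_join) (auto simp: arc_def)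
  have dM: "(if wM = {} then worst d
       else ereal (THE a. block_x H m s (tcur s + a) = extreme ((\<lambda>(i, j). xs s i) ` wM)))
    = conv (bestS d ((\<lambda>k. ereal (xs s k)) ` {k \<in> joining. k \<in> anc}))"
    unfolding wM omega_minus_eq by (rule first_join) (auto simp: arc_def)
  have dt': "dt = conv (bestS d events)" unfolding dt dE dP dM by (rule increments_combined)
  have t_next: "t' = t_next" unfolding t' t_next_def dt' delta_meet_eq by simp
  show ?thesis unfolding t_next
  proof (rule update_spec_intro)
    show "fd \<longleftrightarrow> ereal t_next = limit d \<or> xq H m s i\<^sub>m t_next = xq H m s (Suc m) t_next"
      unfolding fd t_next new_arc_tail ..
  next
    assume ne: "ereal t_next \<noteq> limit d" "v_next \<noteq> w_next"
    show "\<forall>k\<in>Vm - {i\<^sub>m}. osg sn k = S_next k"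
    proof
      fix k assume k: "k \<in> Vm - {i\<^sub>m}"
      have "\<delta> (arc k) = conv (cnd k)" if "k \<in> B - {i\<^sub>m}" for k using that \<delta> by simp
      note ns = new_signs[OF ne this dt' tq k, folded wP wM]
      show "osg sn k = S_next k"
        using k by (intro sign_next) (auto simp only: sn ns Un_iff split: if_splits)
    qed
  qed
qed

lemma update_minus_spec:
  assumes d: "d = Down"
  shows "update_spec (fst (update_minus H m s)) (snd (update_minus H m s))"
proof -
  have e: "flip LT = GT" "flip GT = LT" "att d = LT" "worst d = -\<infinity>" "best d a b = max a b" "bestS d Y = Sup Y"
    "limit d = - lam H (new_arc_tail H m, Suc m)" "det d = GT" for a b Y
    by (simp_all add: flip_def att_def det_def worst_def best_def limit_def bestS_def new_arc_tail d)
  have ext: "extreme X = Max X" for X unfolding extreme_def by (simp only: d direction.case)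
  have \<delta>: "delta_arc_minus H m s (arc k) = conv (cnd k)" if "k \<in> B" "k \<noteq> i\<^sub>m" for k
    using that d by (rule delta_arc_minus_eq)
  show ?thesis unfolding update_minus_def Let_def fst_conv snd_conv
    by (rule update_spec_general[OF refl refl \<delta> refl _ _ refl])
       (simp_all only: e ext not_False_eq_True)
qed

lemma update_plus_spec:
  assumes d: "d = Up"
  shows "update_spec (fst (update_plus H m s)) (snd (update_plus H m s))"
proof -
  have e: "flip LT = GT" "flip GT = LT" "att d = GT" "worst d = \<infinity>" "best d a b = min a b" "bestS d Y = Inf Y"
    "limit d = mu H (new_arc_tail H m, Suc m)" "det d = LT" for a b Y
    by (simp_all add: flip_def att_def det_def worst_def best_def limit_def bestS_def new_arc_tail d)
  have ext: "extreme X = Min X" for X unfolding extreme_def by (simp only: d direction.case)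
  \<comment> \<open>\<open>update_plus\<close> tests the two sets of detaching arcs in the other
    order than the general form; they are disjoint because strict inclusion of paths is
    asymmetric.\<close>
  have swap: "(if e \<in> {(i, j) \<in> X. D (i, j) = u \<and> beyond H m j i} then a
        else if e \<in> {(i, j) \<in> X. D (i, j) = u \<and> beyond H m i j} then b else c)
      = (if e \<in> {(i, j) \<in> X. D (i, j) = u \<and> beyond H m i j} then b
        else if e \<in> {(i, j) \<in> X. D (i, j) = u \<and> beyond H m j i} then a else c)"
    for e X and D :: "nat \<times> nat \<Rightarrow> ereal" and u and a b c :: order_sign
    by (auto simp: beyond_def)
  have \<delta>: "delta_arc_plus H m s (arc k) = conv (cnd k)" if "k \<in> B" "k \<noteq> i\<^sub>m" for k
    using that d by (rule delta_arc_plus_eq)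
  show ?thesis unfolding update_plus_def Let_def fst_conv snd_conv
    by (rule update_spec_general[OF refl refl \<delta> refl _ _ refl])
       (simp_all only: e ext not_False_eq_True, rule if_cong[OF refl refl swap])
qed

definition sign_weight :: "(nat \<times> nat \<Rightarrow> order_sign) \<Rightarrow> nat" where
  "sign_weight sn = (\<Sum>k\<in>Vm - {i\<^sub>m}. weight (osg sn k))"

lemma oz_spec:
  assumes "update_spec s' fd" "k \<in> Vm" "k \<noteq> i\<^sub>m"
  shows "oz (zs s') k = Z_new v_next k"
proof (cases "k \<in> B")
  case True
  then have "zs s' (arc k) = (if k \<in> anc then pot k v_next else - pot k v_next)"
    using assms unfolding update_spec_def by blast
  then show ?thesis using True assms(3) by (simp add: oz_def Z_new_def)
next
  case False
  then have "arc k \<notin> arc ` (B - {i\<^sub>m})" using assms(2,3) B_V by (subst arc_image_iff) auto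
  then have "zs s' (arc k) = zs s (arc k)" using assms(1) unfolding update_spec_def by blast
  then show ?thesis using False by (simp add: oz_def Z_new_def)
qed

lemma xs_spec: "update_spec s' fd \<Longrightarrow> k \<in> Vm \<Longrightarrow> xs s' k = x_new v_next k"
  using Suc_m_notin by (auto simp: update_spec_def x_new_def)

lemma net_cong: "(\<And>k. k \<in> Vm \<Longrightarrow> k \<noteq> i\<^sub>m \<Longrightarrow> Y k = Y' k) \<Longrightarrow> k \<in> Vm \<Longrightarrow> net Y k = net Y' k"
  unfolding net_def by (auto intro!: arg_cong2[where f = "(-)"] sum.cong)

text \<open>When the stage ends, the description says nothing about the signs of \<open>s'\<close>,
  so the invariant is stated with the old ones, still correct by \<open>ok_new\<close>. Otherwise
  \<open>ok_next\<close> applies, and an event took place that lowers the weight.\<close>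

lemma spec_invariant:
  assumes u: "update_spec s' fd"
  shows "invariant d (s'\<lparr>sg := (if fd then sg s else sg s')\<rparr>)"
    and "fd \<longleftrightarrow> ereal (tcur s') = limit d \<or> xs s' (Suc m) = xs s' i\<^sub>m"
    and "\<not> fd \<Longrightarrow> sign_weight (sg s') < sign_weight (sg s)"
proof -
  have t: "tcur s' = t_next" using u by (simp add: update_spec_def)
  have w: "xs s' (Suc m) = w_next" "xs s' i\<^sub>m = v_next"
    using u Suc_m_notin root_B by (auto simp: update_spec_def)
  show "fd \<longleftrightarrow> ereal (tcur s') = limit d \<or> xs s' (Suc m) = xs s' i\<^sub>m"
    using u w t unfolding update_spec_def by auto
  have net: "deriv (loss H k) (xs s' k) = outflow (sub_arcs H m) (zs s') k + (if k = i\<^sub>m then t_next else 0)"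
    if "k \<in> Vm" for k
    using net_new[OF that, of v_next] net_cong[OF oz_spec[OF u] that] xs_spec[OF u that]
      outflow_oriented[OF that, of "zs s'"] by simp
  have opt: "arc_opt H (xs s') (zs s') (if fd then sg s (arc k) else sg s' (arc k)) (arc k)"
    if k: "k \<in> Vm" "k \<noteq> i\<^sub>m" for k
  proof -
    have x: "xs s' k = x_new v_next k" "xs s' (nx k) = x_new v_next (nx k)" "oz (zs s') k = Z_new v_next k"
      using xs_spec[OF u] oz_spec[OF u] k nx_V[OF k] by auto
    show ?thesis
    proof (cases fd)
      case True
      then show ?thesis using ok_new[OF k] unfolding arc_opt_oriented x by (cases "k \<in> anc") (simp_all add: osg_def)
    next
      case False
      then have "osg (sg s') k = S_next k" using u k by (simp add: update_spec_def)
      then show ?thesis using False ok_next[OF k] unfolding arc_opt_oriented x by (cases "k \<in> anc") (simp_all add: osg_def)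
    qed
  qed
  have opt': "arc_opt H (xs s') (zs s') (if fd then sg s e else sg s' e) e" if "e \<in> sub_arcs H m" for e
    using that opt unfolding sub_arcs_arc by blast
  have "lee d (tcur s) 0" using inv by (simp add: invariant_def)
  then have "lee d t_next 0" using t_next_le lee_trans by blast
  then show "invariant d (s'\<lparr>sg := (if fd then sg s else sg s')\<rparr>)"
    using net opt' t w w_next_le lim_le_t_next by (cases fd) (simp_all add: invariant_def)
  show "sign_weight (sg s') < sign_weight (sg s)" if "\<not> fd"
  proof -
    have "osg (sg s') k = S_next k" if "k \<in> Vm - {i\<^sub>m}" for k
      using u that \<open>\<not> fd\<close> by (simp add: update_spec_def)
    then have "sign_weight (sg s') = (\<Sum>k\<in>Vm - {i\<^sub>m}. weight (S_next k))"
      unfolding sign_weight_def by (intro sum.cong) auto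
    also have "\<dots> < sign_weight (sg s)" unfolding sign_weight_def
      by (rule weight_less[OF event_attained(1)]) (use u that in \<open>auto simp: update_spec_def\<close>)
    finally show ?thesis .
  qed
qed

lemma update_spec_unique:
  assumes "update_spec s1 f1" "update_spec s2 f2"
  shows "f1 = f2" "tcur s1 = tcur s2" "xs s1 = xs s2" "zs s1 = zs s2"
    "\<not> f1 \<Longrightarrow> e \<in> sub_arcs H m \<Longrightarrow> sg s1 e = sg s2 e"
proof -
  show "f1 = f2" "tcur s1 = tcur s2" "xs s1 = xs s2" using assms by (auto simp: update_spec_def)
  show "zs s1 = zs s2"
  proof
    fix e
    note u = assms[unfolded update_spec_def]
    show "zs s1 e = zs s2 e"
    proof (cases "e \<in> arc ` (B - {i\<^sub>m})")
      case True
      then obtain k where "k \<in> B - {i\<^sub>m}" "e = arc k" by blast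
      then show ?thesis using u(1)[THEN conjunct2, THEN conjunct2, THEN conjunct1]
        u(2)[THEN conjunct2, THEN conjunct2, THEN conjunct1] by simp
    next
      case False
      then have "zs s1 e = zs s e" "zs s2 e = zs s e"
        using u(1)[THEN conjunct2, THEN conjunct2, THEN conjunct2, THEN conjunct1]
          u(2)[THEN conjunct2, THEN conjunct2, THEN conjunct2, THEN conjunct1] by blast+
      then show ?thesis by simp
    qed
  qed
  assume f: "\<not> f1" and "e \<in> sub_arcs H m"
  then obtain k where k: "k \<in> Vm - {i\<^sub>m}" "e = arc k" unfolding sub_arcs_arc by blast
  then have "osg (sg s1) k = osg (sg s2) k" using assms f \<open>f1 = f2\<close> by (simp add: update_spec_def)
  then show "sg s1 e = sg s2 e" using k by (metis osg_def flip_flip)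
qed

end

section \<open>Correctness and linear cost of the program for one update\<close>

section \<open>The running time of an update\<close>

lemma best_commute: "best d a b = best d b a"
  by (cases d) (simp_all add: best_def max.commute min.commute)

lemma first_run:
  "runs (first_tm d ks P v) (\<lambda>r. r = bestS d (v ` {k \<in> set ks. P k})) (length ks * 2 + 1)"
proof -
  have "runs (first_tm d ks P v) (\<lambda>r. r = bestS d (v ` {k \<in> set ks. P k})) (length ks * (1 + 1) + 1)"
    unfolding first_tm_def
  proof (rule runs_for_invariant[where I = "\<lambda>pre r. r = bestS d (v ` {k \<in> set pre. P k})"])
    fix pre k post r assume r: "r = bestS d (v ` {k \<in> set pre. P k})"
    show "runs (step (if P k then best d r (v k) else r)) (\<lambda>r. r = bestS d (v ` {k' \<in> set (pre @ [k]). P k'})) 1"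
    proof (cases "P k")
      case True
      then have "{k' \<in> set (pre @ [k]). P k'} = insert k {k \<in> set pre. P k}" by auto
      then show ?thesis using True r by (simp add: runs_step bestS_insert best_commute)
    next
      case False
      then have "{k' \<in> set (pre @ [k]). P k'} = {k \<in> set pre. P k}" by auto
      then show ?thesis using False r by (simp add: runs_step)
    qed
  qed simp
  then show ?thesis by (simp add: mult_2_right)
qed

lemma runs_bind_step: "runs (f a) Q M \<Longrightarrow> runs (bind_tm (step a) f) Q (1 + M)"
  using runs_bind[of "step a" "\<lambda>b. b = a" 1 f Q M] by (simp add: runs_step)

lemma runs_bind_value: "runs c (\<lambda>b. b = a) N \<Longrightarrow> runs (f a) Q M \<Longrightarrow> runs (bind_tm c f) Q (N + M)"
  by (rule runs_bind[where P = "\<lambda>b. b = a"]) simp_all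

lemma runs_new_array_value: "runs (new_array k a) (\<lambda>b. b = (\<lambda>_. a)) (Suc k)"
  by (simp add: runs_new_array)

lemma fold_if: "fold (\<lambda>k a. if P k then g k a else a) L a = fold g (filter P L) a"
  by (induction L arbitrary: a) auto

lemma fold_array: "fold (\<lambda>k a. if P k then a(k := h k) else a) L a = (\<lambda>k. if k \<in> set L \<and> P k then h k else a k)"
  by (induction L arbitrary: a) (auto simp: fun_eq_iff)

lemma fold_array_all: "fold (\<lambda>k a. a(k := h k)) L a = (\<lambda>k. if k \<in> set L then h k else a k)"
  using fold_array[of "\<lambda>_. True" h L a] by simp

locale program = labelled +
  fixes inv_cost :: "(real \<Rightarrow> real) \<Rightarrow> real \<Rightarrow> nat" and f :: "nat \<Rightarrow> real \<Rightarrow> real"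
    and la mv :: "nat \<times> nat \<Rightarrow> ereal" and K :: nat
  assumes inv_cost: "\<And>g y. smooth_strongly_convex g \<Longrightarrow> inv_cost g y \<le> K"
    and f_loss: "\<And>k. 1 \<le> k \<Longrightarrow> k \<le> n \<Longrightarrow> f k = loss H k"
    and la: "\<And>k. 2 \<le> k \<Longrightarrow> k \<le> n \<Longrightarrow> la (par k, k) = lam H (par k, k)"
    and mv: "\<And>k. 2 \<le> k \<Longrightarrow> k \<le> n \<Longrightarrow> mv (par k, k) = mu H (par k, k)"
begin

lemma invert_run:
  assumes "fsum_fun f F = g" "smooth_strongly_convex g"
  shows "runs (invert_tm inv_cost f F y) (\<lambda>r. r = deriv_inv g y) (K + 1)"
  using inv_cost[OF assms(2), of y] assms by (simp add: runs_def invert_tm_def deriv_inv_def)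

end

locale running_program = running H n par m s d + program H n par inv_cost f la mv K
  for H n par m s d inv_cost f la mv K +
  fixes sn :: "nat \<times> nat \<Rightarrow> order_sign"
  assumes sn: "\<And>k. 2 \<le> k \<Longrightarrow> k \<le> m \<Longrightarrow> sn (par k, k) = sg s (par k, k)"
begin

lemma sn_arc: "k \<in> Vm \<Longrightarrow> k \<noteq> i\<^sub>m \<Longrightarrow> sn (arc k) = sg s (arc k)"
  using arc_in[of k] sn unfolding sub_arcs by auto

definition inB :: "nat \<Rightarrow> bool" where "inB = (\<lambda>k. k \<in> B)"

definition inP :: "nat \<Rightarrow> bool" where "inP = (\<lambda>k. k \<in> B \<and> k \<in> anc)"

definition points_to_block_root :: "(nat \<Rightarrow> nat) \<Rightarrow> bool" where
  "points_to_block_root nxt \<longleftrightarrow> (\<forall>k\<in>B. k \<in> anc \<longrightarrow> k \<noteq> i\<^sub>m \<longrightarrow> nxt k = nx k)"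

lemma B_range: "k \<in> B \<Longrightarrow> 1 \<le> k \<and> k \<le> m"
  using B_Vm by (auto simp: Vm_def)

lemma f_V: "k \<in> Vm \<Longrightarrow> f k = loss H k"
  using f_loss[of k] m by (simp add: Vm_def)

lemma anc_B_iff:
  assumes "2 \<le> c" "c \<le> m" "c \<in> anc"
  shows "par c \<in> B \<Longrightarrow> c \<in> B" and "c \<in> B \<Longrightarrow> par c \<in> B \<longleftrightarrow> sg s (par c, c) = EQ"
proof -
  have p: "par c \<in> anc" "nx (par c) = c" "par c \<in> Vm" "par c \<noteq> i\<^sub>m"
    using assms par_anc[of c] nx_par[of c] par_m[of c] anc_le[of c] by (auto simp: Vm_def)
  then have "arc (par c) = (par c, c)" by (simp add: arc_def)
  then show "par c \<in> B \<Longrightarrow> c \<in> B" "c \<in> B \<Longrightarrow> par c \<in> B \<longleftrightarrow> sg s (par c, c) = EQ"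
    using block_nx[OF p(3,4)] p by auto
qed

text \<open>Each \<open>tp k\<close> is the representative of the \<open>EQ\<close> component of
  \<open>k\<close>: the recursion makes it constant along \<open>EQ\<close> arcs, and every node is
  connected to its representative.\<close>

lemma block_of_tops:
  fixes tp :: "nat \<Rightarrow> nat"
  assumes "\<forall>k\<in>{1..m}. tp k = (if 2 \<le> k \<and> sn (par k, k) = EQ then tp (par k) else k)"
    and "k \<in> {1..m}"
  shows "tp k = tp i\<^sub>m \<longleftrightarrow> k \<in> B"
proof -
  let ?R = "(eq_arcs H m s \<union> (eq_arcs H m s)\<inverse>)"
  have eq: "e \<in> eq_arcs H m s \<longleftrightarrow> (\<exists>k. 2 \<le> k \<and> k \<le> m \<and> e = (par k, k) \<and> sn (par k, k) = EQ)" for e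
    unfolding eq_arcs_def sub_arcs using sn by auto
  have sym: "sym (?R\<^sup>*)" by (intro sym_rtrancl) (auto simp: sym_def)
  have step_EQ: "tp k = tp (par k)" if "2 \<le> k" "k \<le> m" "sn (par k, k) = EQ" for k
    using assms(1)[rule_format, of k] that by simp
  have conn: "(k, tp k) \<in> ?R\<^sup>*" if "k \<in> {1..m}" for k
    using that
  proof (induction k rule: less_induct)
    case (less k)
    show ?case
    proof (cases "2 \<le> k \<and> sn (par k, k) = EQ")
      case True
      then have "tp k = tp (par k)" using step_EQ less.prems by auto
      moreover have "(par k, tp (par k)) \<in> ?R\<^sup>*" using less True par_m[of k] by auto
      moreover have "(k, par k) \<in> ?R" using eq[of "(par k, k)"] True less.prems by auto
      ultimately show ?thesis by (metis converse_rtrancl_into_rtrancl)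
    next
      case False
      then have "tp k = k" using assms(1)[rule_format, OF less.prems] by auto
      then show ?thesis by simp
    qed
  qed
  have same: "tp z = tp y" if "(y, z) \<in> ?R" for y z
  proof -
    from that consider k where "2 \<le> k" "k \<le> m" "sn (par k, k) = EQ" "(y, z) = (par k, k)"
      | k where "2 \<le> k" "k \<le> m" "sn (par k, k) = EQ" "(z, y) = (par k, k)"
      using eq[of "(y, z)"] eq[of "(z, y)"] by auto
    then show ?thesis by cases (auto dest: step_EQ)
  qed
  show ?thesis
  proof
    assume "tp k = tp i\<^sub>m"
    then have "(i\<^sub>m, tp k) \<in> ?R\<^sup>*" "(tp k, k) \<in> ?R\<^sup>*"
      using conn[of "i\<^sub>m"] conn[OF assms(2)] i\<^sub>m symD[OF sym] by auto
    then have "(i\<^sub>m, k) \<in> ?R\<^sup>*" by (rule rtrancl_trans)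
    then show "k \<in> B" using assms(2) by (simp add: block_def new_arc_tail)
  next
    assume "k \<in> B"
    then have "(i\<^sub>m, k) \<in> ?R\<^sup>*" by (simp add: block_def new_arc_tail)
    then show "tp k = tp i\<^sub>m" 
    proof (induction rule: rtrancl_induct)
      case (step y z)
      then show ?case using same[OF step.hyps(2)] by simp
    qed simp
  qed
qed

text \<open>The equation for \<open>k\<close> refers only to the smaller label \<open>par k\<close>,
  so writing entry \<open>k\<close> does not disturb the equations already established.\<close>

lemma top_run:
  "runs (for_tm [1..<Suc m] (\<lambda>k tp. step
       (tp(k := if 2 \<le> k \<and> sn (par k, k) = EQ then tp (par k) else k))) t0)
     (\<lambda>tp. \<forall>k\<in>{1..m}. tp k = (if 2 \<le> k \<and> sn (par k, k) = EQ then tp (par k) else k)) (2 * m + 1)"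
proof -
  have "runs (for_tm [1..<Suc m] (\<lambda>k tp. step
       (tp(k := if 2 \<le> k \<and> sn (par k, k) = EQ then tp (par k) else k))) t0)
     (\<lambda>tp. \<forall>k\<in>{1..<Suc m}. tp k = (if 2 \<le> k \<and> sn (par k, k) = EQ then tp (par k) else k)) ((Suc m - 1) * (1 + 1) + 1)"
  proof (rule runs_for_upt)
    fix k tp assume k: "1 \<le> k" "k < Suc m"
      and I: "\<forall>k\<in>{1..<k}. tp k = (if 2 \<le> k \<and> sn (par k, k) = EQ then tp (par k) else k)"
    define t1 where "t1 = tp(k := if 2 \<le> k \<and> sn (par k, k) = EQ then tp (par k) else k)"
    have "t1 j = (if 2 \<le> j \<and> sn (par j, j) = EQ then t1 (par j) else j)" if j: "j \<in> {1..<Suc k}" for j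
    proof -
      have "par j < j" if "2 \<le> j" using that j k par_m[of j] by simp
      moreover have "j = k \<or> j \<in> {1..<k}" using j by auto
      ultimately show ?thesis using I[rule_format, of j] by (auto simp: t1_def)
    qed
    then show "runs (step (tp(k := if 2 \<le> k \<and> sn (par k, k) = EQ then tp (par k) else k)))
      (\<lambda>tp. \<forall>k\<in>{1..<Suc k}. tp k = (if 2 \<le> k \<and> sn (par k, k) = EQ then tp (par k) else k)) 1"
      unfolding t1_def[symmetric] by (simp only: runs_def step_def) blast
  qed (use m in auto)
  then show ?thesis by (rule runs_weaken) (simp only: atLeastLessThanSuc_atLeastAtMost, simp)
qed

text \<open>The marks climb from \<open>i\<^sub>m\<close> to the root. \<open>U j c\<close> says
  that the arc into \<open>c\<close> lies on this path and inside the block and that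
  \<open>c\<close> has already been visited; the marked nodes are \<open>i\<^sub>m\<close> and the
  tails of such arcs.\<close>

lemma path_run:
  "runs (for_tm (rev [2..<Suc m]) (\<lambda>k (up, nxt). step
       (if up k \<and> sn (par k, k) = EQ then (up(par k := True), nxt(par k := k)) else (up, nxt)))
       ((\<lambda>_. False)(i\<^sub>m := True), n0))
     (\<lambda>a. \<exists>nxt. a = (inP, nxt) \<and> points_to_block_root nxt) (2 * m + 1)"
proof -
  define U where "U j c \<longleftrightarrow> j \<le> c \<and> c \<le> m \<and> c \<in> anc \<and> c \<in> B \<and> par c \<in> B" for j c
  define I where "I j a \<longleftrightarrow> (\<forall>k. fst a k \<longleftrightarrow> k = i\<^sub>m \<or> (\<exists>c. U j c \<and> par c = k)) \<and>
      (\<forall>c. U j c \<longrightarrow> snd a (par c) = c)" for j :: nat and a :: "(nat \<Rightarrow> bool) \<times> (nat \<Rightarrow> nat)"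
  \<comment> \<open>The mark of \<open>k\<close> is final before \<open>k\<close> is visited,
    because it is set at \<open>nx k\<close>, which has a larger label on the path.\<close>
  have key: "(k = i\<^sub>m \<or> (\<exists>c. U j c \<and> par c = k)) \<longleftrightarrow> k \<in> B \<and> k \<in> anc" if "2 \<le> j" "j \<le> Suc k" for j k
  proof
    assume "k = i\<^sub>m \<or> (\<exists>c. U j c \<and> par c = k)"
    then show "k \<in> B \<and> k \<in> anc" using that root_B i\<^sub>m_anc par_anc by (auto simp: U_def)
  next
    assume k: "k \<in> B \<and> k \<in> anc"
    show "k = i\<^sub>m \<or> (\<exists>c. U j c \<and> par c = k)"
    proof (cases "k = i\<^sub>m")
      case False
      then show ?thesis using k that nx_anc[of k] nx_B[of k] B_range[of "nx k"]
        by (intro disjI2 exI[of _ "nx k"]) (auto simp: U_def)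
    qed simp
  qed
  have "runs (for_tm (rev [2..<Suc m]) (\<lambda>k (up, nxt). step
       (if up k \<and> sn (par k, k) = EQ then (up(par k := True), nxt(par k := k)) else (up, nxt)))
       ((\<lambda>_. False)(i\<^sub>m := True), n0)) (I 2) ((Suc m - 2) * (1 + 1) + 1)"
  proof (rule runs_for_down)
    show "I (Suc m) ((\<lambda>_. False)(i\<^sub>m := True), n0)" by (auto simp: I_def U_def)
    fix k a assume k: "2 \<le> k" "k < Suc m" and Ia: "I (Suc k) a"
    obtain up nxt where a: "a = (up, nxt)" by (cases a)
    have up: "up k \<longleftrightarrow> k \<in> B \<and> k \<in> anc" using Ia key[of "Suc k" k] k by (simp add: I_def a)
    have Uk: "U k c \<longleftrightarrow> U (Suc k) c \<or> c = k \<and> k \<in> anc \<and> k \<in> B \<and> par k \<in> B" for c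
      using k by (cases "c = k") (auto simp: U_def)
    show "runs (case a of (up, nxt) \<Rightarrow> step
       (if up k \<and> sn (par k, k) = EQ then (up(par k := True), nxt(par k := k)) else (up, nxt))) (I k) 1"
    proof (cases "up k \<and> sn (par k, k) = EQ")
      case True
      then have kU: "k \<in> anc" "k \<in> B" "par k \<in> B" using up anc_B_iff(2)[of k] k sn by auto
      have inj: "par c \<noteq> par k" if "U (Suc k) c" for c
        using that anc_child_unique[of c k] kU k by (auto simp: U_def)
      have "I k (up(par k := True), nxt(par k := k))"
        using Ia kU inj unfolding I_def a by (auto simp: Uk)
      then show ?thesis using True by (simp add: a runs_step)
    next
      case False
      then have "\<not> (k \<in> anc \<and> k \<in> B \<and> par k \<in> B)" using up anc_B_iff(2)[of k] k sn by auto
      then have "I k (up, nxt)" using Ia unfolding I_def a by (auto simp: Uk)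
      then show ?thesis using False by (auto simp: a runs_step)
    qed
  qed (use m in simp)
  then show ?thesis
  proof (rule runs_weaken)
    fix a assume Ia: "I 2 a"
    have "fst a k \<longleftrightarrow> inP k" for k
    proof (cases "1 \<le> k")
      case True
      then show ?thesis using Ia key[of 2 k] by (simp add: I_def inP_def)
    next
      case False
      have "par c \<noteq> k" if "U 2 c" for c using that par_m[of c] False by (auto simp: U_def)
      then show ?thesis using Ia False i\<^sub>m B_range[of k] by (auto simp: I_def inP_def)
    qed
    then have "a = (inP, snd a)" by (simp add: prod_eq_iff fun_eq_iff)
    moreover have "points_to_block_root (snd a)" unfolding points_to_block_root_def
    proof (intro ballI impI)
      fix k assume k: "k \<in> B" "k \<in> anc" "k \<noteq> i\<^sub>m"
      then have "U 2 (nx k)" "par (nx k) = k"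
        using nx_anc[of k] nx_B[of k] B_range[of "nx k"] by (auto simp: U_def)
      then show "snd a k = nx k" using Ia unfolding I_def by metis
    qed
    ultimately show "\<exists>nxt. a = (inP, nxt) \<and> points_to_block_root nxt" by blast
  qed simp
qed

lemma block_run:
  "runs (block_tm par m i\<^sub>m sn) (\<lambda>a. \<exists>nxt. a = (inB, inP, nxt) \<and> points_to_block_root nxt) (10 * m + 12)"
proof -
  have "runs (block_tm par m i\<^sub>m sn) (\<lambda>a. \<exists>nxt. a = (inB, inP, nxt) \<and> points_to_block_root nxt)
     (Suc m + (2 * m + 1 + (Suc m + ((length [1..<Suc m] * 2 + 1) + (Suc m + (1 + (Suc m + (2 * m + 1 + 1))))))))"
    unfolding block_tm_def
  proof (rule runs_bind_value[OF runs_new_array_value], rule runs_bind[OF top_run],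
      rule runs_bind_value[OF runs_new_array_value], rule runs_bind_value[OF runs_for_step],
      rule runs_bind_value[OF runs_new_array_value], rule runs_bind_step,
      rule runs_bind_value[OF runs_new_array_value], rule runs_bind[OF path_run])
    fix tp :: "nat \<Rightarrow> nat" and a
    assume tp: "\<forall>k\<in>{1..m}. tp k = (if 2 \<le> k \<and> sn (par k, k) = EQ then tp (par k) else k)"
      and "\<exists>nxt. a = (inP, nxt) \<and> points_to_block_root nxt"
    then obtain nxt where a: "a = (inP, nxt)" "points_to_block_root nxt" by blast
    have "fold (\<lambda>k a. a(k := tp k = tp i\<^sub>m)) [1..<Suc m] (\<lambda>_. False) = inB"
      unfolding fold_array_all
    proof
      fix k
      show "(if k \<in> set [1..<Suc m] then tp k = tp i\<^sub>m else False) = inB k"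
        using block_of_tops[OF tp, of k] B_range[of k] by (cases "k \<in> {1..m}") (auto simp: inB_def)
    qed
    then show "runs (case a of (up, nxt) \<Rightarrow> step (fold (\<lambda>k inB. inB(k := tp k = tp i\<^sub>m)) [1..<Suc m] (\<lambda>_. False), up, nxt))
        (\<lambda>a. \<exists>nxt. a = (inB, inP, nxt) \<and> points_to_block_root nxt) 1"
      using a by (simp add: runs_step)
  qed
  then show ?thesis by (rule runs_weaken) auto
qed

end

context running_program
begin

text \<open>The two passes of the accumulation visit the block in the order of decreasing \<open>rk\<close>.\<close>

definition order :: "nat list" where
  "order = filter (\<lambda>k. inB k \<and> \<not> inP k) (rev [2..<Suc m]) @ filter (\<lambda>k. inP k \<and> k \<noteq> i\<^sub>m) [1..<Suc m]"

lemma set_order: "set order = B - {i\<^sub>m}"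
  using B_range not_anc i\<^sub>m_anc by (force simp: order_def inB_def inP_def)

text \<open>Off the path \<open>rk\<close> grows with the label, so the first pass descends; on the
  path it falls, so the second pass ascends. Ranks off the path exceed \<open>i\<^sub>m\<close>,
  those on the path do not, so the passes can be concatenated.\<close>

lemma sorted_order: "sorted_wrt (\<lambda>k l. rk k > rk l) order"
proof -
  have 1: "sorted_wrt (\<lambda>k l. rk k > rk l) (filter (\<lambda>k. inB k \<and> \<not> inP k) (rev [2..<Suc m]))"
  proof (rule sorted_wrt_mono_rel[where P = "\<lambda>k l. l < k"])
    show "rk l < rk k" if "k \<in> set (filter (\<lambda>k. inB k \<and> \<not> inP k) (rev [2..<Suc m]))"
      "l \<in> set (filter (\<lambda>k. inB k \<and> \<not> inP k) (rev [2..<Suc m]))" "l < k" for k l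
      using that by (auto simp: inB_def inP_def rk_def)
    show "sorted_wrt (\<lambda>k l. l < k) (filter (\<lambda>k. inB k \<and> \<not> inP k) (rev [2..<Suc m]))"
      by (intro sorted_wrt_filter) (simp add: sorted_wrt_rev del: upt_Suc)
  qed
  have 2: "sorted_wrt (\<lambda>k l. rk k > rk l) (filter (\<lambda>k. inP k \<and> k \<noteq> i\<^sub>m) [1..<Suc m])"
  proof (rule sorted_wrt_mono_rel[where P = "(<)"])
    show "rk l < rk k" if "k \<in> set (filter (\<lambda>k. inP k \<and> k \<noteq> i\<^sub>m) [1..<Suc m])"
      "l \<in> set (filter (\<lambda>k. inP k \<and> k \<noteq> i\<^sub>m) [1..<Suc m])" "k < l" for k l
      using that anc_le[of l] by (auto simp: inP_def rk_def simp del: upt_Suc)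
    show "sorted_wrt (<) (filter (\<lambda>k. inP k \<and> k \<noteq> i\<^sub>m) [1..<Suc m])"
      by (intro sorted_wrt_filter) (simp del: upt_Suc)
  qed
  have "rk l < rk k" if "k \<in> set (filter (\<lambda>k. inB k \<and> \<not> inP k) (rev [2..<Suc m]))"
      "l \<in> set (filter (\<lambda>k. inP k \<and> k \<noteq> i\<^sub>m) [1..<Suc m])" for k l
  proof -
    have "rk k = i\<^sub>m + k" "1 \<le> k" using that(1) B_range by (auto simp: inB_def inP_def rk_def)
    moreover have "rk l \<le> i\<^sub>m" using that(2) by (auto simp: inP_def rk_def)
    ultimately show ?thesis by simp
  qed
  then show ?thesis unfolding order_def sorted_wrt_append using 1 2 by blast
qed

lemma accumulate_run:
  assumes "points_to_block_root nxt"
  shows "runs (accumulate_tm par m i\<^sub>m inB inP nxt add a)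
    (\<lambda>b. b = fold (\<lambda>k a. a(nx k := add (a (nx k)) (a k))) order a) (4 * m + 2)"
proof -
  let ?g = "\<lambda>k a. a(nx k := add (a (nx k)) (a k))"
  have "fold (\<lambda>k a. if inB k \<and> \<not> inP k then a(par k := add (a (par k)) (a k)) else a) (rev [2..<Suc m]) a
     = fold ?g (filter (\<lambda>k. inB k \<and> \<not> inP k) (rev [2..<Suc m])) a" for a
    unfolding fold_if by (rule fold_cong) (auto simp: inB_def inP_def)
  moreover have "fold (\<lambda>k a. if inP k \<and> k \<noteq> i\<^sub>m then a(nxt k := add (a (nxt k)) (a k)) else a) [1..<Suc m] a
     = fold ?g (filter (\<lambda>k. inP k \<and> k \<noteq> i\<^sub>m) [1..<Suc m]) a" for a
    unfolding fold_if using assms by (intro fold_cong) (auto simp: inP_def points_to_block_root_def)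
  ultimately have eq: "fold (\<lambda>k a. if inP k \<and> k \<noteq> i\<^sub>m then a(nxt k := add (a (nxt k)) (a k)) else a) [1..<Suc m]
     (fold (\<lambda>k a. if inB k \<and> \<not> inP k then a(par k := add (a (par k)) (a k)) else a) (rev [2..<Suc m]) a)
     = fold ?g order a" by (simp only: order_def fold_append comp_apply)
  have "runs (accumulate_tm par m i\<^sub>m inB inP nxt add a)
    (\<lambda>b. b = fold (\<lambda>k a. a(nx k := add (a (nx k)) (a k))) order a)
    ((length (rev [2..<Suc m]) * 2 + 1) + (length [1..<Suc m] * 2 + 1))"
    unfolding accumulate_tm_def
    by (rule runs_bind_value[OF runs_for_step], rule runs_weaken[OF runs_for_step]) (simp_all only: eq order.refl)
  then show ?thesis by (rule runs_weaken) auto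
qed

lemma accumulated:
  fixes val :: "'a \<Rightarrow> real"
  assumes "\<And>x y. val (add x y) = val x + val y" "k \<in> B"
  shows "val (fold (\<lambda>k a. a(nx k := add (a (nx k)) (a k))) order a k) = (\<Sum>l\<in>branch k. val (a l))"
  using assms(1) set_order sorted_order assms(2) by (rule fold_accumulate)

lemma sub_arcs_image: "sub_arcs H m = (\<lambda>k. (par k, k)) ` {2..<Suc m}"
  unfolding sub_arcs by auto

lemma sigma_run:
  "runs (sigma_tm par m inB (zs s)) (\<lambda>a. \<forall>l\<in>B. a l = sig l) (3 * m + 3)"
proof -
  \<comment> \<open>The contribution of the arc with head \<open>k\<close> to the entry of
    \<open>l\<close>.\<close>
  define h where "h l k = (if par k \<in> B \<and> k \<notin> B \<and> par k = l then zs s (par k, k) else 0)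
      - (if k \<in> B \<and> par k \<notin> B \<and> k = l then zs s (par k, k) else 0)" for l k
  have "runs (sigma_tm par m inB (zs s)) (\<lambda>a. \<forall>l. a l = (\<Sum>k\<in>{2..<Suc m}. h l k))
      (Suc m + ((Suc m - 2) * (1 + 1) + 1))"
    unfolding sigma_tm_def
  proof (rule runs_bind_value[OF runs_new_array_value], rule runs_for_upt)
    fix k a assume k: "2 \<le> k" and a: "\<forall>l. a l = (\<Sum>k\<in>{2..<k}. h l k)"
    then have "(\<Sum>k\<in>{2..<Suc k}. h l k) = a l + h l k" for l by simp
    then show "runs (step (if inB (par k) \<and> \<not> inB k then a(par k := a (par k) + zs s (par k, k))
        else if inB k \<and> \<not> inB (par k) then a(k := a k - zs s (par k, k)) else a))
      (\<lambda>a. \<forall>l. a l = (\<Sum>k\<in>{2..<Suc k}. h l k)) 1"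
      by (simp only:) (auto simp: runs_def step_def h_def inB_def)
  qed (use m in auto)
  then show ?thesis
  proof (rule runs_weaken)
    fix a :: "nat \<Rightarrow> real" assume a: "\<forall>l. a l = (\<Sum>k\<in>{2..<Suc m}. h l k)"
    have "a l = sig l" if l: "l \<in> B" for l
    proof -
      have "sig l = sigma H m s {l}" using l by (simp add: sigma_eq)
      also have "\<dots> = sum (zs s) {e \<in> sub_arcs H m. fst e = l \<and> snd e \<notin> B}
          - sum (zs s) {e \<in> sub_arcs H m. snd e = l \<and> fst e \<notin> B}"
        unfolding sigma_def by (intro arg_cong2[where f = "(-)"] arg_cong[where f = "sum (zs s)"]) auto
      also have "\<dots> = (\<Sum>k\<in>{2..<Suc m}. zs s (par k, k) * ((if par k = l \<and> k \<notin> B then 1 else 0)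
          - (if k = l \<and> par k \<notin> B then 1 else 0)))"
        unfolding sum_if_diff[OF finite_sub_arcs] unfolding sub_arcs_image
        by (subst sum.reindex) (auto simp: inj_on_def)
      also have "\<dots> = (\<Sum>k\<in>{2..<Suc m}. h l k)"
        using l by (intro sum.cong) (auto simp: h_def)
      finally show ?thesis using a by simp
    qed
    then show "\<forall>l\<in>B. a l = sig l" by blast
  qed simp
qed

definition sigma_totals :: "(nat \<Rightarrow> real) \<Rightarrow> bool" where
  "sigma_totals S \<longleftrightarrow> (\<forall>k\<in>B. S k = sum sig (branch k))"

definition loss_totals :: "(nat \<Rightarrow> fsum) \<Rightarrow> bool" where
  "loss_totals F \<longleftrightarrow> (\<forall>k\<in>B. fsum_fun f (F k) = branch_loss k)"

lemma S_run:
  assumes "\<forall>l\<in>B. S0 l = sig l" "points_to_block_root nxt"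
  shows "runs (accumulate_tm par m i\<^sub>m inB inP nxt (+) S0) sigma_totals (4 * m + 2)"
proof (rule runs_weaken[OF accumulate_run[OF assms(2)]])
  fix S assume S: "S = fold (\<lambda>k a. a(nx k := a (nx k) + a k)) order S0"
  have "S k = sum sig (branch k)" if "k \<in> B" for k
  proof -
    have "S k = sum S0 (branch k)" unfolding S using accumulated[of "\<lambda>x. x" "(+)" k S0] that by simp
    also have "\<dots> = sum sig (branch k)" using assms(1) branch_B by (intro sum.cong) auto
    finally show ?thesis .
  qed
  then show "sigma_totals S" by (simp add: sigma_totals_def)
qed simp

text \<open>The symbolic sums depend on the order of accumulation, so they are compared as
  functions, by accumulating their values at an arbitrary point \<open>v\<close>.\<close>

lemma F_run:
  assumes "points_to_block_root nxt"
  shows "runs (accumulate_tm par m i\<^sub>m inB inP nxt Plus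
    (fold (\<lambda>k F. F(k := Single k)) [1..<Suc m] (\<lambda>_. Single 0))) loss_totals (4 * m + 2)"
proof (rule runs_weaken[OF accumulate_run[OF assms]])
  let ?F1 = "fold (\<lambda>k F. F(k := Single k)) [1..<Suc m] (\<lambda>_. Single 0)"
  have F1: "?F1 l = Single l" if "l \<in> B" for l
    unfolding fold_array_all using B_range[OF that] by auto
  fix F assume F: "F = fold (\<lambda>k a. a(nx k := Plus (a (nx k)) (a k))) order ?F1"
  have "fsum_fun f (F k) v = branch_loss k v" if "k \<in> B" for k v
  proof -
    have F1v: "fsum_fun f (?F1 l) v = loss H l v" if "l \<in> branch k" for l
    proof -
      have l: "l \<in> B" using that branch_B by blast
      show ?thesis unfolding F1[OF l] using f_V[OF B_Vm[OF l]] by simp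
    qed
    have "fsum_fun f (F k) v = (\<Sum>l\<in>branch k. fsum_fun f (?F1 l) v)"
      unfolding F using accumulated[of "\<lambda>g. fsum_fun f g v" Plus k ?F1] that by simp
    also have "\<dots> = branch_loss k v"
      unfolding branch_loss_def by (intro sum.cong refl F1v)
    finally show ?thesis .
  qed
  then show "loss_totals F" by (simp add: loss_totals_def fun_eq_iff)
qed simp

lemma D_run:
  assumes "points_to_block_root nxt"
  shows "runs (accumulate_tm par m i\<^sub>m inB inP nxt (+) (\<lambda>k. if k \<in> B then deriv (f k) v else 0))
    (\<lambda>D. \<forall>k\<in>B. D k = (\<Sum>l\<in>branch k. deriv (loss H l) v)) (4 * m + 2)"
proof (rule runs_weaken[OF accumulate_run[OF assms]])
  let ?D = "\<lambda>k. if k \<in> B then deriv (f k) v else 0"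
  fix D assume D: "D = fold (\<lambda>k a. a(nx k := a (nx k) + a k)) order ?D"
  show "\<forall>k\<in>B. D k = (\<Sum>l\<in>branch k. deriv (loss H l) v)"
  proof
    fix k assume k: "k \<in> B"
    have "D k = sum ?D (branch k)" unfolding D using accumulated[of "\<lambda>x. x" "(+)" k ?D] k by simp
    also have "\<dots> = (\<Sum>l\<in>branch k. deriv (loss H l) v)"
      using branch_B f_V B_Vm by (intro sum.cong) (auto dest!: subsetD)
    finally show "D k = (\<Sum>l\<in>branch k. deriv (loss H l) v)" .
  qed
qed simp

definition cands :: "nat \<Rightarrow> ereal" where
  "cands k = (if k \<in> B \<and> k \<noteq> i\<^sub>m then cnd k else worst d)"

lemma arc_weights:
  assumes "k \<in> Vm" "k \<noteq> i\<^sub>m"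
  shows "la (arc k) = lam H (arc k)" "mv (arc k) = mu H (arc k)"
proof -
  obtain c where "arc k = (par c, c)" "2 \<le> c" "c \<le> m"
    using arc_in[OF assms] unfolding sub_arcs by blast
  then show "la (arc k) = lam H (arc k)" "mv (arc k) = mu H (arc k)" using la mv m by auto
qed

lemma cand_run:
  assumes "points_to_block_root nxt" "sigma_totals S" "loss_totals F"
  shows "runs (candidates_tm inv_cost f par la mv d m i\<^sub>m inB inP nxt S F) (\<lambda>c. c = cands)
    (m * (K + 7) + 2)"
proof -
  have "runs (candidates_tm inv_cost f par la mv d m i\<^sub>m inB inP nxt S F)
     (\<lambda>c. c = (\<lambda>k. if k \<in> B \<and> k \<noteq> i\<^sub>m \<and> k < Suc m then cnd k else worst d))
     (Suc m + ((Suc m - 1) * ((1 + (1 + (K + 1 + 1))) + 1) + 1))"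
    unfolding candidates_tm_def
  proof (rule runs_bind_value[OF runs_new_array_value],
      rule runs_for_upt[where I = "\<lambda>j c. c = (\<lambda>k. if k \<in> B \<and> k \<noteq> i\<^sub>m \<and> k < j then cnd k else worst d)"])
    show "1 \<le> Suc m" by simp
    show "(\<lambda>_. worst d) = (\<lambda>k. if k \<in> B \<and> k \<noteq> i\<^sub>m \<and> k < 1 then cnd k else worst d)"
      using B_range by force
    fix k c
    assume c: "c = (\<lambda>k'. if k' \<in> B \<and> k' \<noteq> i\<^sub>m \<and> k' < k then cnd k' else worst d)"
    let ?c' = "\<lambda>k'. if k' \<in> B \<and> k' \<noteq> i\<^sub>m \<and> k' < Suc k then cnd k' else worst d"
    let ?b = "if inP k then (case d of Down \<Rightarrow> - la (k, nxt k) | Up \<Rightarrow> mv (k, nxt k))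
                   else (case d of Down \<Rightarrow> mv (par k, k) | Up \<Rightarrow> - la (par k, k))"
    show "runs (if inB k \<and> k \<noteq> i\<^sub>m then do {
         b \<leftarrow> step ?b;
         if \<bar>b\<bar> = \<infinity> then step c
         else do {
           r \<leftarrow> step (if inP k then real_of_ereal b + S k else S k - real_of_ereal b);
           y \<leftarrow> invert_tm inv_cost f (F k) r;
           step (c(k := ereal y))
         }
       }
       else step c) (\<lambda>c. c = ?c') (1 + (1 + (K + 1 + 1)))"
    proof (cases "k \<in> B \<and> k \<noteq> i\<^sub>m")
      case False
      then have "c = ?c'" unfolding c by (auto simp: less_Suc_eq)
      then show ?thesis using False by (auto simp: inB_def runs_def step_def)
    next
      case True
      then have kV: "k \<in> Vm" "k \<noteq> i\<^sub>m" using B_Vm by auto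
      have b: "?b = (if k \<in> anc then bnd d (olo k) (oup k) else - bnd d (olo k) (oup k))"
      proof (cases "k \<in> anc")
        case anc: True
        then have "nxt k = nx k" using assms(1) True by (simp add: points_to_block_root_def)
        then show ?thesis using anc True arc_weights[OF kV]
          by (simp add: inP_def bnd_def olo_def oup_def arc_def split: direction.split)
      next
        case False
        then show ?thesis using arc_weights[OF kV]
          by (simp add: inP_def bnd_def olo_def oup_def arc_def split: direction.split)
      qed
      have upd: "c(k := cnd k) = ?c'" using True unfolding c by (auto simp: fun_eq_iff less_Suc_eq)
      show ?thesis
      proof (cases "\<bar>bnd d (olo k) (oup k)\<bar> = \<infinity>")
        case inf: True
        then have "cnd k = c k" unfolding c by (simp add: cnd_def)
        then have "c = ?c'" using upd by (metis fun_upd_triv)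
        moreover have "\<bar>?b\<bar> = \<infinity>" unfolding b using inf by simp
        ultimately show ?thesis using True unfolding inB_def
          by (simp add: bind_tm_def runs_def step_def)
      next
        case fin: False
        then have nb: "\<bar>?b\<bar> \<noteq> \<infinity>" unfolding b by simp
        \<comment> \<open>Off the path the stored bound is the negative of the bound read towards
          \<open>i\<^sub>m\<close>, so both branches add the oriented bound to the total of
          \<open>sig\<close>, the argument of the inversion in \<open>pot_inv\<close>.\<close>
        have r: "(if inP k then real_of_ereal ?b + S k else S k - real_of_ereal ?b)
            = real_of_ereal (bnd d (olo k) (oup k)) + sum sig (branch k)"
          unfolding b using True assms(2) by (simp add: inP_def sigma_totals_def)
        have inv: "runs (invert_tm inv_cost f (F k) (real_of_ereal (bnd d (olo k) (oup k)) + sum sig (branch k)))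
            (\<lambda>y. ereal y = cnd k) (K + 1)"
          using invert_run[of "F k" "branch_loss k"] assms(3) True ssc_branch_loss[of k] fin
          by (intro runs_weaken[OF invert_run[of "F k" "branch_loss k"]]) (auto simp: loss_totals_def cnd_def pot_inv_def)
        have "runs (do {
           r \<leftarrow> step (if inP k then real_of_ereal ?b + S k else S k - real_of_ereal ?b);
           y \<leftarrow> invert_tm inv_cost f (F k) r;
           step (c(k := ereal y))}) (\<lambda>c. c = ?c') (1 + (K + 1 + 1))"
          unfolding r
          by (rule runs_bind_step, rule runs_bind[OF inv]) (simp add: runs_def step_def upd)
        then show ?thesis using True nb unfolding inB_def
          by (simp only: simp_thms if_True if_False runs_bind_step)
      qed
    qed
  qed
  then show ?thesis
  proof (rule runs_weaken)
    show "c = cands" if "c = (\<lambda>k. if k \<in> B \<and> k \<noteq> i\<^sub>m \<and> k < Suc m then cnd k else worst d)" for c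
      unfolding that using B_range by (force simp: cands_def)
    show "Suc m + ((Suc m - 1) * ((1 + (1 + (K + 1 + 1))) + 1) + 1) \<le> m * (K + 7) + 2"
      by (simp add: algebra_simps)
  qed
qed

end

lemma runs_bind_eq: "a = b \<Longrightarrow> runs (f b) Q M \<Longrightarrow> runs (bind_tm (step a) f) Q (1 + M)"
  using runs_bind_step[of f b Q M] by simp

lemma runs_le: "runs c P N \<Longrightarrow> N \<le> M \<Longrightarrow> runs c P M"
  by (rule runs_weaken)

text \<open>The sum instead of the maximum of the branch costs keeps the accumulated bound purely
  additive.\<close>

lemma runs_if: "(c \<Longrightarrow> runs a Q M) \<Longrightarrow> (\<not> c \<Longrightarrow> runs b Q N) \<Longrightarrow> runs (if c then a else b) Q (M + N)"
  by (auto intro: runs_le)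

lemma fold_array_inj:
  assumes "inj_on a {k \<in> set L. P k}"
  shows "k \<in> set L \<Longrightarrow> P k \<Longrightarrow> fold (\<lambda>k r. if P k then r(a k := h k) else r) L r0 (a k) = h k"
    and "e \<notin> a ` {k \<in> set L. P k} \<Longrightarrow> fold (\<lambda>k r. if P k then r(a k := h k) else r) L r0 e = r0 e"
proof -
  let ?fold = "\<lambda>L. fold (\<lambda>k r. if P k then r(a k := h k) else r) L r0"
  have "(\<forall>k\<in>set L. P k \<longrightarrow> ?fold L (a k) = h k) \<and> (\<forall>e. e \<notin> a ` {k \<in> set L. P k} \<longrightarrow> ?fold L e = r0 e)"
    using assms
  proof (induction L rule: rev_induct)
    case (snoc x L)
    have "inj_on a {k \<in> set L. P k}" using snoc.prems by (rule inj_on_subset) auto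
    then have IH: "\<forall>k\<in>set L. P k \<longrightarrow> ?fold L (a k) = h k" "\<forall>e. e \<notin> a ` {k \<in> set L. P k} \<longrightarrow> ?fold L e = r0 e"
      using snoc.IH by blast+
    define F where "F = ?fold L"
    have step: "?fold (L @ [x]) = (if P x then F(a x := h x) else F)" by (simp add: F_def)
    have "?fold (L @ [x]) (a k) = h k" if "k \<in> set (L @ [x])" "P k" for k
    proof (cases "k = x")
      case False
      then have "a k \<noteq> a x \<or> \<not> P x" using inj_onD[OF snoc.prems, of k x] that False by auto
      moreover have "F (a k) = h k" using IH(1) that False by (auto simp: F_def)
      ultimately show ?thesis unfolding step by auto
    qed (use that in \<open>simp add: step\<close>)
    moreover have "?fold (L @ [x]) e = r0 e" if "e \<notin> a ` {k \<in> set (L @ [x]). P k}" for e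
      using IH(2) that unfolding step F_def[symmetric] by (auto simp: image_iff)
    ultimately show ?case by blast
  qed (simp del: upt_Suc)
  then show "k \<in> set L \<Longrightarrow> P k \<Longrightarrow> ?fold L (a k) = h k"
    "e \<notin> a ` {k \<in> set L. P k} \<Longrightarrow> ?fold L e = r0 e" by blast+
qed

context running_program
begin

definition wP :: "nat \<Rightarrow> bool" where
  "wP = (\<lambda>k. inB (par k) \<and> \<not> inB k \<and> sn (par k, k) = (case d of Down \<Rightarrow> GT | Up \<Rightarrow> LT))"

definition wM :: "nat \<Rightarrow> bool" where
  "wM = (\<lambda>k. \<not> inB (par k) \<and> inB k \<and> sn (par k, k) = (case d of Down \<Rightarrow> LT | Up \<Rightarrow> GT))"

lemma direction_signs:
  "(case d of Down \<Rightarrow> GT | Up \<Rightarrow> LT) = flip (att d)" "(case d of Down \<Rightarrow> LT | Up \<Rightarrow> GT) = att d"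
  "(case d of Down \<Rightarrow> GT | Up \<Rightarrow> LT) = det d" "(case d of Down \<Rightarrow> LT | Up \<Rightarrow> GT) = flip (det d)"
  by (cases d; simp add: att_def det_def flip_def)+

lemma wP_iff:
  assumes "2 \<le> k" "k \<le> m" shows "wP k \<longleftrightarrow> k \<in> joining \<and> k \<notin> anc"
proof (cases "k \<in> anc")
  case True
  then show ?thesis using anc_B_iff(1)[OF assms] by (auto simp: wP_def inB_def)
next
  case False
  then have "arc k = (par k, k)" "k \<noteq> i\<^sub>m" "k \<in> Vm" using assms i\<^sub>m_anc by (auto simp: arc_def Vm_def)
  then show ?thesis using False sn[OF assms]
    by (auto simp: wP_def inB_def joining_def osg_def direction_signs(1) flip_eq)
qed

lemma wM_iff:
  assumes "2 \<le> k" "k \<le> m" shows "wM k \<longleftrightarrow> k \<in> anc \<and> par k \<in> joining"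
proof (cases "k \<in> anc")
  case True
  have p: "par k \<in> anc" "nx (par k) = k" "par k \<in> Vm" "par k \<noteq> i\<^sub>m"
    using assms True par_anc[of k] nx_par[of k] par_m[of k] anc_le[of k] by (auto simp: Vm_def)
  then have "arc (par k) = (par k, k)" by (simp add: arc_def)
  then show ?thesis using p True sn[OF assms]
    by (auto simp: wM_def inB_def joining_def osg_def direction_signs(2))
next
  case False
  then have "k \<noteq> i\<^sub>m" using i\<^sub>m_anc by auto
  then show ?thesis using False nx_B'(2)[of k] by (auto simp: wM_def inB_def)
qed

text \<open>The program indexes arcs by their heads. For an arc entering the block the farther end
  is the tail, so \<open>par\<close> translates to the indexing of \<open>joining\<close>.\<close>

lemma wM_image: "par ` {k \<in> {2..m}. wM k} = {k \<in> joining. k \<in> anc}"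
proof
  show "par ` {k \<in> {2..m}. wM k} \<subseteq> {k \<in> joining. k \<in> anc}"
    using wM_iff par_anc by auto
  show "{k \<in> joining. k \<in> anc} \<subseteq> par ` {k \<in> {2..m}. wM k}"
  proof
    fix k assume k: "k \<in> {k \<in> joining. k \<in> anc}"
    then have nk: "nx k \<in> anc" "2 \<le> nx k" "par (nx k) = k" "nx k \<le> m"
      using nx_anc[of k] anc_le[of "nx k"] i\<^sub>m by (auto simp: joining_def)
    then show "k \<in> par ` {k \<in> {2..m}. wM k}" using wM_iff[of "nx k"] k
      by (intro image_eqI[of _ _ "nx k"]) auto
  qed
qed

lemma set_upt_Suc: "set [j..<Suc m] = {j..m}"
  by auto

lemma joining_range: "k \<in> joining \<Longrightarrow> k \<le> m" "k \<in> joining \<Longrightarrow> k \<notin> anc \<Longrightarrow> 2 \<le> k"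
proof -
  assume "k \<in> joining"
  then have "k \<in> Vm" unfolding joining_def by blast
  then have k: "k \<in> {1..m}" by (simp add: Vm_def)
  then show "k \<le> m" by simp
  show "2 \<le> k" if "k \<notin> anc" using not_anc[OF k that] .
qed

lemma vE_run:
  "runs (first_tm d [1..<Suc m] (\<lambda>k. inB k \<and> k \<noteq> i\<^sub>m) cands)
    (\<lambda>r. r = bestS d (cnd ` (B - {i\<^sub>m}))) (2 * m + 1)"
proof (rule runs_weaken[OF first_run])
  have "{k \<in> set [1..<Suc m]. inB k \<and> k \<noteq> i\<^sub>m} = B - {i\<^sub>m}"
    unfolding set_upt_Suc using B_range by (auto simp: inB_def)
  moreover have "cands ` (B - {i\<^sub>m}) = cnd ` (B - {i\<^sub>m})" by (rule image_cong) (auto simp: cands_def)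
  ultimately show "r = bestS d (cnd ` (B - {i\<^sub>m}))"
    if "r = bestS d (cands ` {k \<in> set [1..<Suc m]. inB k \<and> k \<noteq> i\<^sub>m})" for r using that by simp
qed (simp del: upt_Suc)

lemma vP_run:
  "runs (first_tm d [2..<Suc m] wP (\<lambda>k. ereal (xs s k)))
    (\<lambda>r. r = bestS d ((\<lambda>k. ereal (xs s k)) ` {k \<in> joining. k \<notin> anc})) (2 * m + 1)"
proof (rule runs_weaken[OF first_run])
  have "{k \<in> set [2..<Suc m]. wP k} = {k \<in> joining. k \<notin> anc}"
    unfolding set_upt_Suc using wP_iff joining_range by force
  then show "r = bestS d ((\<lambda>k. ereal (xs s k)) ` {k \<in> joining. k \<notin> anc})"
    if "r = bestS d ((\<lambda>k. ereal (xs s k)) ` {k \<in> set [2..<Suc m]. wP k})" for r using that by simp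
qed (simp del: upt_Suc)

lemma vM_run:
  "runs (first_tm d [2..<Suc m] wM (\<lambda>k. ereal (xs s (par k))))
    (\<lambda>r. r = bestS d ((\<lambda>k. ereal (xs s k)) ` {k \<in> joining. k \<in> anc})) (2 * m + 1)"
proof (rule runs_weaken[OF first_run])
  have "(\<lambda>k. ereal (xs s (par k))) ` {k \<in> set [2..<Suc m]. wM k}
      = (\<lambda>k. ereal (xs s k)) ` par ` {k \<in> {2..m}. wM k}"
    unfolding set_upt_Suc by (simp add: image_image)
  then show "r = bestS d ((\<lambda>k. ereal (xs s k)) ` {k \<in> joining. k \<in> anc})"
    if "r = bestS d ((\<lambda>k. ereal (xs s (par k))) ` {k \<in> set [2..<Suc m]. wM k})" for r
    using that unfolding wM_image by simp
qed (simp del: upt_Suc)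

lemma deriv_run: "runs (deriv_tm f k v) (\<lambda>g. g = deriv (f k) v) 1"
  by (simp add: runs_def deriv_tm_def)

lemma increment_run:
  assumes "sigma_totals S"
  shows "runs (increment_tm f d m inB (S i\<^sub>m) (tcur s) v) (\<lambda>r. r = conv v) (3 * m + 4)"
proof (cases "\<bar>v\<bar> = \<infinity>")
  case True
  then show ?thesis by (simp add: increment_tm_def conv_def runs_def step_def)
next
  case False
  define w where "w = real_of_ereal v"
  have loop: "runs (for_tm [1..<Suc m] (\<lambda>k r. if inB k then bind_tm (deriv_tm f k w) (\<lambda>g. step (r + g)) else step r) 0)
     (\<lambda>r. r = (\<Sum>k\<in>{k \<in> B. k < Suc m}. deriv (loss H k) w)) ((Suc m - 1) * (2 + 1) + 1)"
  proof (rule runs_for_upt[where I = "\<lambda>j r. r = (\<Sum>k\<in>{k \<in> B. k < j}. deriv (loss H k) w)"])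
    show "0 = (\<Sum>k\<in>{k \<in> B. k < 1}. deriv (loss H k) w)" using B_range by (intro sum.neutral[symmetric]) force
    fix k r assume r: "r = (\<Sum>k\<in>{k' \<in> B. k' < k}. deriv (loss H k) w)"
    show "runs (if inB k then bind_tm (deriv_tm f k w) (\<lambda>g. step (r + g)) else step r)
      (\<lambda>r. r = (\<Sum>k\<in>{k' \<in> B. k' < Suc k}. deriv (loss H k) w)) 2"
    proof (cases "k \<in> B")
      case True
      have "{k' \<in> B. k' < Suc k} = insert k {k' \<in> B. k' < k}" using True by auto
      then show ?thesis using True r finite_B f_V[OF B_Vm[OF True]]
        by (auto simp: inB_def runs_def bind_tm_def step_def deriv_tm_def)
    next
      case False
      then have "{k' \<in> B. k' < Suc k} = {k' \<in> B. k' < k}" by (auto simp: less_Suc_eq)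
      then show ?thesis using False r by (simp add: inB_def runs_def step_def)
    qed
  qed (simp del: upt_Suc)
  have S: "{k \<in> B. k < Suc m} = B" using B_range by force
  have "runs (increment_tm f d m inB (S i\<^sub>m) (tcur s) v) (\<lambda>r. r = conv v) (1 + ((Suc m - 1) * (2 + 1) + 1 + 1))"
    unfolding increment_tm_def if_not_P[OF False]
  proof (rule runs_bind_step, fold w_def, rule runs_bind[OF loop])
    fix r assume "r = (\<Sum>k\<in>{k \<in> B. k < Suc m}. deriv (loss H k) w)"
    then have "ereal (r - S i\<^sub>m - tcur s) = conv v"
      using False assms root_B unfolding S
      by (simp add: conv_def pot_def branch_root sigma_totals_def sum_subtractf w_def)
    then show "runs (step (ereal (r - S i\<^sub>m - tcur s))) (\<lambda>r. r = conv v) 1" by (simp add: runs_step)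
  qed
  then show ?thesis by (rule runs_le) simp
qed

lemma meet_run:
  assumes "sigma_totals S" "loss_totals F"
  shows "runs (invert_tm inv_cost f (Plus (F i\<^sub>m) (Single (Suc m))) (S i\<^sub>m)) (\<lambda>r. r = y_meet) (K + 1)"
proof -
  have F: "fsum_fun f (Plus (F i\<^sub>m) (Single (Suc m))) = (\<lambda>v. branch_loss i\<^sub>m v + loss H (Suc m) v)"
    using assms(2) root_B f_loss[of "Suc m"] m by (simp add: loss_totals_def)
  have S: "S i\<^sub>m = sum sig B" using assms(1) root_B by (simp add: sigma_totals_def branch_root)
  show ?thesis unfolding y_meet_def S
    by (rule invert_run[OF F]) (intro ssc_add ssc_branch_loss root_B ssc_fn)
qed

lemma v_run:
  assumes "sigma_totals S" "loss_totals F"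
  shows "runs (invert_tm inv_cost f (F i\<^sub>m) (t_next + S i\<^sub>m)) (\<lambda>r. r = v_next) (K + 1)"
proof -
  have F: "fsum_fun f (F i\<^sub>m) = branch_loss i\<^sub>m" and S: "S i\<^sub>m = sum sig (branch i\<^sub>m)"
    using assms root_B by (simp_all add: loss_totals_def sigma_totals_def)
  show ?thesis unfolding v_next_def pot_inv_def S
    by (rule invert_run[OF F]) (rule ssc_branch_loss[OF root_B])
qed

lemma f_new: "fsum_fun f (Single (Suc m)) = loss H (Suc m)"
  using f_loss[of "Suc m"] m by simp

lemma w_run: "runs (invert_tm inv_cost f (Single (Suc m)) (- t_next)) (\<lambda>r. r = w_next) (K + 1)"
  unfolding w_next_def by (rule invert_run[OF f_new ssc_fn])

lemma limit_program: "(case d of Down \<Rightarrow> - la (i\<^sub>m, Suc m) | Up \<Rightarrow> mv (i\<^sub>m, Suc m)) = limit d"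
  using la[of "Suc m"] mv[of "Suc m"] m by (simp add: limit_def split: direction.split)

lemma t_next_program:
  "real_of_ereal (best d (ereal (tcur s) + conv (bestS d events))
     (best d (ereal (tcur s + (- deriv (f (Suc m)) y_meet - tcur s))) (limit d))) = t_next"
  using f_loss[of "Suc m"] m by (simp add: t_next_def)

definition x_next :: "nat \<Rightarrow> real" where
  "x_next = (\<lambda>k. if k \<in> B then v_next else if k = Suc m then w_next else xs s k)"

lemma x_next_program:
  "(fold (\<lambda>k x. if inB k then x(k := v_next) else x) [1..<Suc m] (xs s))(Suc m := w_next) = x_next"
  unfolding fold_array set_upt_Suc x_next_def
  using B_range Suc_m_notin by (auto simp: inB_def fun_eq_iff)

lemma D_loop_run:
  "runs (for_tm [1..<Suc m] (\<lambda>k D. if inB k then bind_tm (deriv_tm f k v) (\<lambda>g. step (D(k := g))) else step D) (\<lambda>_. 0))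
    (\<lambda>D. D = (\<lambda>k. if k \<in> B then deriv (f k) v else 0)) (3 * m + 1)"
proof (rule runs_weaken[OF runs_for_fold[where N = 2 and f = "\<lambda>k D. if inB k then D(k := deriv (f k) v) else D"]])
  show "runs (if inB k then bind_tm (deriv_tm f k v) (\<lambda>g. step (D(k := g))) else step D)
      (\<lambda>s'. s' = (if inB k then D(k := deriv (f k) v) else D)) 2" for k D
    by (simp add: runs_def bind_tm_def step_def deriv_tm_def)
  show "D = (\<lambda>k. if k \<in> B then deriv (f k) v else 0)"
    if "D = fold (\<lambda>k D. if inB k then D(k := deriv (f k) v) else D) [1..<Suc m] (\<lambda>_. 0)" for D
    unfolding that fold_array set_upt_Suc using B_range by (auto simp: inB_def fun_eq_iff)
qed (simp del: upt_Suc)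

definition updated_flow :: "(nat \<times> nat \<Rightarrow> real) \<Rightarrow> bool" where
  "updated_flow z \<longleftrightarrow> (\<forall>k\<in>B - {i\<^sub>m}. z (arc k) = (if k \<in> anc then pot k v_next else - pot k v_next)) \<and>
     (\<forall>e. e \<notin> arc ` (B - {i\<^sub>m}) \<longrightarrow> z e = zs s e)"

lemma inj_on_arc_sub: "A \<subseteq> B - {i\<^sub>m} \<Longrightarrow> inj_on arc A"
  using B_V by (intro inj_on_subset[OF inj_on_arc]) auto

lemma z_run:
  assumes "points_to_block_root nxt" "sigma_totals S" "\<forall>k\<in>B. D k = (\<Sum>l\<in>branch k. deriv (loss H l) v_next)"
  shows "runs (for_tm [1..<Suc m] (\<lambda>k z. step
       (if inB k \<and> k \<noteq> i\<^sub>m then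
          (if inP k then z((k, nxt k) := D k - S k) else z((par k, k) := - D k + S k))
        else z)) (zs s)) updated_flow (2 * m + 1)"
proof (rule runs_weaken[OF runs_for_step])
  let ?h = "\<lambda>k. if k \<in> anc then D k - S k else - D k + S k"
  let ?L = "[1..<Suc m]"
  let ?P = "\<lambda>k. inB k \<and> k \<noteq> i\<^sub>m"
  fix z assume "z = fold (\<lambda>k z. if inB k \<and> k \<noteq> i\<^sub>m then
          (if inP k then z((k, nxt k) := D k - S k) else z((par k, k) := - D k + S k)) else z) ?L (zs s)"
  also have "\<dots> = fold (\<lambda>k z. if ?P k then z(arc k := ?h k) else z) ?L (zs s)"
    using assms(1) by (intro fold_cong) (auto simp: inB_def inP_def points_to_block_root_def arc_def fun_eq_iff)
  finally have z: "z = fold (\<lambda>k z. if ?P k then z(arc k := ?h k) else z) ?L (zs s)" .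
  have P: "{k \<in> set ?L. ?P k} = B - {i\<^sub>m}" unfolding set_upt_Suc using B_range by (auto simp: inB_def)
  then have inj: "inj_on arc {k \<in> set ?L. ?P k}" using inj_on_arc_sub by simp
  have "z (arc k) = (if k \<in> anc then pot k v_next else - pot k v_next)" if "k \<in> B - {i\<^sub>m}" for k
  proof -
    have "k \<in> set ?L" "?P k" using that unfolding P[symmetric] by blast+
    then have "z (arc k) = ?h k" unfolding z by (rule fold_array_inj(1)[OF inj])
    then show ?thesis using that assms(2,3) by (simp add: pot_def sum_subtractf sigma_totals_def)
  qed
  moreover have "z e = zs s e" if "e \<notin> arc ` (B - {i\<^sub>m})" for e
    unfolding z using that by (intro fold_array_inj(2)[OF inj]) (simp only: P not_False_eq_True)
  ultimately show "updated_flow z" by (simp add: updated_flow_def)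
qed (simp del: upt_Suc)

definition detached_signs :: "(nat \<times> nat \<Rightarrow> order_sign) \<Rightarrow> bool" where
  "detached_signs r \<longleftrightarrow> (\<forall>k\<in>Vm - {i\<^sub>m}. r (arc k) = (if k \<in> B \<and> cnd k = ereal v_next then
     (if k \<in> anc then det d else flip (det d)) else sg s (arc k)))"

lemma sg1_run:
  assumes "points_to_block_root nxt"
  shows "runs (for_tm [1..<Suc m] (\<lambda>k r. step
         (if inB k \<and> k \<noteq> i\<^sub>m \<and> cands k = ereal v_next then
            (if inP k then r((k, nxt k) := (case d of Down \<Rightarrow> GT | Up \<Rightarrow> LT))
             else r((par k, k) := (case d of Down \<Rightarrow> LT | Up \<Rightarrow> GT)))
          else r)) sn) detached_signs (2 * m + 1)"
proof (rule runs_weaken[OF runs_for_step])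
  let ?h = "\<lambda>k. if k \<in> anc then det d else flip (det d)"
  let ?L = "[1..<Suc m]"
  let ?P = "\<lambda>k. inB k \<and> k \<noteq> i\<^sub>m \<and> cands k = ereal v_next"
  fix r assume "r = fold (\<lambda>k r. if inB k \<and> k \<noteq> i\<^sub>m \<and> cands k = ereal v_next then
            (if inP k then r((k, nxt k) := (case d of Down \<Rightarrow> GT | Up \<Rightarrow> LT))
             else r((par k, k) := (case d of Down \<Rightarrow> LT | Up \<Rightarrow> GT))) else r) ?L sn"
  also have "\<dots> = fold (\<lambda>k r. if ?P k then r(arc k := ?h k) else r) ?L sn"
    using assms by (intro fold_cong)
      (auto simp: inB_def inP_def points_to_block_root_def arc_def fun_eq_iff direction_signs(3,4))
  finally have r: "r = fold (\<lambda>k r. if ?P k then r(arc k := ?h k) else r) ?L sn" .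
  have P: "{k \<in> set ?L. ?P k} = {k \<in> B - {i\<^sub>m}. cnd k = ereal v_next}"
    unfolding set_upt_Suc using B_range by (auto simp: inB_def cands_def)
  then have inj: "inj_on arc {k \<in> set ?L. ?P k}" using inj_on_arc_sub by auto
  have "r (arc k) = (if k \<in> B \<and> cnd k = ereal v_next then ?h k else sg s (arc k))" if k: "k \<in> Vm - {i\<^sub>m}" for k
  proof (cases "k \<in> B \<and> cnd k = ereal v_next")
    case True
    then have "k \<in> {k \<in> set ?L. ?P k}" unfolding P using k by blast
    then have "k \<in> set ?L" "?P k" by blast+
    then have "r (arc k) = ?h k" unfolding r by (rule fold_array_inj(1)[OF inj])
    then show ?thesis using True by simp
  next
    case False
    then have "arc k \<notin> arc ` {k \<in> set ?L. ?P k}" unfolding P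
      using k B_V by (subst arc_image_iff) auto
    then have "r (arc k) = sn (arc k)" unfolding r by (rule fold_array_inj(2)[OF inj])
    then show ?thesis using False k sn_arc by auto
  qed
  then show "detached_signs r" by (simp add: detached_signs_def)
qed (simp del: upt_Suc)

lemma sg2_run:
  assumes "detached_signs r1"
  shows "runs (for_tm [2..<Suc m] (\<lambda>k r. step
         (if wP k \<and> xs s k = v_next \<or> wM k \<and> xs s (par k) = v_next then r((par k, k) := EQ) else r)) r1)
     (\<lambda>r. \<forall>k\<in>Vm - {i\<^sub>m}. osg r k = S_next k) (2 * m + 1)"
proof (rule runs_weaken[OF runs_for_step])
  let ?L = "[2..<Suc m]"
  let ?P = "\<lambda>k. wP k \<and> xs s k = v_next \<or> wM k \<and> xs s (par k) = v_next"
  fix r assume r: "r = fold (\<lambda>k r. if ?P k then r((par k, k) := EQ) else r) ?L r1"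
  have inj: "inj_on (\<lambda>k. (par k, k)) {k \<in> set ?L. ?P k}" by (auto simp: inj_on_def)
  have r_at: "r (par c, c) = (if ?P c then EQ else r1 (par c, c))" if c: "2 \<le> c" "c \<le> m" for c
  proof (cases "?P c")
    case True
    have "c \<in> set ?L" unfolding set_upt_Suc using c by simp
    then have "r (par c, c) = EQ" unfolding r using True by (rule fold_array_inj(1)[OF inj])
    then show ?thesis using True by simp
  next
    case False
    then have "(par c, c) \<notin> (\<lambda>k. (par k, k)) ` {k \<in> set ?L. ?P k}" by auto
    then have "r (par c, c) = r1 (par c, c)" unfolding r by (rule fold_array_inj(2)[OF inj])
    then show ?thesis unfolding if_not_P[OF False] .
  qed
  show "\<forall>k\<in>Vm - {i\<^sub>m}. osg r k = S_next k"
  proof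
    fix k assume k: "k \<in> Vm - {i\<^sub>m}"
    have r1: "r1 (arc k) = (if k \<in> B \<and> cnd k = ereal v_next then
      (if k \<in> anc then det d else flip (det d)) else sg s (arc k))" using assms k by (simp add: detached_signs_def)
    have "r (arc k) = (if k \<in> joining \<and> xs s k = v_next then EQ else r1 (arc k))"
    proof (cases "k \<in> anc")
      case True
      then have nk: "nx k \<in> anc" "2 \<le> nx k" "par (nx k) = k" "nx k \<le> m"
        using k nx_anc[of k] anc_le[of "nx k"] i\<^sub>m by auto
      then have "?P (nx k) \<longleftrightarrow> k \<in> joining \<and> xs s k = v_next"
        using wP_iff[of "nx k"] wM_iff[of "nx k"] by auto
      moreover have "arc k = (par (nx k), nx k)" using True nk by (simp add: arc_def)
      ultimately show ?thesis using r_at[of "nx k"] nk by simp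
    next
      case False
      then have c: "2 \<le> k" "k \<le> m" using k not_anc[of k] by (auto simp: Vm_def)
      then have "?P k \<longleftrightarrow> k \<in> joining \<and> xs s k = v_next"
        using wP_iff[of k] wM_iff[of k] False by auto
      moreover have "arc k = (par k, k)" using False by (simp add: arc_def)
      ultimately show ?thesis using r_at[OF c] by simp
    qed
    then show "osg r k = S_next k" using k r1 by (intro sign_next) auto
  qed
qed (simp del: upt_Suc)

lemma update_spec_record:
  assumes "updated_flow z" "fd \<longleftrightarrow> ereal t_next = limit d \<or> x_next i\<^sub>m = x_next (Suc m)"
    and "\<not> fd \<Longrightarrow> \<forall>k\<in>Vm - {i\<^sub>m}. osg r k = S_next k"
  shows "update_spec \<lparr>tcur = t_next, xs = x_next, zs = z, sg = r\<rparr> fd"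
  using assms root_B Suc_m_notin unfolding update_spec_def updated_flow_def by (simp add: x_next_def)

text \<open>The cost bound starts as an unknown and grows by one summand per statement of the
  program; only the last line compares the resulting sum, in which \<open>K\<close> occurs at most
  multiplied by \<open>m\<close>, with the generous factor 100.\<close>

lemma update_run:
  assumes s': "tcur s' = tcur s" "xs s' = xs s" "zs s' = zs s" "sg s' = sn"
  shows "runs (update_tm inv_cost f par la mv d m i\<^sub>m s') (\<lambda>a. update_spec (fst a) (snd a))
    ((K + 1) * 100 * (m + 1))"
  apply (rule runs_le)
   apply (unfold update_tm_def Let_def s')
   apply (rule runs_bind, rule block_run)
   apply (elim exE conjE, hypsubst, unfold prod.case)
   apply (fold wP_def wM_def)
   apply (rule runs_bind, rule sigma_run)
   apply (rule runs_bind, rule S_run, assumption, assumption)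
   apply (rule runs_bind_value, rule runs_new_array_value)
   apply (rule runs_bind_value, rule runs_for_step)
   apply (rule runs_bind, rule F_run, assumption)
   apply (rule runs_bind_value, rule cand_run, assumption, assumption, assumption)
   apply (rule runs_bind_value, rule vE_run)
   apply (rule runs_bind_value, rule vP_run)
   apply (rule runs_bind_value, rule vM_run)
   apply (rule runs_bind_value, rule increment_run, assumption)
   apply (rule runs_bind_value, rule increment_run, assumption)
   apply (rule runs_bind_value, rule increment_run, assumption)
   apply (rule runs_bind_eq, rule increments_combined)
   apply (rule runs_bind_value, rule meet_run, assumption, assumption)
   apply (rule runs_bind_value, rule deriv_run)
   apply (rule runs_bind_step)
   apply (rule runs_bind_eq, rule limit_program)
   apply (rule runs_bind_eq, rule t_next_program)
   apply (rule runs_bind_value, rule v_run, assumption, assumption)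
   apply (rule runs_bind_value, rule w_run)
   apply (rule runs_bind_value, rule runs_for_step)
   apply (rule runs_bind_eq, rule x_next_program)
   apply (rule runs_bind_value, rule runs_new_array_value)
   apply (rule runs_bind_value, rule D_loop_run)
   apply (rule runs_bind, rule D_run, assumption)
   apply (rule runs_bind, rule z_run, assumption, assumption, assumption)
   apply (rule runs_bind_step)
   apply (rule runs_if)
    apply (rule runs_step)
    apply (unfold fst_conv snd_conv)
    apply (rule update_spec_record, assumption, simp, simp)
   apply (rule runs_bind, rule sg1_run, assumption)
   apply (rule runs_bind, rule sg2_run[unfolded wP_def wM_def], assumption)
   apply (rule runs_step)
   apply (unfold fst_conv snd_conv)
   apply (rule update_spec_record, assumption, simp, simp)
  apply (simp add: algebra_simps)
  done

end

section \<open>A whole stage, and the loop over the stages\<close>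

section \<open>Stages\<close>

context stage
begin

text \<open>In a stage, an arc passes from \<open>att d\<close> to \<open>EQ\<close> to \<open>det d\<close> and never back.\<close>

definition progress :: "direction \<Rightarrow> (nat \<times> nat \<Rightarrow> order_sign) \<Rightarrow> nat" where
  "progress d sn = (\<Sum>k\<in>Vm - {i\<^sub>m}. if osg sn k = att d then 2 else if osg sn k = EQ then 1 else 0)"

lemma progress_le: "progress d sn \<le> 2 * m"
proof -
  have "progress d sn \<le> of_nat (card (Vm - {i\<^sub>m})) * 2"
    unfolding progress_def by (rule sum_bounded_above) simp
  also have "card (Vm - {i\<^sub>m}) \<le> m" by (simp add: Vm_def card_Diff_singleton_if)
  finally show ?thesis by simp
qed

lemma sub_arcs_Suc: "sub_arcs H (Suc m) = insert (i\<^sub>m, Suc m) (sub_arcs H m)"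
  using m by (auto simp: sub_arcs_eq le_Suc_eq)

lemma sub_arcs_bounds: "e \<in> sub_arcs H m \<Longrightarrow> fst e \<in> {1..m} \<and> snd e \<in> {1..m}"
  by (auto simp: sub_arcs_def)

lemma outflow_insert:
  assumes "k \<in> {1..Suc m}"
  shows "outflow (sub_arcs H (Suc m)) (z((i\<^sub>m, Suc m) := t)) k =
    (if k = Suc m then - t else outflow (sub_arcs H m) z k + (if k = i\<^sub>m then t else 0))"
proof -
  let ?e = "(i\<^sub>m, Suc m)" and ?E = "sub_arcs H m" and ?z = "z((i\<^sub>m, Suc m) := t)"
  have e: "?e \<notin> ?E" using sub_arcs_bounds[of ?e] by auto
  have z: "sum ?z {e \<in> ?E. Q e} = sum z {e \<in> ?E. Q e}" for Q using e by (intro sum.cong) auto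
  have ins: "{e \<in> insert ?e ?E. Q e} = (if Q ?e then insert ?e {e \<in> ?E. Q e} else {e \<in> ?E. Q e})" for Q
    by auto
  have s: "sum ?z {e \<in> insert ?e ?E. Q e} = (if Q ?e then t else 0) + sum z {e \<in> ?E. Q e}" for Q
    using e finite_sub_arcs z[of Q] unfolding ins by simp
  have new: "{e \<in> ?E. fst e = Suc m} = {}" "{e \<in> ?E. snd e = Suc m} = {}" using sub_arcs_bounds by fastforce+
  show ?thesis unfolding outflow_def sub_arcs_Suc s using i\<^sub>m by (cases "k = Suc m") (auto simp: new)
qed

lemma weights_new: "limit Down \<le> 0" "0 \<le> limit Up"
  using weights[of "Suc m"] m by (simp_all add: limit_def)

text \<open>The extra outflow \<open>t\<close> at \<open>i\<^sub>m\<close> becomes the flow on the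
  new arc. If the values have met, the arc gets the sign \<open>EQ\<close>; otherwise the limit was
  reached and the flow sits on the bound demanded by the strict order.\<close>

lemma kkt_of_invariant:
  assumes inv: "invariant d s" and fin: "ereal (tcur s) = limit d \<or> xs s (Suc m) = xs s i\<^sub>m"
  shows "kkt H (Suc m) (xs s) ((zs s)((i\<^sub>m, Suc m) := tcur s))"
  unfolding kkt_def
proof (intro conjI ballI)
  fix k assume k: "k \<in> {1..Suc m}"
  show "deriv (loss H k) (xs s k) = outflow (sub_arcs H (Suc m)) ((zs s)((i\<^sub>m, Suc m) := tcur s)) k"
    unfolding outflow_insert[OF k] using inv k unfolding invariant_def by (auto simp: Vm_def le_Suc_eq)
next
  fix e assume e: "e \<in> sub_arcs H (Suc m)"
  let ?z = "(zs s)((i\<^sub>m, Suc m) := tcur s)"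
  show "\<exists>sn. arc_opt H (xs s) ?z sn e"
  proof (cases "e = (i\<^sub>m, Suc m)")
    case False
    then have "e \<in> sub_arcs H m" using e unfolding sub_arcs_Suc by blast
    then show ?thesis using inv False unfolding invariant_def arc_opt_def by auto
  next
    case True
    have d: "lee d (xs s (Suc m)) (xs s i\<^sub>m)" "lee d (limit d) (ereal (tcur s))" "lee d (tcur s) 0"
      using inv by (auto simp: invariant_def)
    show ?thesis
    proof (cases "xs s (Suc m) = xs s i\<^sub>m")
      case eq: True
      have t: "- lam H e \<le> 0" "0 \<le> mu H e" using weights_new True by (simp_all add: limit_def)
      have "ereal (tcur s) \<le> 0 \<and> - lam H e \<le> ereal (tcur s) \<or> 0 \<le> ereal (tcur s) \<and> ereal (tcur s) \<le> mu H e"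
        using d True by (cases d) (auto simp: lee_def limit_def)
      then have "- lam H e \<le> ereal (tcur s) \<and> ereal (tcur s) \<le> mu H e"
        using t order_trans[of "ereal (tcur s)" 0 "mu H e"] order_trans[of "- lam H e" 0 "ereal (tcur s)"] by blast
      then have "arc_ok (- lam H e) (mu H e) EQ (xs s i\<^sub>m) (xs s (Suc m)) (tcur s)"
        using eq by (simp add: arc_ok_def)
      then show ?thesis using True by (auto simp: arc_opt_def)
    next
      case False
      then have "arc_ok (- lam H e) (mu H e) (case d of Down \<Rightarrow> GT | Up \<Rightarrow> LT) (xs s i\<^sub>m) (xs s (Suc m)) (tcur s)"
        using d fin True by (cases d) (auto simp: arc_ok_def lee_def limit_def)
      then show ?thesis using True by (auto simp: arc_opt_def)
    qed
  qed
qed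

text \<open>A stage starts with signs computed from the values. The only change concerns ties whose
  flow sits on a bound; \<open>EQ\<close> accepts them because
  \<open>l \<le> 0 \<le> u\<close>.\<close>

lemma arc_ok_compare:
  assumes "arc_ok l u sn a b z" "l \<le> 0" "0 \<le> u" shows "arc_ok l u (compare_sign a b) a b z"
  using assms by (cases sn) (auto simp: arc_ok_def compare_sign_def intro: order_trans)

lemma initial_invariant:
  assumes kkt: "kkt H m x z"
    and w: "deriv (loss H (Suc m)) w = 0" and g: "g = deriv (loss H (Suc m)) (x i\<^sub>m)"
    and s: "tcur s = 0" "xs s = x(Suc m := w)" "zs s = z"
    and sn: "\<And>k. 2 \<le> k \<Longrightarrow> k \<le> m \<Longrightarrow> sg s (par k, k) = compare_sign (x (par k)) (x k)"
  shows "invariant (if g > 0 then Down else Up) s" "g = 0 \<longleftrightarrow> w = x i\<^sub>m"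
proof -
  have smooth_strongly_convex: "smooth_strongly_convex (loss H (Suc m))" using ssc_loss[of "Suc m"] m by simp
  note mono = strict_mono_less_eq[OF deriv_strict_mono[OF smooth_strongly_convex]] strict_mono_eq[OF deriv_strict_mono[OF smooth_strongly_convex]]
  show "g = 0 \<longleftrightarrow> w = x i\<^sub>m" using mono(2)[of w "x i\<^sub>m"] w g by auto
  have opt: "arc_opt H (xs s) (zs s) (sg s e) e" if "e \<in> sub_arcs H m" for e
  proof -
    obtain k where k: "e = (par k, k)" "2 \<le> k" "k \<le> m"
      using \<open>e \<in> sub_arcs H m\<close> unfolding sub_arcs by blast
    obtain sn' where "arc_opt H x z sn' e" using kkt \<open>e \<in> sub_arcs H m\<close> unfolding kkt_def by blast
    then have "arc_ok (- lam H e) (mu H e) (compare_sign (x (par k)) (x k)) (x (par k)) (x k) (z e)"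
      using weights[of k] k m by (intro arc_ok_compare) (auto simp: arc_opt_def)
    then show ?thesis using s sn[OF k(2,3)] k par_m[of k] by (simp add: arc_opt_def)
  qed
  have "lee (if g > 0 then Down else Up) w (x i\<^sub>m)"
    using mono(1)[of w "x i\<^sub>m"] mono(1)[of "x i\<^sub>m" w] w g by (auto simp: lee_def)
  moreover have "lee (if g > 0 then Down else Up) (limit (if g > 0 then Down else Up)) (ereal 0)"
    using weights_new by (auto simp: lee_def zero_ereal_def)
  ultimately show "invariant (if g > 0 then Down else Up) s"
    using s kkt opt w i\<^sub>m unfolding invariant_def kkt_def by (auto simp: Vm_def)
qed

end

context running
begin

lemma sign_weight_progress: "sign_weight sn = progress d sn"
  unfolding sign_weight_def progress_def weight_def ..

lemma update_spec_update:
  "update_spec (fst ((if d = Down then update_minus H m else update_plus H m) s))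
     (snd ((if d = Down then update_minus H m else update_plus H m) s))"
  using update_minus_spec update_plus_spec by (cases "d = Down") (auto, cases d, auto)

end

locale stage_program = stage H n par m + program H n par inv_cost f la mv K
  for H n par m inv_cost f la mv K
begin

text \<open>The two computations differ in the signs of pairs that are not arcs.\<close>

definition simulates :: "direction \<Rightarrow> asra_state \<times> bool \<Rightarrow> asra_state \<times> bool \<Rightarrow> bool" where
  "simulates d a b \<longleftrightarrow> snd b = snd a \<and>
     tcur (fst b) = tcur (fst a) \<and> xs (fst b) = xs (fst a) \<and> zs (fst b) = zs (fst a) \<and>
     (if snd a then kkt H (Suc m) (xs (fst a)) ((zs (fst a))((i\<^sub>m, Suc m) := tcur (fst a)))
      else invariant d (fst a) \<and> xs (fst a) (Suc m) \<noteq> xs (fst a) i\<^sub>m \<and>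
        (\<forall>k. 2 \<le> k \<longrightarrow> k \<le> m \<longrightarrow> sg (fst b) (par k, k) = sg (fst a) (par k, k)))"

lemma simulates_step:
  assumes sim: "simulates d (s, False) (s', False)"
  defines "u \<equiv> (if d = Down then update_minus H m else update_plus H m) s"
  shows "runs (update_tm inv_cost f par la mv d m i\<^sub>m s') (simulates d u) ((K + 1) * 100 * (m + 1))"
    and "\<not> snd u \<Longrightarrow> progress d (sg (fst u)) < progress d (sg s)"
proof -
  interpret running_program H n par m s d inv_cost f la mv K "sg s'"
    using sim by unfold_locales (auto simp: simulates_def)
  have u: "update_spec (fst u) (snd u)" unfolding u_def by (rule update_spec_update)
  show "progress d (sg (fst u)) < progress d (sg s)" if "\<not> snd u"
    using spec_invariant(3)[OF u that] by (simp only: sign_weight_progress)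
  note inv_u = spec_invariant(1,2)[OF u]
  have pure: "if snd u then kkt H (Suc m) (xs (fst u)) ((zs (fst u))((i\<^sub>m, Suc m) := tcur (fst u)))
      else invariant d (fst u) \<and> xs (fst u) (Suc m) \<noteq> xs (fst u) i\<^sub>m"
  proof (cases "snd u")
    case True
    then have "invariant d ((fst u)\<lparr>sg := sg s\<rparr>)" using inv_u(1) by simp
    then show ?thesis using kkt_of_invariant[of d "(fst u)\<lparr>sg := sg s\<rparr>"] inv_u(2) True by simp
  next
    case False
    then show ?thesis using inv_u by simp
  qed
  have "runs (update_tm inv_cost f par la mv d m i\<^sub>m s') (\<lambda>a. update_spec (fst a) (snd a))
      ((K + 1) * 100 * (m + 1))"
    using sim by (intro update_run) (auto simp: simulates_def)
  then show "runs (update_tm inv_cost f par la mv d m i\<^sub>m s') (simulates d u) ((K + 1) * 100 * (m + 1))"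
  proof (rule runs_weaken)
    fix b assume b: "update_spec (fst b) (snd b)"
    note eq = update_spec_unique[OF b u]
    have "(par k, k) \<in> sub_arcs H m" if "2 \<le> k" "k \<le> m" for k using that unfolding sub_arcs by blast
    then show "simulates d u b" using pure eq unfolding simulates_def by auto
  qed simp
qed

lemma generate_run:
  assumes kkt: "kkt H m x z"
  shows "\<exists>x' z'. generate H m (x, z) = Some (x', z') \<and> kkt H (Suc m) x' z' \<and>
    runs (generate_tm inv_cost f par la mv m (x, z)) (\<lambda>a. a = (x', z')) (250 * (K + 1) * n\<^sup>2)"
proof -
  have smooth_strongly_convex: "smooth_strongly_convex (loss H (Suc m))" using ssc_loss[of "Suc m"] m by simp
  have f: "f (Suc m) = loss H (Suc m)" using f_loss[of "Suc m"] m by simp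
  define g where "g = deriv (loss H (Suc m)) (x i\<^sub>m)"
  define d where "d = (if g > 0 then Down else Up)"
  define w where "w = deriv_inv (loss H (Suc m)) 0"
  define s0 where "s0 = \<lparr>tcur = 0, xs = x(Suc m := w), zs = z, sg = (\<lambda>(i, j). compare_sign (x i) (x j))\<rparr>"
  define sg0 where "sg0 = fold (\<lambda>k r. r((par k, k) := compare_sign (x (par k)) (x k))) [2..<Suc m] (\<lambda>_. EQ)"
  define s1 where "s1 = \<lparr>tcur = 0, xs = x(Suc m := w), zs = z, sg = sg0\<rparr>"
  let ?upd = "\<lambda>(s, _ :: bool). (if d = Down then update_minus H m else update_plus H m) s"
  let ?body = "\<lambda>(s, _ :: bool). update_tm inv_cost f par la mv d m i\<^sub>m s"
  let ?b = "\<lambda>(s :: asra_state, found). \<not> found"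
  let ?C = "(K + 1) * 100 * (m + 1)"
  have w: "deriv (loss H (Suc m)) w = 0" using smooth_strongly_convex by (simp add: w_def)
  have inv0: "invariant d s0"
    unfolding d_def using kkt w g_def by (rule initial_invariant(1)) (simp_all add: s0_def)
  have g0: "g = 0 \<longleftrightarrow> w = x i\<^sub>m"
    using kkt w g_def by (rule initial_invariant(2)[where s = s0]) (simp_all add: s0_def)
  have x0: "xs s0 (Suc m) = w" "xs s0 i\<^sub>m = x i\<^sub>m" using i\<^sub>m by (auto simp: s0_def)
  have sg0: "sg0 (par k, k) = compare_sign (x (par k)) (x k)" if "2 \<le> k" "k \<le> m" for k
  proof -
    have "k \<in> set [2..<Suc m]" using that by (simp del: upt_Suc)
    moreover have "inj_on (\<lambda>k. (par k, k)) {k \<in> set [2..<Suc m]. True}" by (auto simp: inj_on_def)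
    ultimately have "fold (\<lambda>k r. if True then r((par k, k) := compare_sign (x (par k)) (x k)) else r)
        [2..<Suc m] (\<lambda>_. EQ) (par k, k) = compare_sign (x (par k)) (x k)"
      by (intro fold_array_inj(1)[where a = "\<lambda>k. (par k, k)" and P = "\<lambda>_. True"] TrueI)
    then show ?thesis unfolding sg0_def by (simp only: if_True)
  qed
  have sim0: "simulates d (s0, g = 0) (s1, g = 0)"
    unfolding simulates_def using inv0 g0 x0 sg0 kkt_of_invariant[OF inv0]
    by (auto simp: s0_def s1_def)
  have "\<exists>r. while_option ?b ?upd (s0, g = 0) = Some r \<and> \<not> ?b r \<and>
    runs (while_tm ?b ?body (s1, g = 0)) (simulates d r) ((progress d (sg (fst (s0, g = 0))) + 1) * (?C + 1) + 1)"
  proof (rule runs_while_simulation[where R = "simulates d" and \<nu> = "\<lambda>a. progress d (sg (fst a))"])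
    show "simulates d (s0, g = 0) (s1, g = 0)" by (rule sim0)
    fix a b assume ab: "simulates d a b"
    obtain s fd s' fd' where a: "a = (s, fd)" "b = (s', fd')" by (cases a, cases b)
    then have fd: "fd' = fd" using ab by (simp add: simulates_def)
    then show "?b b = ?b a" using a by simp
    assume "?b a"
    then have "simulates d (s, False) (s', False)" using ab a fd by simp
    note st = simulates_step[OF this]
    show "runs (?body b) (simulates d (?upd a)) ?C" using st(1) a by simp
    assume "?b (?upd a)"
    then show "progress d (sg (fst (?upd a))) < progress d (sg (fst a))" using st(2) a by (auto simp: case_prod_beta)
  qed
  then obtain r where r: "while_option ?b ?upd (s0, g = 0) = Some r" "\<not> ?b r"
    and run: "runs (while_tm ?b ?body (s1, g = 0)) (simulates d r) ((progress d (sg s0) + 1) * (?C + 1) + 1)"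
    by auto
  obtain s where s: "r = (s, True)" using r(2) by (cases r) auto
  let ?x' = "xs s" and ?z' = "(zs s)((i\<^sub>m, Suc m) := tcur s)"
  have upd_eq: "(if g > 0 then update_minus H m else update_plus H m) = (if d = Down then update_minus H m else update_plus H m)"
    by (simp add: d_def)
  have "generate H m (x, z) = Some (?x', ?z')"
    unfolding generate_def prod.case Let_def new_arc_tail g_def[symmetric] upd_eq
      deriv_conjugate[OF smooth_strongly_convex] w_def[symmetric] s0_def[symmetric] r(1) s by simp
  moreover obtain b where "simulates d r b" using run unfolding runs_def by blast
  then have "kkt H (Suc m) ?x' ?z'" unfolding simulates_def s by simp
  moreover have "runs (generate_tm inv_cost f par la mv m (x, z)) (\<lambda>a. a = (?x', ?z')) (250 * (K + 1) * n\<^sup>2)"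
  proof -
    have wrun: "runs (invert_tm inv_cost f (Single (Suc m)) 0) (\<lambda>r. r = w) (K + 1)"
      unfolding w_def by (rule invert_run) (use f smooth_strongly_convex in auto)
    have "runs (generate_tm inv_cost f par la mv m (x, z)) (\<lambda>a. a = (?x', ?z'))
       (1 + (1 + (K + 1 + (1 + (Suc m + (length [2..<Suc m] * 2 + 1 + (((progress d (sg s0) + 1) * (?C + 1) + 1) + 1)))))))"
      unfolding generate_tm_def prod.case
    proof (rule runs_bind_step, rule runs_bind_value[where a = g], simp add: runs_def deriv_tm_def f g_def,
        rule runs_bind_value[OF wrun], rule runs_bind_step, rule runs_bind_value[OF runs_new_array_value],
        rule runs_bind_value[OF runs_for_step], fold d_def sg0_def, fold s1_def, rule runs_bind[OF run])
      fix b assume "simulates d r b"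
      then show "runs (case b of (s, _) \<Rightarrow> step (xs s, (zs s)((i\<^sub>m, Suc m) := tcur s))) (\<lambda>a. a = (?x', ?z')) 1"
        unfolding s simulates_def by (cases b) (simp add: runs_step)
    qed
    then show ?thesis
    proof (rule runs_le)
      have 1: "m + 1 \<le> n" using m by simp
      \<comment> \<open>At most \<open>2 * m + 1\<close> updates by \<open>progress_le\<close>.
        Rounding the number of updates up to \<open>2 * (m + 1)\<close> and the cost of each up to
        the factor 101 gives 202.\<close>
      have "(progress d (sg s0) + 1) * (?C + 1) \<le> (2 * (m + 1)) * ((K + 1) * 101 * (m + 1))"
      proof (intro mult_mono)
        have "1 \<le> (K + 1) * (m + 1)" by simp
        moreover have "(K + 1) * c * (m + 1) = c * ((K + 1) * (m + 1))" for c by (simp only: ac_simps)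
        ultimately show "?C + 1 \<le> (K + 1) * 101 * (m + 1)" by linarith
      qed (use progress_le[of d "sg s0"] in auto)
      also have "\<dots> = 202 * ((K + 1) * ((m + 1) * (m + 1)))" by (simp add: algebra_simps)
      finally have a: "(progress d (sg s0) + 1) * (?C + 1) \<le> 202 * ((K + 1) * ((m + 1) * (m + 1)))" .
      have b: "K + 3 * m + 10 \<le> 20 * ((K + 1) * ((m + 1) * (m + 1)))" by (simp add: algebra_simps)
      have c: "(m + 1) * (m + 1) \<le> n\<^sup>2" using mult_mono[OF 1 1] by (simp add: power2_eq_square)
      have "1 + (1 + (K + 1 + (1 + (Suc m + (length [2..<Suc m] * 2 + 1 + (((progress d (sg s0) + 1) * (?C + 1) + 1) + 1))))))
         \<le> (progress d (sg s0) + 1) * (?C + 1) + (K + 3 * m + 10)" using m by (simp del: upt_Suc mult_Suc mult_Suc_right)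
      also have "\<dots> \<le> 250 * ((K + 1) * ((m + 1) * (m + 1)))" using a b by linarith
      also have "\<dots> \<le> 250 * ((K + 1) * n\<^sup>2)" by (intro mult_le_mono order.refl c)
      finally show "1 + (1 + (K + 1 + (1 + (Suc m + (length [2..<Suc m] * 2 + 1 + (((progress d (sg s0) + 1) * (?C + 1) + 1) + 1))))))
         \<le> 250 * (K + 1) * n\<^sup>2" by (simp only: mult.assoc)
    qed
  qed
  ultimately show ?thesis by blast
qed

end

context program
begin

text \<open>The loop invariant ties the state of the program to \<open>asra_iterate\<close>, so the
  mathematical result is shown to exist along the way. The stages contribute at most 251 to the
  constant and the initialization at most 9.\<close>

lemma labelled_run:
  "\<exists>x z. asra H = Some (x, z) \<and> kkt H n x z \<and>
    runs (asra_labelled_tm inv_cost f par la mv n) (\<lambda>a. a = (x, z)) (260 * (K + 1) * n ^ 3)"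
proof -
  have ssc1: "smooth_strongly_convex (loss H 1)" using ssc_loss[of 1] n_pos by simp
  define v where "v = deriv_inv (loss H 1) 0"
  have vrun: "runs (invert_tm inv_cost f (Single 1) 0) (\<lambda>r. r = v) (K + 1)"
    unfolding v_def by (rule invert_run) (use f_loss[of 1] n_pos ssc1 in auto)
  define I where "I j a \<longleftrightarrow> asra_iterate H (j - 1) = Some a \<and> kkt H j (fst a) (snd a)" for j a
  have "sub_arcs H 1 = {}" using n_pos by (subst sub_arcs_eq) auto
  then have I1: "I 1 (\<lambda>_. v, \<lambda>_. 0)"
    using deriv_conjugate[OF ssc1, of 0] ssc1 by (simp add: I_def kkt_def outflow_def v_def)
  have loop: "runs (for_tm [1..<n] (generate_tm inv_cost f par la mv) (\<lambda>_. v, \<lambda>_. 0)) (I n)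
      ((n - 1) * (250 * (K + 1) * n\<^sup>2 + 1) + 1)"
  proof (rule runs_for_upt[where I = I])
    show "1 \<le> n" "I 1 (\<lambda>_. v, \<lambda>_. 0)" by (rule n_pos, rule I1)
    fix k a assume k: "1 \<le> k" "k < n" and a: "I k a"
    interpret stage_program H n par k inv_cost f la mv K
      using k by unfold_locales
    obtain x z where xz: "a = (x, z)" by (cases a)
    then obtain x' z' where g: "generate H k (x, z) = Some (x', z')" "kkt H (Suc k) x' z'"
      and run: "runs (generate_tm inv_cost f par la mv k a) (\<lambda>a. a = (x', z')) (250 * (K + 1) * n\<^sup>2)"
      using generate_run[of x z] a by (auto simp: I_def)
    have "I (Suc k) (x', z')" using a g k xz by (cases k) (auto simp: I_def)
    then show "runs (generate_tm inv_cost f par la mv k a) (I (Suc k)) (250 * (K + 1) * n\<^sup>2)"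
      using runs_weaken[OF run] by blast
  qed
  have "runs (asra_labelled_tm inv_cost f par la mv n) (I n)
     (K + 1 + (Suc n + (Suc n + ((n - 1) * (250 * (K + 1) * n\<^sup>2 + 1) + 1))))"
    unfolding asra_labelled_tm_def
    by (rule runs_bind_value[OF vrun], rule runs_bind_value[OF runs_new_array_value],
        rule runs_bind_value[OF runs_new_array_value], rule loop)
  moreover have "K + 1 + (Suc n + (Suc n + ((n - 1) * (250 * (K + 1) * n\<^sup>2 + 1) + 1))) \<le> 260 * (K + 1) * n ^ 3"
  proof -
    have "1 \<le> n\<^sup>2" using n_pos by simp
    also have "n\<^sup>2 \<le> (K + 1) * n\<^sup>2" by simp
    finally have "250 * (K + 1) * n\<^sup>2 + 1 \<le> 251 * ((K + 1) * n\<^sup>2)" unfolding mult.assoc by linarith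
    then have "(n - 1) * (250 * (K + 1) * n\<^sup>2 + 1) \<le> n * (251 * ((K + 1) * n\<^sup>2))"
      by (intro mult_mono) auto
    also have "\<dots> = 251 * ((K + 1) * n ^ 3)" by (simp add: power2_eq_square power3_eq_cube algebra_simps)
    finally have 1: "(n - 1) * (250 * (K + 1) * n\<^sup>2 + 1) \<le> 251 * ((K + 1) * n ^ 3)" .
    have "n \<le> n ^ 3" using n_pos by (simp add: self_le_power)
    moreover have "n ^ 3 \<le> (K + 1) * n ^ 3" by simp
    moreover have n3: "1 \<le> n ^ 3" using n_pos by simp
    moreover have "K + 1 \<le> (K + 1) * n ^ 3" using mult_le_mono2[OF n3, of "K + 1"] by simp
    ultimately have "K + 1 + (Suc n + (Suc n + 1)) \<le> 9 * ((K + 1) * n ^ 3)" by linarith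
    with 1 have "K + 1 + (Suc n + (Suc n + ((n - 1) * (250 * (K + 1) * n\<^sup>2 + 1) + 1))) \<le> 260 * ((K + 1) * n ^ 3)"
      by linarith
    then show ?thesis by (simp only: mult.assoc)
  qed
  ultimately have run: "runs (asra_labelled_tm inv_cost f par la mv n) (I n) (260 * (K + 1) * n ^ 3)"
    by (rule runs_le)
  obtain a where a: "I n a" using run unfolding runs_def by blast
  have "asra H = Some a" using a nodes_H by (simp add: asra_def I_def)
  moreover have "runs (asra_labelled_tm inv_cost f par la mv n) (\<lambda>b. b = a) (260 * (K + 1) * n ^ 3)"
    using a by (intro runs_weaken[OF run]) (auto simp: I_def)
  ultimately show ?thesis using a by (cases a) (auto simp: I_def)
qed

end

section \<open>Optimality of Karush-Kuhn-Tucker points by duality\<close>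

section \<open>Optimality\<close>

text \<open>As a function of the difference \<open>a\<close>, the cost of an arc is convex and
  positively homogeneous; its linear minorants are those with slope between \<open>- u\<close> and
  \<open>l\<close>, and \<open>- z\<close> is such a slope.\<close>

lemma arc_cost_ge:
  fixes l u :: ereal
  assumes "- l \<le> ereal z" "ereal z \<le> u" "0 \<le> l" "0 \<le> u"
  shows "ereal (- z * a) \<le> l * ereal (max 0 a) + u * ereal (max 0 (- a))"
proof (cases "a \<ge> 0")
  case True
  have "ereal (- z) \<le> l" using assms(1) by (metis ereal_uminus_le_reorder uminus_ereal.simps(1))
  then have "ereal (- z) * ereal a \<le> l * ereal a" using True by (intro ereal_mult_right_mono) auto
  then show ?thesis using True by (simp add: max_def flip: zero_ereal_def)
next
  case False
  then have "ereal z * ereal (- a) \<le> u * ereal (- a)" using assms(2) by (intro ereal_mult_right_mono) auto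
  then show ?thesis using False by (simp add: max_def flip: zero_ereal_def)
qed

lemma arc_ok_bounds:
  assumes "arc_ok l u sn a b z" "l \<le> 0" "0 \<le> u" shows "l \<le> ereal z" "ereal z \<le> u"
  using assms by (cases sn; auto simp: arc_ok_def intro: order_trans)+

text \<open>Complementary slackness makes the linear minorant exact. For equal values the convention
  that infinity times 0 is 0 covers infinite weights.\<close>

lemma arc_cost_eq:
  assumes "arc_ok (- l) u sn a b z" "0 \<le> l" "0 \<le> u"
  shows "l * ereal (max 0 (a - b)) + u * ereal (max 0 (b - a)) = ereal (- z * (a - b))"
proof (cases sn)
  case GT
  then have "l = ereal (- z)" "b \<le> a" using assms(1) by (auto simp: arc_ok_def) (metis ereal_uminus_uminus uminus_ereal.simps(1))
  then show ?thesis by (simp add: max_def flip: zero_ereal_def)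
next
  case LT
  then have "u = ereal z" "a \<le> b" using assms(1) by (auto simp: arc_ok_def)
  then show ?thesis by (simp add: max_def algebra_simps flip: zero_ereal_def)
next
  case EQ
  then have "a = b" using assms(1) by (simp add: arc_ok_def)
  then show ?thesis by (simp flip: zero_ereal_def)
qed

context labelled
begin

lemma arcs_eq: "sub_arcs H n = arcs H"
  using sub_arcs_eq[of n] arcs_H by simp

lemma finite_arcs: "finite (arcs H)"
  unfolding arcs_H by simp

lemma arc_range: "e \<in> arcs H \<Longrightarrow> fst e \<in> {1..n} \<and> snd e \<in> {1..n}"
  using par unfolding arcs_H by force

definition arc_cost :: "(nat \<Rightarrow> real) \<Rightarrow> nat \<times> nat \<Rightarrow> ereal" where
  "arc_cost x e = lam H e * ereal (max 0 (x (fst e) - x (snd e)))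
     + mu H e * ereal (max 0 (x (snd e) - x (fst e)))"

lemma objective_eq: "objective H x = ereal (\<Sum>i\<in>{1..n}. loss H i (x i)) + (\<Sum>e\<in>arcs H. arc_cost x e)"
  unfolding objective_def nodes_H arc_cost_def sum.distrib
  by (simp add: case_prod_beta add.assoc)

text \<open>Summation by parts on the graph: the net outflow is the adjoint of taking differences
  along arcs.\<close>

lemma sum_outflow:
  "(\<Sum>k\<in>{1..n}. outflow (arcs H) z k * c k) = (\<Sum>e\<in>arcs H. z e * (c (fst e) - c (snd e)))"
proof -
  have *: "(\<Sum>k\<in>{1..n}. (\<Sum>e\<in>{e \<in> arcs H. h e = k}. z e * c (h e))) = (\<Sum>e\<in>arcs H. z e * c (h e))"
    if "h ` arcs H \<subseteq> {1..n}" for h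
    using that finite_arcs by (intro sum.group) auto
  have d: "sum z {e \<in> arcs H. h e = k} * c k = (\<Sum>e\<in>{e \<in> arcs H. h e = k}. z e * c (h e))" for h k
    unfolding sum_distrib_right by (rule sum.cong) auto
  have "(\<Sum>k\<in>{1..n}. outflow (arcs H) z k * c k)
      = (\<Sum>k\<in>{1..n}. (\<Sum>e\<in>{e \<in> arcs H. fst e = k}. z e * c (fst e)) - (\<Sum>e\<in>{e \<in> arcs H. snd e = k}. z e * c (snd e)))"
    unfolding outflow_def left_diff_distrib d ..
  also have "\<dots> = (\<Sum>e\<in>arcs H. z e * c (fst e)) - (\<Sum>e\<in>arcs H. z e * c (snd e))"
  proof -
    have "fst ` arcs H \<subseteq> {1..n}" "snd ` arcs H \<subseteq> {1..n}" using arc_range by blast+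
    from this[THEN *] show ?thesis unfolding sum_subtractf by simp
  qed
  finally show ?thesis by (simp add: right_diff_distrib sum_subtractf)
qed

text \<open>The objective at \<open>y\<close> is bounded below by tangents at the nodes and linear
  minorants on the arcs, all exact at \<open>x\<close>. Their linear parts cancel by
  \<open>sum_outflow\<close>, because the derivatives are the net outflows of
  \<open>z\<close>.\<close>

lemma kkt_minimizer:
  assumes "kkt H n x z" shows "is_minimizer H x"
  unfolding is_minimizer_def
proof
  fix y :: "nat \<Rightarrow> real"
  have w: "0 \<le> lam H e \<and> 0 \<le> mu H e" if "e \<in> arcs H" for e
    using that weights unfolding arcs_H by auto
  let ?p = "\<lambda>x e. - z e * (x (fst e) - x (snd e))"
  have opt: "\<exists>sn. arc_opt H x z sn e" if "e \<in> arcs H" for e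
    using assms that unfolding kkt_def arcs_eq by blast
  have eq: "arc_cost x e = ereal (?p x e)" if e: "e \<in> arcs H" for e
  proof -
    obtain sn where "arc_opt H x z sn e" using opt[OF e] by blast
    then show ?thesis unfolding arc_opt_def arc_cost_def
      by (rule arc_cost_eq) (use w[OF e] in blast)+
  qed
  have ge: "ereal (?p y e) \<le> arc_cost y e" if e: "e \<in> arcs H" for e
  proof -
    obtain sn where "arc_ok (- lam H e) (mu H e) sn (x (fst e)) (x (snd e)) (z e)"
      using opt[OF e] unfolding arc_opt_def by blast
    then have "- lam H e \<le> ereal (z e)" "ereal (z e) \<le> mu H e"
      using arc_ok_bounds w[OF e] by (auto simp: ereal_uminus_le_reorder)
    then show ?thesis using arc_cost_ge[of "lam H e" "z e" "mu H e" "y (fst e) - y (snd e)"] w[OF e]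
      by (simp add: arc_cost_def)
  qed
  have "(\<Sum>i\<in>{1..n}. loss H i (x i)) + (\<Sum>e\<in>arcs H. ?p x e)
      = (\<Sum>i\<in>{1..n}. loss H i (x i) + deriv (loss H i) (x i) * (y i - x i)) + (\<Sum>e\<in>arcs H. ?p y e)"
  proof -
    have "(\<Sum>i\<in>{1..n}. deriv (loss H i) (x i) * (y i - x i)) = (\<Sum>i\<in>{1..n}. outflow (arcs H) z i * (y i - x i))"
      using assms unfolding kkt_def arcs_eq by (intro sum.cong) auto
    also have "\<dots> = (\<Sum>e\<in>arcs H. ?p x e) - (\<Sum>e\<in>arcs H. ?p y e)"
      unfolding sum_outflow sum_subtractf[symmetric] by (intro sum.cong) (auto simp: algebra_simps)
    finally show ?thesis by (simp add: sum.distrib)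
  qed
  also have "\<dots> \<le> (\<Sum>i\<in>{1..n}. loss H i (y i)) + (\<Sum>e\<in>arcs H. ?p y e)"
    using ssc_tangent ssc_loss by (intro add_right_mono sum_mono) auto
  finally have main: "(\<Sum>i\<in>{1..n}. loss H i (x i)) + (\<Sum>e\<in>arcs H. ?p x e)
      \<le> (\<Sum>i\<in>{1..n}. loss H i (y i)) + (\<Sum>e\<in>arcs H. ?p y e)" .
  have "objective H x = ereal ((\<Sum>i\<in>{1..n}. loss H i (x i)) + (\<Sum>e\<in>arcs H. ?p x e))"
  proof -
    have "(\<Sum>e\<in>arcs H. arc_cost x e) = (\<Sum>e\<in>arcs H. ereal (?p x e))" by (intro sum.cong refl eq)
    then show ?thesis unfolding objective_eq by (simp only: sum_ereal plus_ereal.simps)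
  qed
  also have "\<dots> \<le> ereal (\<Sum>i\<in>{1..n}. loss H i (y i)) + (\<Sum>e\<in>arcs H. ereal (?p y e))"
    using main by (simp only: sum_ereal plus_ereal.simps ereal_less_eq)
  also have "\<dots> \<le> objective H y"
    unfolding objective_eq using ge by (intro add_left_mono sum_mono)
  finally show "objective H x \<le> objective H y" .
qed

end

section \<open>The computed labelling normalizes the problem and preserves its minimizers\<close>

section \<open>Normalization\<close>

lemma successively_crossing:
  assumes "successively P p" "p \<noteq> []" "hd p \<in> L" "last p \<notin> L"
  shows "\<exists>x y. P x y \<and> x \<in> L \<and> y \<notin> L"
  using assms
proof (induction p rule: induct_list012)
  case (3 x y p)
  then show ?case by (cases "y \<in> L") auto
qed auto

text \<open>Induction on the number of labels. Keeping paths inside the first \<open>j\<close>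
  labels makes them stay distinct when the next node is attached to its parent, and lets
  \<open>adjacent_label\<close> avoid the node \<open>b\<close>.\<close>

lemma parent_paths:
  fixes par :: "nat \<Rightarrow> nat"
  assumes par: "\<And>k. 2 \<le> k \<Longrightarrow> k \<le> j \<Longrightarrow> 1 \<le> par k \<and> par k < k"
    and xy: "x \<in> {1..j}" "y \<in> {1..j}"
  shows "\<exists>p. undirected_path {(par k, k) |k. 2 \<le> k \<and> k \<le> j} x p y \<and> set p \<subseteq> {1..j}"
  using assms
proof (induction j arbitrary: x y)
  case (Suc j)
  let ?E = "\<lambda>j. {(par k, k) |k. 2 \<le> k \<and> k \<le> j}"
  have mono: "undirected_path (?E (Suc j)) x p y" if "undirected_path (?E j) x p y" for x p y
    using that unfolding undirected_path_def
    by (auto elim!: successively_mono simp: adjacent_def)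
  have IH: "\<exists>p. undirected_path (?E (Suc j)) x p y \<and> set p \<subseteq> {1..j}" if "x \<in> {1..j}" "y \<in> {1..j}" for x y
    using Suc.IH[OF Suc.prems(1) that] mono by fastforce
  have single: "undirected_path (?E (Suc j)) x [x] x" for x by (simp add: undirected_path_def)
  have adj: "adjacent (?E (Suc j)) (par (Suc j)) (Suc j)" "adjacent (?E (Suc j)) (Suc j) (par (Suc j))"
    and p: "par (Suc j) \<in> {1..j}" if "1 \<le> j"
    using that Suc.prems(1)[of "Suc j"] by (auto simp: adjacent_def)
  consider "x = y" | "x \<in> {1..j}" "y \<in> {1..j}" | "x \<in> {1..j}" "y = Suc j" | "x = Suc j" "y \<in> {1..j}"
    using Suc.prems(2,3) by (auto simp: le_Suc_eq)
  then show ?case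
  proof cases
    case 1
    then show ?thesis using single Suc.prems(2) by (intro exI[of _ "[x]"]) auto
  next
    case 2
    then show ?thesis using IH by fastforce
  next
    case 3
    then have j: "1 \<le> j" by simp
    obtain q where q: "undirected_path (?E (Suc j)) x q (par (Suc j))" "set q \<subseteq> {1..j}" using IH 3 p[OF j] by blast
    then have "Suc j \<notin> set q" by auto
    then have "undirected_path (?E (Suc j)) x (q @ [Suc j]) y"
      using q adj[OF j] 3 unfolding undirected_path_def by (simp add: successively_append_iff)
    then show ?thesis using q(2) by (intro exI[of _ "q @ [Suc j]"]) auto
  next
    case 4
    then have j: "1 \<le> j" by simp
    obtain q where q: "undirected_path (?E (Suc j)) (par (Suc j)) q y" "set q \<subseteq> {1..j}" using IH 4 p[OF j] by blast
    then have "Suc j \<notin> set q" by auto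
    then have "undirected_path (?E (Suc j)) x (Suc j # q) y"
      using q adj[OF j] 4 unfolding undirected_path_def by (cases q) auto
    then show ?thesis using q(2) by (intro exI[of _ "Suc j # q"]) auto
  qed
qed simp

locale listed_problem =
  fixes G :: tree_problem and vs :: "nat list" and es :: "(nat \<times> nat) list"
  assumes wf: "wf_problem G" and vs: "distinct vs" "set vs = nodes G"
    and es: "distinct es" "set es = arcs G"
begin

abbreviation n :: nat where "n \<equiv> length vs"

lemma tree: "directed_tree (nodes G) (arcs G)"
  using wf by (simp add: wf_problem_def)

lemma card_nodes: "card (nodes G) = n"
  using vs distinct_card by metis

lemma n_pos: "1 \<le> n"
  using tree vs unfolding directed_tree_def by (cases vs) auto

lemma hd_node: "hd vs \<in> nodes G"
  using n_pos vs by (cases vs) auto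

definition labelling :: "nat \<Rightarrow> (nat \<Rightarrow> nat) \<Rightarrow> (nat \<Rightarrow> nat) \<Rightarrow> (nat \<times> nat \<Rightarrow> ereal)
    \<Rightarrow> (nat \<times> nat \<Rightarrow> ereal) \<Rightarrow> bool" where
  "labelling m nu par la mv \<longleftrightarrow> inj_on nu {1..m} \<and> nu ` {1..m} \<subseteq> nodes G \<and>
     (\<forall>k\<in>{2..m}. 1 \<le> par k \<and> par k < k \<and>
        ((nu (par k), nu k) \<in> arcs G \<and> la (par k, k) = lam G (nu (par k), nu k) \<and> mv (par k, k) = mu G (nu (par k), nu k) \<or>
         (nu k, nu (par k)) \<in> arcs G \<and> la (par k, k) = mu G (nu k, nu (par k)) \<and> mv (par k, k) = lam G (nu k, nu (par k))))"

definition labels :: "nat \<Rightarrow> (nat \<Rightarrow> nat) \<Rightarrow> (nat \<Rightarrow> nat) \<Rightarrow> bool" where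
  "labels m lab nu \<longleftrightarrow> (\<forall>k\<in>{1..m}. lab (nu k) = k) \<and> (\<forall>v\<in>nodes G - nu ` {1..m}. lab v = 0)"

lemma arc_nodes: "(a, b) \<in> arcs G \<Longrightarrow> a \<in> nodes G \<and> b \<in> nodes G"
  using tree unfolding directed_tree_def by blast

lemma labels_iff: "labels m lab nu \<Longrightarrow> v \<in> nodes G \<Longrightarrow> lab v \<noteq> 0 \<longleftrightarrow> v \<in> nu ` {1..m}"
proof -
  assume l: "labels m lab nu" and v: "v \<in> nodes G"
  show "lab v \<noteq> 0 \<longleftrightarrow> v \<in> nu ` {1..m}"
  proof (cases "v \<in> nu ` {1..m}")
    case True
    then obtain k where "k \<in> {1..m}" "v = nu k" by blast
    then show ?thesis using l True unfolding labels_def by auto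
  next
    case False
    then show ?thesis using l v unfolding labels_def by auto
  qed
qed

text \<open>A path to an unlabelled node, which exists by connectedness, must leave the set of
  labelled nodes; so the search for the next arc always succeeds.\<close>

lemma crossing_arc:
  assumes lb: "labelling m nu par la mv" "labels m lab nu" and m: "1 \<le> m" "m < n"
  shows "\<exists>(a, b)\<in>set es. (lab a = 0) \<noteq> (lab b = 0)"
proof -
  let ?L = "nu ` {1..m}"
  have "card ?L = m" using lb(1) by (simp add: labelling_def card_image)
  then have "?L \<noteq> nodes G" using m card_nodes by auto
  then obtain v where v: "v \<in> nodes G" "v \<notin> ?L" using lb(1) unfolding labelling_def by blast
  have u: "nu 1 \<in> ?L" "nu 1 \<in> nodes G" using lb(1) m unfolding labelling_def by auto
  obtain p where p: "undirected_path (arcs G) (nu 1) p v"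
    using tree u v unfolding directed_tree_def by blast
  then obtain x y where xy: "adjacent (arcs G) x y" "x \<in> ?L" "y \<notin> ?L"
    using successively_crossing[of "adjacent (arcs G)" p ?L] u v unfolding undirected_path_def by auto
  then have "x \<in> nodes G" "y \<in> nodes G" using arc_nodes unfolding adjacent_def by blast+
  then have "lab x \<noteq> 0" "lab y = 0" using labels_iff[OF lb(2)] xy by auto
  moreover have "(x, y) \<in> set es \<or> (y, x) \<in> set es" using xy(1) es(2) unfolding adjacent_def by blast
  ultimately show ?thesis
    by (elim disjE) (rule bexI[of _ "(x, y)"], simp, assumption, rule bexI[of _ "(y, x)"], simp, assumption)
qed

lemma find_run:
  "runs (for_tm es (\<lambda>(a, b) r. step
         (if r = None \<and> (lab a = 0) \<noteq> (lab b = 0) then Some (a, b) else r)) None)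
    (\<lambda>r. case r of None \<Rightarrow> \<forall>(a, b)\<in>set es. (lab a = 0) = (lab b = 0)
       | Some (a, b) \<Rightarrow> (a, b) \<in> set es \<and> (lab a = 0) \<noteq> (lab b = 0)) (length es * (1 + 1) + 1)"
proof (rule runs_for_invariant[where I = "\<lambda>pre r. case r of None \<Rightarrow> \<forall>(a, b)\<in>set pre. (lab a = 0) = (lab b = 0)
       | Some (a, b) \<Rightarrow> (a, b) \<in> set es \<and> (lab a = 0) \<noteq> (lab b = 0)"])
  fix pre e post r
  assume es: "es = pre @ e # post" and r: "case r of None \<Rightarrow> \<forall>(a, b)\<in>set pre. (lab a = 0) = (lab b = 0)
       | Some (a, b) \<Rightarrow> (a, b) \<in> set es \<and> (lab a = 0) \<noteq> (lab b = 0)"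
  obtain a b where e: "e = (a, b)" by (cases e)
  then have "(a, b) \<in> set es" using es by simp
  then show "runs ((\<lambda>(a, b) r. step (if r = None \<and> (lab a = 0) \<noteq> (lab b = 0) then Some (a, b) else r)) e r)
    (\<lambda>r. case r of None \<Rightarrow> \<forall>(a, b)\<in>set (pre @ [e]). (lab a = 0) = (lab b = 0)
       | Some (a, b) \<Rightarrow> (a, b) \<in> set es \<and> (lab a = 0) \<noteq> (lab b = 0)) 1"
    using r unfolding e prod.case
    by (cases r; cases "(lab a = 0) = (lab b = 0)") (auto simp: runs_def step_def simp del: neq0_conv)
qed simp

lemma extend_labelling:
  assumes lb: "labelling m nu par la mv" "labels m lab nu" and m: "1 \<le> m"
    and v: "v \<in> nodes G" "lab v = 0" and u: "u \<in> nodes G" "lab u \<noteq> 0"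
    and arc: "(u, v) \<in> arcs G \<and> l = lam G (u, v) \<and> w = mu G (u, v) \<or> (v, u) \<in> arcs G \<and> l = mu G (v, u) \<and> w = lam G (v, u)"
  shows "labelling (Suc m) (nu(Suc m := v)) (par(Suc m := lab u)) (la((lab u, Suc m) := l)) (mv((lab u, Suc m) := w))"
    and "labels (Suc m) (lab(v := Suc m)) (nu(Suc m := v))"
proof -
  obtain k where k: "k \<in> {1..m}" "u = nu k" "lab u = k"
    using labels_iff[OF lb(2) u(1)] u(2) lb(2) unfolding labels_def by auto
  have vn: "v \<notin> nu ` {1..m}" using labels_iff[OF lb(2) v(1)] v(2) by simp
  have S: "{1..Suc m} = insert (Suc m) {1..m}" by auto
  have img: "(nu(Suc m := v)) ` {1..m} = nu ` {1..m}" by (intro image_cong) auto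
  have "inj_on (nu(Suc m := v)) {1..m}" using lb(1) unfolding labelling_def
    by (subst inj_on_cong[of _ _ nu]) auto
  then have inj: "inj_on (nu(Suc m := v)) {1..Suc m}" unfolding S using vn img by (auto simp: inj_on_insert)
  show "labelling (Suc m) (nu(Suc m := v)) (par(Suc m := lab u)) (la((lab u, Suc m) := l)) (mv((lab u, Suc m) := w))"
    unfolding labelling_def
  proof (intro conjI ballI inj)
    show "(nu(Suc m := v)) ` {1..Suc m} \<subseteq> nodes G" unfolding S using lb(1) v img by (auto simp: labelling_def)
    fix j assume j: "j \<in> {2..Suc m}"
    let ?nu = "nu(Suc m := v)" and ?par = "par(Suc m := lab u)"
    have old: "j \<le> m \<Longrightarrow> 1 \<le> par j \<and> par j < j" using lb(1) j unfolding labelling_def by auto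
    show "1 \<le> ?par j" "?par j < j" using old k j by (auto simp: le_Suc_eq)
    show "(?nu (?par j), ?nu j) \<in> arcs G \<and> (la((lab u, Suc m) := l)) (?par j, j) = lam G (?nu (?par j), ?nu j) \<and>
         (mv((lab u, Suc m) := w)) (?par j, j) = mu G (?nu (?par j), ?nu j) \<or>
       (?nu j, ?nu (?par j)) \<in> arcs G \<and> (la((lab u, Suc m) := l)) (?par j, j) = mu G (?nu j, ?nu (?par j)) \<and>
         (mv((lab u, Suc m) := w)) (?par j, j) = lam G (?nu j, ?nu (?par j))"
    proof (cases "j = Suc m")
      case True
      then show ?thesis using k arc by simp
    next
      case False
      then have "j \<in> {2..m}" "par j \<noteq> Suc m" using j old by auto
      then show ?thesis using lb(1) False unfolding labelling_def by simp
    qed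
  qed
  have "nu j \<noteq> v" if "j \<in> {1..m}" for j using vn that by blast
  then have 1: "(lab(v := Suc m)) ((nu(Suc m := v)) j) = j" if "j \<in> {1..Suc m}" for j
    using lb(2) that unfolding labels_def by (cases "j = Suc m") auto
  have img': "(nu(Suc m := v)) ` {1..Suc m} = insert v (nu ` {1..m})" unfolding S image_insert img by simp
  show "labels (Suc m) (lab(v := Suc m)) (nu(Suc m := v))"
    unfolding labels_def img' using 1 lb(2) unfolding labels_def by (intro conjI ballI) auto
qed

lemma labelling_run:
  "runs (normalize_tm (lam G) (mu G) vs es) (\<lambda>(nu, par, la, mv). labelling n nu par la mv)
    (5 * Suc n + ((n - 1) * (length es * 2 + 3) + 3))"
proof -
  define I where "I m a \<longleftrightarrow> (case a of (lab, nu, par, la, mv) \<Rightarrow> labelling m nu par la mv \<and> labels m lab nu)" for m a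
  define st where "st m r a = (case a of (lab, nu, par, la, mv) \<Rightarrow> case r of None \<Rightarrow> (lab, nu, par, la, mv)
         | Some (a, b) \<Rightarrow>
             if lab b = 0 then
               (lab(b := Suc m), nu(Suc m := b), par(Suc m := lab a),
                la((lab a, Suc m) := lam G (a, b)), mv((lab a, Suc m) := mu G (a, b)))
             else
               (lab(a := Suc m), nu(Suc m := a), par(Suc m := lab b),
                la((lab b, Suc m) := mu G (a, b)), mv((lab b, Suc m) := lam G (a, b))))"
    for m r and a :: "(nat \<Rightarrow> nat) \<times> (nat \<Rightarrow> nat) \<times> (nat \<Rightarrow> nat) \<times> (nat \<times> nat \<Rightarrow> ereal) \<times> (nat \<times> nat \<Rightarrow> ereal)"
  have loop: "runs (for_tm [1..<n] (\<lambda>m (lab, nu, par, la, mv). do {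
       r \<leftarrow> for_tm es (\<lambda>(a, b) r. step
         (if r = None \<and> (lab a = 0) \<noteq> (lab b = 0) then Some (a, b) else r)) None;
       step (case r of None \<Rightarrow> (lab, nu, par, la, mv)
         | Some (a, b) \<Rightarrow>
             if lab b = 0 then
               (lab(b := Suc m), nu(Suc m := b), par(Suc m := lab a),
                la((lab a, Suc m) := lam G (a, b)), mv((lab a, Suc m) := mu G (a, b)))
             else
               (lab(a := Suc m), nu(Suc m := a), par(Suc m := lab b),
                la((lab b, Suc m) := mu G (a, b)), mv((lab b, Suc m) := lam G (a, b))))
       }) ((\<lambda>_. 0)(hd vs := 1), \<lambda>_. hd vs, \<lambda>_. 0, \<lambda>_. 0, \<lambda>_. 0)) (I n)
      ((n - 1) * ((length es * (1 + 1) + 1) + 1 + 1) + 1)"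
  proof (rule runs_for_upt[OF n_pos, where I = I])
    show "I 1 ((\<lambda>_. 0)(hd vs := 1), \<lambda>_. hd vs, \<lambda>_. 0, \<lambda>_. 0, \<lambda>_. 0)"
      using hd_node by (auto simp: I_def labelling_def labels_def)
    fix m a assume m: "1 \<le> m" "m < n" and a: "I m a"
    obtain lab nu par la mv where eq: "a = (lab, nu, par, la, mv)" by (cases a)
    have lb: "labelling m nu par la mv" "labels m lab nu" using a by (auto simp: I_def eq)
    have "I (Suc m) (st m r a)"
      if r: "case r of None \<Rightarrow> \<forall>(a, b)\<in>set es. (lab a = 0) = (lab b = 0)
       | Some (a, b) \<Rightarrow> (a, b) \<in> set es \<and> (lab a = 0) \<noteq> (lab b = 0)" for r
    proof (cases r)
      case None
      then show ?thesis using r crossing_arc[OF lb m] by auto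
    next
      case (Some e)
      obtain c e' where e: "e = (c, e')" by (cases e)
      then have ce: "(c, e') \<in> arcs G" "(lab c = 0) \<noteq> (lab e' = 0)" using r Some es(2) by auto
      note V = arc_nodes[OF ce(1)]
      show ?thesis
      proof (cases "lab e' = 0")
        case True
        then have "lab c \<noteq> 0" using ce by simp
        then show ?thesis using Some e True extend_labelling[OF lb m(1), of e' c "lam G (c, e')" "mu G (c, e')"] V ce(1)
          by (simp add: I_def st_def eq)
      next
        case False
        then have "lab c = 0" using ce by simp
        then show ?thesis using Some e False extend_labelling[OF lb m(1), of c e' "mu G (c, e')" "lam G (c, e')"] V ce(1)
          by (simp add: I_def st_def eq)
      qed
    qed
    then show "runs (case a of (lab, nu, par, la, mv) \<Rightarrow> do {
       r \<leftarrow> for_tm es (\<lambda>(a, b) r. step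
         (if r = None \<and> (lab a = 0) \<noteq> (lab b = 0) then Some (a, b) else r)) None;
       step (case r of None \<Rightarrow> (lab, nu, par, la, mv)
         | Some (a, b) \<Rightarrow>
             if lab b = 0 then
               (lab(b := Suc m), nu(Suc m := b), par(Suc m := lab a),
                la((lab a, Suc m) := lam G (a, b)), mv((lab a, Suc m) := mu G (a, b)))
             else
               (lab(a := Suc m), nu(Suc m := a), par(Suc m := lab b),
                la((lab b, Suc m) := mu G (a, b)), mv((lab b, Suc m) := lam G (a, b))))
       }) (I (Suc m)) (length es * (1 + 1) + 1 + 1)"
      unfolding eq prod.case by (intro runs_bind[OF find_run]) (simp add: st_def runs_def step_def)
  qed
  have "runs (normalize_tm (lam G) (mu G) vs es) (\<lambda>(nu, par, la, mv). labelling n nu par la mv)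
    (Suc n + (1 + (Suc n + (Suc n + (Suc n + (Suc n + ((n - 1) * ((length es * (1 + 1) + 1) + 1 + 1) + 1 + 1)))))))"
    unfolding normalize_tm_def
    apply (rule runs_bind_value[OF runs_new_array_value])
    apply (rule runs_bind_step)
    apply (rule runs_bind_value[OF runs_new_array_value])+
    apply (rule runs_bind[OF loop])
    apply (auto simp: I_def runs_def step_def)
    done
  then show ?thesis by (rule runs_le) (simp add: algebra_simps)
qed

end

locale labelled_problem = listed_problem +
  fixes nu par :: "nat \<Rightarrow> nat" and la mv :: "nat \<times> nat \<Rightarrow> ereal"
  assumes labelling: "labelling n nu par la mv"
begin

lemma nu_inj: "i \<in> {1..n} \<Longrightarrow> j \<in> {1..n} \<Longrightarrow> nu i = nu j \<longleftrightarrow> i = j"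
  using labelling unfolding labelling_def inj_on_def by blast

lemma nu_image: "nu ` {1..n} = nodes G"
proof (rule card_subset_eq)
  show "finite (nodes G)" using tree by (simp add: directed_tree_def)
  show "nu ` {1..n} \<subseteq> nodes G" using labelling by (simp add: labelling_def)
  show "card (nu ` {1..n}) = card (nodes G)"
    using labelling card_nodes by (simp add: labelling_def card_image)
qed

lemma bij_nu: "bij_betw nu {1..n} (nodes G)"
  using nu_image labelling by (simp add: bij_betw_def labelling_def)

lemma par_n: "2 \<le> k \<Longrightarrow> k \<le> n \<Longrightarrow> 1 \<le> par k \<and> par k < k"
  using labelling by (simp add: labelling_def)

lemma adjacent_par: "2 \<le> k \<Longrightarrow> k \<le> n \<Longrightarrow> adjacent (arcs G) (nu (par k)) (nu k)"
  using labelling unfolding labelling_def adjacent_def by auto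

lemma adjacent_commute: "adjacent E u v \<longleftrightarrow> adjacent E v u"
  by (auto simp: adjacent_def)

lemma map_path:
  assumes p: "undirected_path {(par k, k) |k. 2 \<le> k \<and> k \<le> j} x p y" "set p \<subseteq> {1..j}" and j: "j \<le> n"
  shows "undirected_path (arcs G) (nu x) (map nu p) (nu y)"
proof -
  have "successively (adjacent (arcs G)) (map nu p)"
    unfolding successively_map
  proof (rule successively_mono)
    show "successively (adjacent {(par k, k) |k. 2 \<le> k \<and> k \<le> j}) p" using p(1) by (simp add: undirected_path_def)
    show "adjacent (arcs G) (nu a) (nu b)" if adj: "adjacent {(par k, k) |k. 2 \<le> k \<and> k \<le> j} a b" for a b
    proof -
      obtain k where k: "2 \<le> k" "k \<le> n" "a = par k \<and> b = k \<or> a = k \<and> b = par k"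
        using adj j unfolding adjacent_def by fastforce
      then show ?thesis using adjacent_par[of k] adjacent_commute by blast
    qed
  qed
  moreover have "inj_on nu (set p)"
    using p(2) j labelling unfolding labelling_def by (auto elim!: inj_on_subset)
  ultimately show ?thesis using p unfolding undirected_path_def by (simp add: distinct_map hd_map last_map)
qed

text \<open>A second labelled neighbour of a node would close a cycle.\<close>

lemma adjacent_label:
  assumes ab: "1 \<le> a" "a < b" "b \<le> n" and adj: "adjacent (arcs G) (nu a) (nu b)"
  shows "a = par b"
proof (rule ccontr)
  assume ne: "a \<noteq> par b"
  have b: "2 \<le> b" "b - 1 \<le> n" using ab by auto
  have "\<exists>p. undirected_path {(par k, k) |k. 2 \<le> k \<and> k \<le> b - 1} (par b) p a \<and> set p \<subseteq> {1..b - 1}"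
  proof (rule parent_paths)
    show "1 \<le> par k \<and> par k < k" if "2 \<le> k" "k \<le> b - 1" for k using that par_n[of k] ab by simp
    show "par b \<in> {1..b - 1}" "a \<in> {1..b - 1}" using par_n[of b] b ab by auto
  qed
  then obtain p where p: "undirected_path {(par k, k) |k. 2 \<le> k \<and> k \<le> b - 1} (par b) p a" "set p \<subseteq> {1..b - 1}"
    by blast
  then have q: "undirected_path (arcs G) (nu (par b)) (map nu p) (nu a)" using map_path b by blast
  \<comment> \<open>The ends of the path differ, so together with \<open>nu b\<close> it has the
    three nodes required of a cycle.\<close>
  have len: "2 \<le> length p" using p(1) ne unfolding undirected_path_def
    by (cases p; cases "tl p") auto
  have "nu b \<notin> set (map nu p)"
  proof
    assume "nu b \<in> set (map nu p)"
    then obtain c where c: "c \<in> {1..b - 1}" "nu b = nu c" using p(2) by auto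
    then have "c \<in> {1..n}" "c < b" using ab b by auto
    then show False using nu_inj[of b c] ab c(2) by auto
  qed
  then have "undirected_cycle (arcs G) (map nu p @ [nu b])"
    using q len adj adjacent_par[OF b(1) ab(3)] adjacent_commute[of "arcs G" "nu b"] p(1)
    unfolding undirected_cycle_def undirected_path_def by (auto simp: successively_append_iff)
  then show False using tree unfolding directed_tree_def by blast
qed

abbreviation N :: tree_problem where "N \<equiv> normalized G nu"

lemma N_simps: "nodes N = {1..n}" "loss N i = loss G (nu i)"
  "lam N (i, j) = (if (nu i, nu j) \<in> arcs G then lam G (nu i, nu j) else mu G (nu j, nu i))"
  "mu N (i, j) = (if (nu i, nu j) \<in> arcs G then mu G (nu i, nu j) else lam G (nu j, nu i))"
  by (simp_all add: normalized_def card_nodes)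

lemma arcs_N: "arcs N = {(par k, k) |k. 2 \<le> k \<and> k \<le> n}"
proof -
  have "arcs N = {(i, j). i \<in> {1..n} \<and> j \<in> {1..n} \<and> i < j \<and> adjacent (arcs G) (nu i) (nu j)}"
    by (simp add: normalized_def card_nodes)
  also have "\<dots> = {(par k, k) |k. 2 \<le> k \<and> k \<le> n}"
    using adjacent_label adjacent_par par_n by fastforce
  finally show ?thesis .
qed

lemma no_reverse: "(a, b) \<in> arcs G \<Longrightarrow> (b, a) \<notin> arcs G"
  using tree unfolding directed_tree_def by blast

lemma weights_N:
  assumes "2 \<le> k" "k \<le> n"
  shows "la (par k, k) = lam N (par k, k)" "mv (par k, k) = mu N (par k, k)"
    and "0 \<le> lam N (par k, k) \<and> 0 \<le> mu N (par k, k)"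
proof -
  have k: "(nu (par k), nu k) \<in> arcs G \<and> la (par k, k) = lam G (nu (par k), nu k) \<and> mv (par k, k) = mu G (nu (par k), nu k) \<or>
         (nu k, nu (par k)) \<in> arcs G \<and> la (par k, k) = mu G (nu k, nu (par k)) \<and> mv (par k, k) = lam G (nu k, nu (par k))"
    using labelling assms unfolding labelling_def by auto
  then show "la (par k, k) = lam N (par k, k)" "mv (par k, k) = mu N (par k, k)"
    using no_reverse by (auto simp: N_simps)
  have "\<forall>e\<in>arcs G. 0 \<le> lam G e \<and> 0 \<le> mu G e" using wf by (simp add: wf_problem_def)
  then show "0 \<le> lam N (par k, k) \<and> 0 \<le> mu N (par k, k)" using k by (auto simp: N_simps)
qed

lemma ssc_N: "1 \<le> k \<Longrightarrow> k \<le> n \<Longrightarrow> smooth_strongly_convex (loss N k)"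
  using wf nu_image by (auto simp: wf_problem_def smooth_strongly_convex_def N_simps)

sublocale labelled N n par
  by unfold_locales (use N_simps n_pos arcs_N par_n ssc_N weights_N in auto)

text \<open>Paths come from the parent map, while a cycle on the labels would be carried by the
  injective \<open>nu\<close> to a cycle of the given tree.\<close>

lemma normalizing_nu: "normalizing G nu"
proof -
  have cyc: "\<not> undirected_cycle (arcs N) p" for p
  proof
    assume p: "undirected_cycle (arcs N) p"
    have E: "adjacent (arcs N) a b \<Longrightarrow> a \<in> {1..n} \<and> b \<in> {1..n} \<and> adjacent (arcs G) (nu a) (nu b)" for a b
      by (auto simp: normalized_def card_nodes adjacent_def)
    have set_p: "set p \<subseteq> {1..n}"
    proof
      fix v assume v: "v \<in> set p"
      then obtain ys zs where yz: "p = ys @ v # zs" by (meson split_list)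
      show "v \<in> {1..n}"
      proof (cases zs)
        case Nil
        then show ?thesis using p yz E[of v] unfolding undirected_cycle_def by auto
      next
        case (Cons z zs')
        then show ?thesis using p yz E[of v z] unfolding undirected_cycle_def by (auto simp: successively_append_iff)
      qed
    qed
    have "successively (adjacent (arcs G)) (map nu p)"
      unfolding successively_map
      by (rule successively_mono[of "adjacent (arcs N)"]) (use p E in \<open>auto simp: undirected_cycle_def\<close>)
    moreover have "inj_on nu (set p)" using bij_nu set_p by (auto simp: bij_betw_def elim!: inj_on_subset)
    moreover have "p \<noteq> []" using p unfolding undirected_cycle_def by auto
    ultimately have "undirected_cycle (arcs G) (map nu p)"
      using p E[of "last p" "hd p"] unfolding undirected_cycle_def
      by (simp add: distinct_map hd_map last_map)
    then show False using tree unfolding directed_tree_def by blast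
  qed
  have "directed_tree (nodes N) (arcs N)"
    unfolding directed_tree_def
  proof (intro conjI)
    show "finite (nodes N)" "nodes N \<noteq> {}" using n_pos by (auto simp: N_simps)
    show "arcs N \<subseteq> nodes N \<times> nodes N" using par_n unfolding arcs_N N_simps by force
    show "\<forall>(u, v)\<in>arcs N. u \<noteq> v \<and> (v, u) \<notin> arcs N" 
    proof -
      have "u < v" if "(u, v) \<in> arcs N" for u v using that par_n unfolding arcs_N by auto
      then have "u \<noteq> v \<and> (v, u) \<notin> arcs N" if "(u, v) \<in> arcs N" for u v
        using that by (metis less_asym less_irrefl)
      then show ?thesis by blast
    qed
    show "\<forall>u\<in>nodes N. \<forall>v\<in>nodes N. \<exists>p. undirected_path (arcs N) u p v"
      unfolding arcs_N N_simps using parent_paths[of n par] par_n by blast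
    show "\<nexists>p. undirected_cycle (arcs N) p" using cyc by blast
  qed
  moreover have "{v \<in> nodes N. \<forall>u. (u, v) \<notin> arcs N} = {1}"
    using n_pos unfolding arcs_N N_simps by (auto simp: not_less_eq_eq)
  ultimately show ?thesis using bij_nu by (simp add: normalizing_def arborescence_def card_nodes)
qed

definition orient :: "nat \<times> nat \<Rightarrow> nat \<times> nat" where
  "orient e = (if (nu (fst e), nu (snd e)) \<in> arcs G then (nu (fst e), nu (snd e)) else (nu (snd e), nu (fst e)))"

lemma bij_orient: "bij_betw orient (arcs N) (arcs G)"
proof -
  have N: "e \<in> arcs N \<longleftrightarrow> fst e \<in> {1..n} \<and> snd e \<in> {1..n} \<and> fst e < snd e \<and> adjacent (arcs G) (nu (fst e)) (nu (snd e))" for e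
    by (cases e) (simp add: normalized_def card_nodes)
  have inj: "inj_on orient (arcs N)"
  proof (rule inj_onI)
    fix e e' assume a: "e \<in> arcs N" "e' \<in> arcs N" "orient e = orient e'"
    then have "nu (fst e) = nu (fst e') \<and> nu (snd e) = nu (snd e') \<or> nu (fst e) = nu (snd e') \<and> nu (snd e) = nu (fst e')"
      by (auto simp: orient_def split: if_splits)
    then show "e = e'" using a(1,2) nu_inj unfolding N by (auto simp: prod_eq_iff)
  qed
  have "orient ` arcs N = arcs G"
  proof
    show "orient ` arcs N \<subseteq> arcs G" by (auto simp: N orient_def adjacent_def)
    show "arcs G \<subseteq> orient ` arcs N"
    proof
      fix e assume e: "e \<in> arcs G"
      obtain u v where uv: "e = (u, v)" by (cases e)
      then have "u \<in> nodes G" "v \<in> nodes G" "u \<noteq> v" using e arc_nodes no_reverse by auto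
      then obtain i j where ij: "i \<in> {1..n}" "j \<in> {1..n}" "u = nu i" "v = nu j" "i \<noteq> j"
        unfolding nu_image[symmetric] by blast
      show "e \<in> orient ` arcs N"
      proof (cases "i < j")
        case True
        then show ?thesis using e uv ij
          by (intro image_eqI[of _ _ "(i, j)"]) (auto simp: N orient_def adjacent_def)
      next
        case False
        then show ?thesis using e uv ij no_reverse
          by (intro image_eqI[of _ _ "(j, i)"]) (auto simp: N orient_def adjacent_def)
      qed
    qed
  qed
  then show ?thesis using inj by (simp add: bij_betw_def)
qed

text \<open>Keeps normalization quadratic: each of the labelling rounds scans the whole list
  \<open>es\<close>.\<close>

lemma length_es: "length es \<le> n"
proof -
  have "length es = card (arcs N)" using es distinct_card bij_betw_same_card[OF bij_orient] by metis
  also have "arcs N \<subseteq> (\<lambda>k. (par k, k)) ` {1..n}" unfolding arcs_N by auto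
  then have "card (arcs N) \<le> card ((\<lambda>k. (par k, k)) ` {1..n})" by (intro card_mono) auto
  also have "\<dots> \<le> n" using card_image_le[of "{1..n}"] by simp
  finally show ?thesis .
qed

text \<open>Reversing an arc exchanges its end nodes and its two weights, which only swaps the two
  penalty terms of the arc.\<close>

lemma objective_N: "objective G y = objective N (\<lambda>i. y (nu i))"
proof -
  have "(\<Sum>v\<in>nodes G. ereal (loss G v (y v))) = (\<Sum>i\<in>{1..n}. ereal (loss N i (y (nu i))))"
    by (subst sum.reindex_bij_betw[OF bij_nu, symmetric]) (simp add: N_simps)
  moreover have "(\<Sum>(i, j)\<in>arcs G. lam G (i, j) * ereal (max 0 (y i - y j))) + (\<Sum>(i, j)\<in>arcs G. mu G (i, j) * ereal (max 0 (y j - y i)))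
     = (\<Sum>e\<in>arcs N. arc_cost (\<lambda>i. y (nu i)) e)"
  proof -
    have "(\<Sum>(i, j)\<in>arcs G. lam G (i, j) * ereal (max 0 (y i - y j))) + (\<Sum>(i, j)\<in>arcs G. mu G (i, j) * ereal (max 0 (y j - y i)))
      = (\<Sum>e\<in>arcs G. lam G e * ereal (max 0 (y (fst e) - y (snd e))) + mu G e * ereal (max 0 (y (snd e) - y (fst e))))"
      by (simp add: sum.distrib case_prod_beta)
    also have "\<dots> = (\<Sum>e\<in>arcs N. lam G (orient e) * ereal (max 0 (y (fst (orient e)) - y (snd (orient e))))
        + mu G (orient e) * ereal (max 0 (y (snd (orient e)) - y (fst (orient e)))))"
      by (rule sum.reindex_bij_betw[OF bij_orient, symmetric])
    also have "\<dots> = (\<Sum>e\<in>arcs N. arc_cost (\<lambda>i. y (nu i)) e)"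
    proof (rule sum.cong)
      fix e :: "nat \<times> nat"
      show "lam G (orient e) * ereal (max 0 (y (fst (orient e)) - y (snd (orient e))))
        + mu G (orient e) * ereal (max 0 (y (snd (orient e)) - y (fst (orient e)))) = arc_cost (\<lambda>i. y (nu i)) e"
        by (cases e) (simp add: orient_def arc_cost_def N_simps add.commute)
    qed simp
    finally show ?thesis .
  qed
  ultimately show ?thesis unfolding objective_eq unfolding objective_def by (simp add: add.assoc)
qed

lemma minimizer_N:
  assumes "is_minimizer N x" "\<And>i. i \<in> {1..n} \<Longrightarrow> y (nu i) = x i"
  shows "is_minimizer G y"
  unfolding is_minimizer_def
proof
  fix y'
  have "arc_cost (\<lambda>i. y (nu i)) e = arc_cost x e" if "e \<in> arcs N" for e
    using arc_range[OF that] assms(2) by (simp add: arc_cost_def)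
  then have "objective N (\<lambda>i. y (nu i)) = objective N x"
    unfolding objective_eq using assms(2) by (intro arg_cong2[where f = "(+)"] arg_cong[where f = ereal] sum.cong) auto
  then show "objective G y \<le> objective G y'"
    using assms(1) unfolding objective_N is_minimizer_def by simp
qed

end

section \<open>Normalization, algorithm and the cubic bound combined\<close>

section \<open>The whole algorithm\<close>

lemma (in listed_problem) asra_run:
  assumes K: "\<And>g y. smooth_strongly_convex g \<Longrightarrow> inv_cost g y \<le> K"
  shows "runs (asra_tm inv_cost (loss G) (lam G) (mu G) vs es)
    (\<lambda>(nu, y, z). normalizing G nu \<and> (\<exists>x. asra (normalized G nu) = Some (x, z) \<and>
       (\<forall>i\<in>{1..n}. y (nu i) = x i)) \<and> is_minimizer G y \<and> length es \<le> n)
    (5 * Suc n + ((n - 1) * (length es * 2 + 3) + 3) + (Suc n + (n * 2 + 1 + (260 * (K + 1) * n ^ 3 + (Suc n + (n * 2 + 1 + 1))))))"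
  unfolding asra_tm_def
proof (rule runs_bind[OF labelling_run])
  fix a assume a: "case a of (nu, par, la, mv) \<Rightarrow> labelling n nu par la mv"
  obtain nu par la mv where eq: "a = (nu, par, la, mv)" by (cases a)
  interpret labelled_problem G vs es nu par la mv
    using a by unfold_locales (simp add: eq)
  define fl where "fl = fold (\<lambda>k fl. fl(k := loss G (nu k))) [1..<Suc n] (\<lambda>_. loss G (hd vs))"
  have fl: "fl k = loss N k" if "1 \<le> k" "k \<le> n" for k
    unfolding fl_def fold_array_all using that by (simp add: N_simps del: upt_Suc)
  interpret program N n par inv_cost fl la mv K
    using K fl weights_N by unfold_locales auto
  obtain x z where xz: "asra N = Some (x, z)" "kkt N n x z"
    and run: "runs (asra_labelled_tm inv_cost fl par la mv n) (\<lambda>a. a = (x, z)) (260 * (K + 1) * n ^ 3)"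
    using labelled_run by blast
  define y where "y = fold (\<lambda>k y. y(nu k := x k)) [1..<Suc n] (\<lambda>_. 0)"
  have y: "y (nu i) = x i" if "i \<in> {1..n}" for i
  proof -
    have "i \<in> set [1..<Suc n]" using that by (simp del: upt_Suc)
    moreover have "inj_on nu {k \<in> set [1..<Suc n]. True}" using nu_inj by (auto simp: inj_on_def simp del: upt_Suc)
    ultimately have "fold (\<lambda>k y. if True then y(nu k := x k) else y) [1..<Suc n] (\<lambda>_. 0) (nu i) = x i"
      by (intro fold_array_inj(1)[where a = nu and P = "\<lambda>_. True"] TrueI)
    then show ?thesis unfolding y_def by (simp only: if_True)
  qed
  have len: "length [1..<Suc n] * 2 + 1 = n * 2 + 1" by (simp del: upt_Suc)
  show "runs (case a of (nu, par, la, mv) \<Rightarrow> do {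
      fl0 \<leftarrow> new_array n (loss G (hd vs));
      fl \<leftarrow> for_tm [1..<Suc n] (\<lambda>k fl. step (fl(k := loss G (nu k)))) fl0;
      (x, z) \<leftarrow> asra_labelled_tm inv_cost fl par la mv n;
      y0 \<leftarrow> new_array n 0;
      y \<leftarrow> for_tm [1..<Suc n] (\<lambda>k y. step (y(nu k := x k))) y0;
      step (nu, y, z)})
    (\<lambda>(nu, y, z). normalizing G nu \<and> (\<exists>x. asra (normalized G nu) = Some (x, z) \<and>
       (\<forall>i\<in>{1..n}. y (nu i) = x i)) \<and> is_minimizer G y \<and> length es \<le> n)
    (Suc n + (n * 2 + 1 + (260 * (K + 1) * n ^ 3 + (Suc n + (n * 2 + 1 + 1)))))"
    unfolding eq prod.case
  proof (rule runs_bind_value[OF runs_new_array_value], rule runs_bind_value[OF runs_for_step[of "[1..<Suc n]", unfolded len]],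
      fold fl_def, rule runs_bind_value[OF run], unfold prod.case,
      rule runs_bind_value[OF runs_new_array_value], rule runs_bind_value[OF runs_for_step[of "[1..<Suc n]", unfolded len]], fold y_def)
    show "runs (step (nu, y, z))
      (\<lambda>(nu, y, z). normalizing G nu \<and> (\<exists>x. asra (normalized G nu) = Some (x, z) \<and>
       (\<forall>i\<in>{1..n}. y (nu i) = x i)) \<and> is_minimizer G y \<and> length es \<le> n) 1"
      using normalizing_nu xz y minimizer_N[OF kkt_minimizer[OF xz(2)] y] length_es
      by (simp add: runs_def step_def)
  qed
qed

theorem mainTheorem2:
  fixes inv_cost :: "(real \<Rightarrow> real) \<Rightarrow> real \<Rightarrow> nat"
  assumes inv_cost_bounded:
    "\<exists>K. \<forall>f y. differentiable_everywhere f \<and> strongly_convex f \<longrightarrow> inv_cost f y \<le> K"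
  shows "\<exists>T :: nat \<Rightarrow> real. T \<in> O(\<lambda>n. real n ^ 3) \<and>
    (\<forall>G vs es.
       wf_problem G \<and> distinct vs \<and> set vs = nodes G \<and> distinct es \<and> set es = arcs G \<longrightarrow>
       (\<exists>nu y z x' z' c.
          asra_tm inv_cost (loss G) (lam G) (mu G) vs es = Run (nu, y, z) c \<and>
          normalizing G nu \<and>
          asra (normalized G nu) = Some (x', z') \<and>
          (\<forall>i\<in>{1..card (nodes G)}. y (nu i) = x' i) \<and>
          (\<forall>e\<in>arcs (normalized G nu). z e = z' e) \<and>
          is_minimizer G y \<and>
          real c \<le> T (card (nodes G))))"
proof -
  \<comment> \<open>\<open>K\<close> bounds the inversions for all smooth strongly convex functions,
    sums of losses included, and is fixed before any problem; hence one \<open>T\<close> serves all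
    of them.\<close>
  obtain K where K: "\<And>f y. smooth_strongly_convex f \<Longrightarrow> inv_cost f y \<le> K"
    using inv_cost_bounded unfolding smooth_strongly_convex_def by blast
  show ?thesis
  \<comment> \<open>The part with \<open>260 * (K + 1)\<close> pays for the stages. Normalization
    and copying cost at most \<open>2 * (n * n) + 14 * n + 13\<close>, which is below
    \<open>40 * n ^ 3\<close> for positive \<open>n\<close>.\<close>
  proof (intro exI[of _ "\<lambda>n. real (260 * (K + 1) + 40) * real n ^ 3"] conjI allI impI)
    show "(\<lambda>n. real (260 * (K + 1) + 40) * real n ^ 3) \<in> O(\<lambda>n. real n ^ 3)" by simp
    fix G vs es
    assume a: "wf_problem G \<and> distinct vs \<and> set vs = nodes G \<and> distinct es \<and> set es = arcs G"
    interpret listed_problem G vs es using a by unfold_locales auto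
    obtain nu y z c where run: "asra_tm inv_cost (loss G) (lam G) (mu G) vs es = Run (nu, y, z) c"
      and post: "normalizing G nu" "\<exists>x. asra (normalized G nu) = Some (x, z) \<and> (\<forall>i\<in>{1..n}. y (nu i) = x i)"
        "is_minimizer G y" "length es \<le> n"
      and c: "c \<le> 5 * Suc n + ((n - 1) * (length es * 2 + 3) + 3) +
        (Suc n + (n * 2 + 1 + (260 * (K + 1) * n ^ 3 + (Suc n + (n * 2 + 1 + 1)))))"
      using asra_run[of inv_cost K, OF K] unfolding runs_def by auto
    have n3: "n \<le> n ^ 3" "1 \<le> n ^ 3" using n_pos by (simp_all add: self_le_power)
    have "n * n \<le> n ^ 3" using n_pos by (simp add: power3_eq_cube)
    moreover have "(n - 1) * (length es * 2 + 3) \<le> n * (n * 2 + 3)"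
      using post(4) by (intro mult_le_mono) auto
    then have "(n - 1) * (length es * 2 + 3) \<le> 2 * (n * n) + 3 * n" by (simp add: algebra_simps)
    moreover have "c \<le> q + 40 * t"
      if "c \<le> 5 * Suc k + (b + 3) + (Suc k + (k * 2 + 1 + (q + (Suc k + (k * 2 + 1 + 1)))))"
        "s \<le> t" "b \<le> 2 * s + 3 * k" "k \<le> t" "1 \<le> t" for b q s t k :: nat
    proof -
      have "c \<le> 11 * k + 13 + b + q" using that(1) by simp
      then show ?thesis using that(2-5) by linarith
    qed
    ultimately have "c \<le> 260 * (K + 1) * n ^ 3 + 40 * n ^ 3" using c n3 by blast
    then have "c \<le> (260 * (K + 1) + 40) * n ^ 3" by (simp only: distrib_right)
    then have "real c \<le> real ((260 * (K + 1) + 40) * n ^ 3)" by (simp only: of_nat_le_iff)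
    then have "real c \<le> real (260 * (K + 1) + 40) * real (card (nodes G)) ^ 3"
      by (simp only: card_nodes of_nat_mult of_nat_power)
    with run post show "\<exists>nu y z x' z' c.
          asra_tm inv_cost (loss G) (lam G) (mu G) vs es = Run (nu, y, z) c \<and>
          normalizing G nu \<and>
          asra (normalized G nu) = Some (x', z') \<and>
          (\<forall>i\<in>{1..card (nodes G)}. y (nu i) = x' i) \<and>
          (\<forall>e\<in>arcs (normalized G nu). z e = z' e) \<and>
          is_minimizer G y \<and>
          real c \<le> real (260 * (K + 1) + 40) * real (card (nodes G)) ^ 3"
      unfolding card_nodes by blast
  qed
qed

end
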